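(* Let $k$ be an algebraically closed field of characteristic zero and let $X=V(f)\subset\mathbb{P}^3$ be a reduced hypersurface of degree $d\geq 3$ over $k$. Then $X=V(f)$ has vanishing Hessian (i.e. $h_f\equiv 0$) if and only if $X$ is a cone. More precisely, $X=V(f)$ has vanishing Hessian if and only if either $X$ is a cone over a curve with vertex a point, or $X$ consists of $d$ distinct planes through a line. In the first case $Z(f)$ is a plane in $\mathbb{P}^{3*}$, while in the second case $Z(f)$ is a line in $\mathbb{P}^{3*}$.
   Context: For homogeneous $f\in k[x_0,\ldots,x_n]$: the Hessian polynomial is $h_f:=\det\left(\frac{\partial^2 f}{\partial x_i\partial x_j}\right)_{i,j=0,\ldots,n}$; the polar map is the rational map $\phi_f:\mathbb{P}^n\dashrightarrow\mathbb{P}^{n*}$, $p\mapsto(\frac{\partial f}{\partial x_0}(p):\ldots:\frac{\partial f}{\partial x_n}(p))$; the polar image $Z(f)\subset\mathbb{P}^{n*}$ is the closure of the image of $\phi_f$. A hypersurface $X=V(f)\subset\mathbb{P}^n$ is a cone if, modulo projective transformations of $\mathbb{P}^n$, the equation defining $X$ does not depend on all the variables; equivalently $\mathrm{Vert}(X)=\{x\in X: J(x,X)=X\}\neq\emptyset$, where $J(x,X)=\overline{\bigcup_{y\in X,\,y\neq x}\langle x,y\rangle}$. The set $\mathrm{Vert}(X)$ is the vertex of $X$; "cone with vertex a point" means that the vertex is exactly one point. *)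

theory Defs
  imports
    "HOL-Analysis.Analysis"
    "HOL-Library.Poly_Mapping"
    "HOL-Computational_Algebra.Computational_Algebra"
begin

section \<open>Polynomials in variables indexed by a finite type\<close>

text \<open>
  The keys of a polynomial are its monomials, given by their exponents. For \<open>k[x\<^sub>0,\<dots>,x\<^sub>n]\<close> the
  index type has \<open>n + 1\<close> elements.
\<close>

type_synonym ('n, 'a) mpoly = "('n \<Rightarrow>\<^sub>0 nat) \<Rightarrow>\<^sub>0 'a"

definition mp_const :: "'a::zero \<Rightarrow> ('n, 'a) mpoly" where
  "mp_const c = Poly_Mapping.single 0 c"

definition mp_var :: "'n \<Rightarrow> ('n, 'a::zero_neq_one) mpoly" where
  "mp_var i = Poly_Mapping.single (Poly_Mapping.single i 1) 1"

definition mp_vars :: "('n, 'a::zero) mpoly \<Rightarrow> 'n set" where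
  "mp_vars f = (\<Union>m\<in>Poly_Mapping.keys f. Poly_Mapping.keys m)"

definition mp_homogeneous :: "nat \<Rightarrow> ('n::finite, 'a::zero) mpoly \<Rightarrow> bool" where
  "mp_homogeneous d f \<longleftrightarrow>
     (\<forall>m\<in>Poly_Mapping.keys f. (\<Sum>i\<in>UNIV. Poly_Mapping.lookup m i) = d)"

definition mp_insertion ::
    "('a::zero \<Rightarrow> 'b::comm_semiring_1) \<Rightarrow> ('n::finite \<Rightarrow> 'b) \<Rightarrow> ('n, 'a) mpoly \<Rightarrow> 'b" where
  "mp_insertion c b f =
     (\<Sum>m\<in>Poly_Mapping.keys f.
        c (Poly_Mapping.lookup f m) * (\<Prod>i\<in>UNIV. b i ^ Poly_Mapping.lookup m i))"

definition mp_eval :: "('n::finite, 'a::comm_semiring_1) mpoly \<Rightarrow> 'a ^ 'n \<Rightarrow> 'a" where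
  "mp_eval f v = mp_insertion (\<lambda>c. c) (\<lambda>i. v $ i) f"

text \<open>The polynomial \<open>f(A x)\<close>.\<close>

definition mp_lin_subst ::
    "'a::comm_semiring_1 ^ 'n ^ 'n \<Rightarrow> ('n::finite, 'a) mpoly \<Rightarrow> ('n, 'a) mpoly" where
  "mp_lin_subst A f =
     mp_insertion mp_const (\<lambda>i. \<Sum>j\<in>UNIV. mp_const (A $ i $ j) * mp_var j) f"

text \<open>
  The subtraction of exponents is truncated, but a monomial in which \<open>x\<^sub>i\<close> does not occur
  contributes the coefficient \<open>0\<close>.
\<close>

definition mp_pderiv :: "'n \<Rightarrow> ('n, 'a::comm_semiring_1) mpoly \<Rightarrow> ('n, 'a) mpoly" where
  "mp_pderiv i f =
     (\<Sum>m\<in>Poly_Mapping.keys f.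
        Poly_Mapping.single (m - Poly_Mapping.single i 1)
          (of_nat (Poly_Mapping.lookup m i) * Poly_Mapping.lookup f m))"

definition hessian :: "('n::finite, 'a::comm_ring_1) mpoly \<Rightarrow> ('n, 'a) mpoly" where
  "hessian f = det (\<chi> i j. mp_pderiv i (mp_pderiv j f))"


section \<open>Projective space\<close>

text \<open>
  A point of projective space is a one-dimensional linear subspace of \<open>k\<^sup>n\<^sup>+\<^sup>1\<close>. The dual space is
  represented in the same way, through the dual coordinates.
\<close>

definition proj_point :: "'a::field ^ 'n \<Rightarrow> ('a ^ 'n) set" where
  "proj_point v = vec.span {v}"

definition proj_space :: "('a::field ^ 'n) set set" where
  "proj_space = {proj_point v | v. v \<noteq> 0}"

definition proj_linear :: "('a::field ^ 'n) set \<Rightarrow> ('a ^ 'n) set set" where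
  "proj_linear W = {p \<in> proj_space. p \<subseteq> W}"

definition proj_line_through ::
    "('a::field ^ 'n) set \<Rightarrow> ('a ^ 'n) set \<Rightarrow> ('a ^ 'n) set set" where
  "proj_line_through p q = proj_linear (vec.span (p \<union> q))"

definition is_proj_line :: "('a::field ^ 'n) set set \<Rightarrow> bool" where
  "is_proj_line S \<longleftrightarrow> (\<exists>W. vec.subspace W \<and> vec.dim W = 2 \<and> S = proj_linear W)"

definition is_proj_plane :: "('a::field ^ 'n) set set \<Rightarrow> bool" where
  "is_proj_plane S \<longleftrightarrow> (\<exists>W. vec.subspace W \<and> vec.dim W = 3 \<and> S = proj_linear W)"

definition proj_zeros :: "('n::finite, 'a::field) mpoly set \<Rightarrow> ('a ^ 'n) set set" where
  "proj_zeros G = {p \<in> proj_space. \<forall>g\<in>G. \<forall>v\<in>p. mp_eval g v = 0}"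

definition proj_hypersurface :: "('n::finite, 'a::field) mpoly \<Rightarrow> ('a ^ 'n) set set" where
  "proj_hypersurface f = proj_zeros {f}"

definition zariski_closed :: "('a::field ^ 'n::finite) set set \<Rightarrow> bool" where
  "zariski_closed S \<longleftrightarrow> (\<exists>G. (\<forall>g\<in>G. \<exists>e. mp_homogeneous e g) \<and> S = proj_zeros G)"

definition zariski_closure :: "('a::field ^ 'n::finite) set set \<Rightarrow> ('a ^ 'n) set set" where
  "zariski_closure S = zariski_closed hull S"


section \<open>The polar image\<close>

definition gradient :: "('n::finite, 'a::field) mpoly \<Rightarrow> 'a ^ 'n \<Rightarrow> 'a ^ 'n" where
  "gradient f v = (\<chi> i. mp_eval (mp_pderiv i f) v)"

definition polar_image :: "('n::finite, 'a::field) mpoly \<Rightarrow> ('a ^ 'n) set set" where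
  "polar_image f =
     zariski_closure {proj_point (gradient f v) | v. v \<noteq> 0 \<and> gradient f v \<noteq> 0}"


section \<open>Cones\<close>

text \<open>
  This is meant for \<open>f\<close> a square-free form, so that \<open>f\<close> is the equation of its zero locus up to a
  scalar.
\<close>

definition is_cone :: "('n::finite, 'a::field) mpoly \<Rightarrow> bool" where
  "is_cone f \<longleftrightarrow> (\<exists>A. invertible A \<and> mp_vars (mp_lin_subst A f) \<noteq> UNIV)"

definition proj_join ::
    "('a::field ^ 'n::finite) set \<Rightarrow> ('a ^ 'n) set set \<Rightarrow> ('a ^ 'n) set set" where
  "proj_join p X = zariski_closure (\<Union>q\<in>X - {p}. proj_line_through p q)"

definition proj_vertex :: "('a::field ^ 'n::finite) set set \<Rightarrow> ('a ^ 'n) set set" where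
  "proj_vertex X = {p \<in> X. proj_join p X = X}"

text \<open>A plane curve may be reducible.\<close>

definition is_plane_curve ::
    "('a::field ^ 'n::finite) set set \<Rightarrow> ('a ^ 'n) set set \<Rightarrow> bool" where
  "is_plane_curve H C \<longleftrightarrow>
     is_proj_plane H \<and>
     (\<exists>g e. e > 0 \<and> mp_homogeneous e g \<and> C = H \<inter> proj_hypersurface g \<and> C \<noteq> H)"

definition is_cone_over_curve_with_point_vertex ::
    "('a::field ^ 'n::finite) set set \<Rightarrow> bool" where
  "is_cone_over_curve_with_point_vertex X \<longleftrightarrow>
     (\<exists>p H C. is_plane_curve H C \<and> p \<in> proj_space \<and> p \<notin> H \<and>
        X = proj_join p C \<and> proj_vertex X = {p})"

definition consists_of_planes_through_line ::
    "nat \<Rightarrow> ('a::field ^ 'n) set set \<Rightarrow> bool" where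
  "consists_of_planes_through_line d X \<longleftrightarrow>
     (\<exists>L P. is_proj_line L \<and> finite P \<and> card P = d \<and>
        (\<forall>H\<in>P. is_proj_plane H \<and> L \<subseteq> H) \<and> X = \<Union>P)"

end

theory Submission
  imports Defs "Berlekamp_Zassenhaus.Unique_Factorization_Poly"
begin

no_notation fps_nth (infixl "$" 75)
no_notation Matrix.vec_index (infixl "$" 100)
hide_const (open) Matrix.vec Matrix.mat Matrix.row Matrix.col Determinant.det
hide_fact (open) Matrix.vec_eq_iff

text \<open>
  Let \<open>V\<close> be the space of all \<open>q\<close> with \<open>D\<^sub>q f = 0\<close>. It is the vertex of \<open>X\<close>: if the zero set of \<open>f\<close> is
  stable under translation along \<open>q\<close>, then \<open>f\<close> has no root or vanishes on each line in direction
  \<open>q\<close>, hence is constant there. Since \<open>f\<close> is square-free, \<open>dim V \<le> 2\<close>, and \<open>f\<close> is a product of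
  linear forms if \<open>dim V = 2\<close>.

  The core is the theorem of Gordan and Noether: a form \<open>g\<close> with \<open>g(\<nabla>f) = 0\<close> vanishes on the
  orthogonal complement of \<open>V\<close>, which is therefore the polar image. The components of
  \<open>h = (\<nabla>g)(\<nabla>f)\<close>, \<open>\<nabla>f\<close> and \<open>f\<close> are invariant under \<open>x \<mapsto> x + t h(x)\<close>. This remains true when
  \<open>h\<close> is divided by a common factor. Then \<open>h\<close> vanishes on its own image, and elimination shows that
  the rank of its Jacobian matrix is at most \<open>2\<close>. So the fibre of \<open>h\<close> over a point \<open>p\<close> of projective
  space is a hypersurface; it contains the image of \<open>h\<close> and is invariant under translation along \<open>p\<close>.
  As two fibres meet in zeros of \<open>h\<close> only, \<open>h\<close> vanishes on the span of three general values.
  Because no linear form divides \<open>h\<close>, the values of \<open>h\<close> span at most a plane, \<open>h = \<alpha> p + \<beta> q\<close>, and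
  differentiating \<open>\<alpha> D\<^sub>p f + \<beta> D\<^sub>q f = 0\<close> one finds that all values of \<open>h\<close> belong to \<open>V\<close>.
  By induction on the degree of \<open>g\<close>, this forces \<open>g = 0\<close> on the complement.

  Finally, if the Hessian vanishes, a form \<open>g \<noteq> 0\<close> with \<open>g(\<nabla>f) = 0\<close> exists by the Jacobian
  criterion, so that \<open>V \<noteq> 0\<close>.
\<close>

subsection \<open>Insertion homomorphisms\<close>

text \<open>No dimension theory is used; two facts take its place. Elimination: polynomials that are
  not all 0 share a prime factor or have a nonzero combination free of a prescribed variable.
  Differentiation: in characteristic 0, a set of polynomials that is closed under partial
  derivatives and has a nonzero element contains a nonzero constant. That a fibre of
  \<open>h\<close> is a hypersurface means here that its equations share a prime factor. Otherwise
  their ideal has a nonzero element free of \<open>x_l\<close>. Differentiation along fields tangent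
  to the fibre keeps it in the saturation of the ideal with respect to a suitable \<open>w\<close>,
  so a power of \<open>w\<close> lies in the ideal, although \<open>w\<close> is nonzero at a point
  of the fibre. Coprime components of \<open>h\<close> are essential twice: for elimination applied
  to \<open>h\<close> itself, and to exclude a linear form dividing \<open>h\<close>. The number
  four enters through the Jacobian matrix, where one of four rows can be avoided by a kernel vector,
  leaving exactly a 3 by 3 minor, and because three independent values of \<open>h\<close> span a
  hyperplane, the zero set of a single linear form.\<close>

abbreviation mp_coeff :: "('n, 'a::zero) mpoly \<Rightarrow> ('n \<Rightarrow>\<^sub>0 nat) \<Rightarrow> 'a" where
  "mp_coeff \<equiv> Poly_Mapping.lookup"

abbreviation expo :: "('n \<Rightarrow>\<^sub>0 nat) \<Rightarrow> 'n \<Rightarrow> nat" where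
  "expo \<equiv> Poly_Mapping.lookup"

lemma mp_sum_singles:
  "(p :: ('n, 'a::comm_monoid_add) mpoly) = (\<Sum>m\<in>Poly_Mapping.keys p. Poly_Mapping.single m (mp_coeff p m))"
proof (rule poly_mapping_eqI)
  fix k
  show "mp_coeff p k = mp_coeff (\<Sum>m\<in>Poly_Mapping.keys p. Poly_Mapping.single m (mp_coeff p m)) k"
    by (cases "k \<in> Poly_Mapping.keys p")
      (auto simp: lookup_sum lookup_single when_def in_keys_iff)
qed

lemma mp_insertion_superset:
  assumes "finite S" "Poly_Mapping.keys p \<subseteq> S" "c 0 = 0"
  shows "mp_insertion c b p = (\<Sum>m\<in>S. c (mp_coeff p m) * (\<Prod>i\<in>UNIV. b i ^ expo m i))"
  unfolding mp_insertion_def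
  by (rule sum.mono_neutral_left) (use assms in \<open>auto simp: in_keys_iff\<close>)

lemma mp_insertion_zero [simp]: "mp_insertion c b 0 = 0"
  by (simp add: mp_insertion_def)

lemma mp_insertion_single:
  "c 0 = 0 \<Longrightarrow> mp_insertion c b (Poly_Mapping.single m a) = c a * (\<Prod>i\<in>UNIV. b i ^ expo m i)"
  by (subst mp_insertion_superset[where S = "{m}"]) auto

lemma mp_insertion_add:
  fixes c :: "'a::comm_monoid_add \<Rightarrow> 'b::comm_semiring_1"
  assumes "c 0 = 0" "\<And>x y. c (x + y) = c x + c y"
  shows "mp_insertion c b (p + q) = mp_insertion c b p + mp_insertion c b q"
proof -
  let ?S = "Poly_Mapping.keys p \<union> Poly_Mapping.keys q"
  have "mp_insertion c b (p + q) = (\<Sum>m\<in>?S. c (mp_coeff (p + q) m) * (\<Prod>i\<in>UNIV. b i ^ expo m i))"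
    using keys_add[of p q] assms(1) by (intro mp_insertion_superset) auto
  also have "\<dots> = (\<Sum>m\<in>?S. c (mp_coeff p m) * (\<Prod>i\<in>UNIV. b i ^ expo m i)) +
      (\<Sum>m\<in>?S. c (mp_coeff q m) * (\<Prod>i\<in>UNIV. b i ^ expo m i))"
    by (simp add: lookup_add assms(2) distrib_right sum.distrib)
  also have "\<dots> = mp_insertion c b p + mp_insertion c b q"
    using assms(1) by (subst (1 2) mp_insertion_superset[where S = ?S]) auto
  finally show ?thesis .
qed

lemma mp_insertion_sum:
  fixes c :: "'a::comm_monoid_add \<Rightarrow> 'b::comm_semiring_1"
  assumes "c 0 = 0" "\<And>x y. c (x + y) = c x + c y"
  shows "mp_insertion c b (sum p I) = (\<Sum>i\<in>I. mp_insertion c b (p i))"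
  by (induction I rule: infinite_finite_induct) (simp_all add: mp_insertion_add assms)

lemma mp_insertion_mult:
  fixes c :: "'a::comm_semiring_1 \<Rightarrow> 'b::comm_semiring_1"
  assumes c: "c 0 = 0" "\<And>x y. c (x + y) = c x + c y" "\<And>x y. c (x * y) = c x * c y"
  shows "mp_insertion c b (p * q) = mp_insertion c b p * mp_insertion c b q"
proof -
  have *: "mp_insertion c b (Poly_Mapping.single m x * Poly_Mapping.single n y) =
      mp_insertion c b (Poly_Mapping.single m x) * mp_insertion c b (Poly_Mapping.single n y)" for m n x y
    by (simp add: mult_single mp_insertion_single c lookup_add power_add prod.distrib mult_ac)
  have "mp_insertion c b (p * q) =
      mp_insertion c b ((\<Sum>m\<in>Poly_Mapping.keys p. Poly_Mapping.single m (mp_coeff p m)) *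
        (\<Sum>m\<in>Poly_Mapping.keys q. Poly_Mapping.single m (mp_coeff q m)))"
    by (simp flip: mp_sum_singles)
  also have "\<dots> = mp_insertion c b (\<Sum>m\<in>Poly_Mapping.keys p. Poly_Mapping.single m (mp_coeff p m)) *
        mp_insertion c b (\<Sum>m\<in>Poly_Mapping.keys q. Poly_Mapping.single m (mp_coeff q m))"
    by (simp add: sum_product mp_insertion_sum c * )
  finally show ?thesis by (simp flip: mp_sum_singles)
qed

lemma mp_insertion_const [simp]: "c 0 = 0 \<Longrightarrow> mp_insertion c b (mp_const a) = c a"
  by (simp add: mp_const_def mp_insertion_single)

lemma mp_insertion_var [simp]: "c 0 = 0 \<Longrightarrow> c 1 = 1 \<Longrightarrow> mp_insertion c b (mp_var i) = b i"
  by (simp add: mp_var_def mp_insertion_single lookup_single when_def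
      if_distrib[where f = "\<lambda>n. b _ ^ n"] cong: if_cong)

lemma mp_const_0 [simp]: "mp_const 0 = 0" by (simp add: mp_const_def)
lemma mp_const_1 [simp]: "mp_const 1 = 1" by (simp add: mp_const_def)
lemma mp_const_add: "mp_const (a + b) = mp_const a + mp_const b" by (simp add: mp_const_def single_add)
lemma mp_const_mult: "mp_const (a * b) = mp_const a * mp_const b" by (simp add: mp_const_def mult_single)
lemma mp_const_minus: "mp_const (a - b) = mp_const a - mp_const (b :: 'a::ab_group_add)"
  by (simp add: mp_const_def single_diff)
lemma mp_const_eq_0_iff [simp]: "mp_const a = 0 \<longleftrightarrow> a = 0"
  by (metis mp_const_def lookup_single_eq single_zero)
lemma mp_const_eq_iff [simp]: "mp_const a = mp_const b \<longleftrightarrow> a = b"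
  by (metis mp_const_def lookup_single_eq)
lemma of_nat_eq_mp_const: "of_nat n = mp_const (of_nat n)"
  by (simp add: mp_const_def)

lemma mp_insertion_one [simp]: "c 0 = 0 \<Longrightarrow> c 1 = 1 \<Longrightarrow> mp_insertion c b 1 = 1"
  using mp_insertion_const[of c b 1] by simp

lemma mp_insertion_minus:
  fixes c :: "'a::comm_ring_1 \<Rightarrow> 'b::comm_ring_1"
  assumes "c 0 = 0" "\<And>x y. c (x + y) = c x + c y"
  shows "mp_insertion c b (p - q) = mp_insertion c b p - mp_insertion c b q"
  using mp_insertion_add[OF assms, of b "p - q" q] by simp

lemma single_eq_prod_var:
  fixes a :: "'a::comm_semiring_1" and m :: "'n::finite \<Rightarrow>\<^sub>0 nat"
  shows "Poly_Mapping.single m a = mp_const a * (\<Prod>i\<in>UNIV. mp_var i ^ expo m i)"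
proof -
  have pw: "mp_var i ^ n = Poly_Mapping.single (Poly_Mapping.single i n) (1 :: 'a)" for i :: 'n and n
    by (induction n) (simp_all add: mp_var_def mult_single flip: single_add)
  have "(\<Prod>i\<in>S. mp_var i ^ expo m i) =
      Poly_Mapping.single (\<Sum>i\<in>S. Poly_Mapping.single i (expo m i)) (1 :: 'a)" if "finite S" for S
    using that by (induction S) (simp_all add: pw mult_single)
  moreover have "(\<Sum>i\<in>UNIV. Poly_Mapping.single i (expo m i)) = m"
    by (rule poly_mapping_eqI) (simp add: lookup_sum lookup_single when_def)
  ultimately show ?thesis by (simp add: mp_const_def mult_single)
qed

lemma mp_induct [case_names const var add mult]:
  fixes p :: "('n::finite, 'a::comm_semiring_1) mpoly"
  assumes const: "\<And>c. P (mp_const c)" and var: "\<And>i. P (mp_var i)"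
    and add: "\<And>p q. P p \<Longrightarrow> P q \<Longrightarrow> P (p + q)" and mult: "\<And>p q. P p \<Longrightarrow> P q \<Longrightarrow> P (p * q)"
  shows "P p"
proof -
  have pow: "P (mp_var i ^ n)" for i n
    by (induction n) (use const[of 1] in \<open>auto intro: mult var\<close>)
  have prod: "P (\<Prod>i\<in>S. mp_var i ^ m i)" if "finite S" for S :: "'n set" and m
    using that by (induction S) (use const[of 1] in \<open>auto intro: mult pow\<close>)
  have single: "P (Poly_Mapping.single m a)" for m a
    unfolding single_eq_prod_var by (intro mult const prod) simp
  have "P (\<Sum>m\<in>S. Poly_Mapping.single m (mp_coeff p m))" if "finite S" for S
    using that by (induction S) (use const[of 0] in \<open>auto intro: add single\<close>)
  then show ?thesis by (subst mp_sum_singles) simp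
qed

lemma mp_hom_eqI:
  fixes F G :: "('n::finite, 'a::comm_semiring_1) mpoly \<Rightarrow> 'b::comm_semiring_1"
  assumes "\<And>p q. F (p + q) = F p + F q" "\<And>p q. F (p * q) = F p * F q"
    and "\<And>p q. G (p + q) = G p + G q" "\<And>p q. G (p * q) = G p * G q"
    and "\<And>c. F (mp_const c) = G (mp_const c)" "\<And>i. F (mp_var i) = G (mp_var i)"
  shows "F p = G p"
  by (induction p rule: mp_induct) (simp_all add: assms)

lemma mp_eval_zero [simp]: "mp_eval 0 v = 0" by (simp add: mp_eval_def)
lemma mp_eval_add [simp]: "mp_eval (p + q) v = mp_eval p v + mp_eval q v"
  by (simp add: mp_eval_def mp_insertion_add)
lemma mp_eval_mult [simp]: "mp_eval (p * q) v = mp_eval p v * mp_eval q v"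
  by (simp add: mp_eval_def mp_insertion_mult)
lemma mp_eval_minus [simp]: "mp_eval (p - q) v = mp_eval p v - mp_eval (q :: ('n::finite, 'a::comm_ring_1) mpoly) v"
  by (simp add: mp_eval_def mp_insertion_minus)
lemma mp_eval_uminus [simp]: "mp_eval (- q) v = - mp_eval (q :: ('n::finite, 'a::comm_ring_1) mpoly) v"
  using mp_eval_minus[of 0 q v] by simp
lemma mp_eval_const [simp]: "mp_eval (mp_const c) v = c" by (simp add: mp_eval_def)
lemma mp_eval_one [simp]: "mp_eval 1 v = 1" by (simp add: mp_eval_def)
lemma mp_eval_var [simp]: "mp_eval (mp_var i) v = v $ i" by (simp add: mp_eval_def)
lemma mp_eval_power [simp]: "mp_eval (p ^ n) v = mp_eval p v ^ n"
  by (induction n) simp_all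
lemma mp_eval_sum [simp]: "mp_eval (sum p I) v = (\<Sum>i\<in>I. mp_eval (p i) v)"
  by (induction I rule: infinite_finite_induct) simp_all
lemma mp_eval_prod [simp]: "mp_eval (prod p I) v = (\<Prod>i\<in>I. mp_eval (p i) v)"
  by (induction I rule: infinite_finite_induct) simp_all

definition mp_comp :: "('n::finite \<Rightarrow> ('m, 'a::comm_semiring_1) mpoly) \<Rightarrow> ('n, 'a) mpoly \<Rightarrow> ('m, 'a) mpoly" where
  "mp_comp = mp_insertion mp_const"

lemma mp_comp_zero [simp]: "mp_comp F 0 = 0" by (simp add: mp_comp_def)
lemma mp_comp_one [simp]: "mp_comp F 1 = 1" by (simp add: mp_comp_def)
lemma mp_comp_add: "mp_comp F (p + q) = mp_comp F p + mp_comp F q"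
  by (simp add: mp_comp_def mp_insertion_add mp_const_add)
lemma mp_comp_mult: "mp_comp F (p * q) = mp_comp F p * mp_comp F q"
  by (simp add: mp_comp_def mp_insertion_mult mp_const_add mp_const_mult)
lemma mp_comp_const [simp]: "mp_comp F (mp_const c) = mp_const c" by (simp add: mp_comp_def)
lemma mp_comp_var [simp]: "mp_comp F (mp_var i) = F i" by (simp add: mp_comp_def)
lemma mp_comp_sum: "mp_comp F (sum p I) = (\<Sum>i\<in>I. mp_comp F (p i))"
  by (induction I rule: infinite_finite_induct) (simp_all add: mp_comp_add)

lemma mp_eval_comp: "mp_eval (mp_comp F p) v = mp_eval p (\<chi> i. mp_eval (F i) v)"
  by (rule mp_hom_eqI) (simp_all add: mp_comp_add mp_comp_mult)


subsection \<open>Partial derivatives\<close>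

lemma mp_pderiv_superset:
  assumes "finite S" "Poly_Mapping.keys f \<subseteq> S"
  shows "mp_pderiv i f = (\<Sum>m\<in>S. Poly_Mapping.single (m - Poly_Mapping.single i 1)
          (of_nat (expo m i) * mp_coeff f m))"
  unfolding mp_pderiv_def
  by (rule sum.mono_neutral_left) (use assms in \<open>auto simp: in_keys_iff\<close>)

lemma mp_pderiv_single:
  "mp_pderiv i (Poly_Mapping.single m a) =
     Poly_Mapping.single (m - Poly_Mapping.single i 1) (of_nat (expo m i) * a)"
  by (subst mp_pderiv_superset[where S = "{m}"]) auto

lemma mp_pderiv_zero [simp]: "mp_pderiv i 0 = 0" by (simp add: mp_pderiv_def)

lemma mp_pderiv_add: "mp_pderiv i (p + q) = mp_pderiv i p + mp_pderiv i q"
proof -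
  let ?S = "Poly_Mapping.keys p \<union> Poly_Mapping.keys q"
  show ?thesis
    using keys_add[of p q]
    by (subst (1 2 3) mp_pderiv_superset[where S = ?S])
      (auto simp: lookup_add distrib_left single_add sum.distrib)
qed

lemma mp_pderiv_sum: "mp_pderiv i (sum p I) = (\<Sum>j\<in>I. mp_pderiv i (p j))"
  by (induction I rule: infinite_finite_induct) (simp_all add: mp_pderiv_add)

lemma mp_pderiv_mult: "mp_pderiv i (p * q) = mp_pderiv i p * q + p * mp_pderiv i q"
proof -
  \<comment> \<open>If \<open>x_i\<close> does not occur in \<open>m\<close>, the truncated
    difference gives the wrong monomial, but the coefficient is 0 on both sides.\<close>
  have aux: "Poly_Mapping.single (m + n - Poly_Mapping.single i 1) (of_nat (expo m i) * (x * y)) =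
      Poly_Mapping.single (m - Poly_Mapping.single i 1 + n) (of_nat (expo m i) * (x * y))"
    for m n and x y :: 'b
  proof (cases "expo m i = 0")
    case False
    then have "m + n - Poly_Mapping.single i 1 = m - Poly_Mapping.single i 1 + n"
      by (intro poly_mapping_eqI) (auto simp: lookup_add lookup_minus lookup_single when_def)
    then show ?thesis by simp
  qed simp
  have *: "mp_pderiv i (Poly_Mapping.single m x * Poly_Mapping.single n y) =
      mp_pderiv i (Poly_Mapping.single m x) * Poly_Mapping.single n y +
      Poly_Mapping.single m x * mp_pderiv i (Poly_Mapping.single n y)" for m n and x y :: 'b
  proof -
    have "mp_pderiv i (Poly_Mapping.single m x * Poly_Mapping.single n y) =
        Poly_Mapping.single (m + n - Poly_Mapping.single i 1) (of_nat (expo m i) * (x * y)) +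
        Poly_Mapping.single (n + m - Poly_Mapping.single i 1) (of_nat (expo n i) * (y * x))"
      by (simp only: mult_single mp_pderiv_single lookup_add of_nat_add distrib_right single_add
          add.commute[of n m] mult.commute[of y x])
    also have "\<dots> = Poly_Mapping.single (m - Poly_Mapping.single i 1 + n) (of_nat (expo m i) * (x * y)) +
        Poly_Mapping.single (n - Poly_Mapping.single i 1 + m) (of_nat (expo n i) * (y * x))"
      by (simp only: aux)
    also have "\<dots> = mp_pderiv i (Poly_Mapping.single m x) * Poly_Mapping.single n y +
      Poly_Mapping.single m x * mp_pderiv i (Poly_Mapping.single n y)"
      by (simp only: mult_single mp_pderiv_single add.commute[of m] mult.assoc mult.left_commute[of x] mult.commute[of x y])
    finally show ?thesis .
  qed
  have "mp_pderiv i (p * q) =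
      mp_pderiv i ((\<Sum>m\<in>Poly_Mapping.keys p. Poly_Mapping.single m (mp_coeff p m)) *
        (\<Sum>m\<in>Poly_Mapping.keys q. Poly_Mapping.single m (mp_coeff q m)))"
    by (simp flip: mp_sum_singles)
  also have "\<dots> = mp_pderiv i (\<Sum>m\<in>Poly_Mapping.keys p. Poly_Mapping.single m (mp_coeff p m)) *
        (\<Sum>m\<in>Poly_Mapping.keys q. Poly_Mapping.single m (mp_coeff q m)) +
        (\<Sum>m\<in>Poly_Mapping.keys p. Poly_Mapping.single m (mp_coeff p m)) *
        mp_pderiv i (\<Sum>m\<in>Poly_Mapping.keys q. Poly_Mapping.single m (mp_coeff q m))"
    by (simp add: sum_product mp_pderiv_sum * sum.distrib)
  finally show ?thesis by (simp flip: mp_sum_singles)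
qed

lemma mp_pderiv_const [simp]: "mp_pderiv i (mp_const c) = 0"
  by (simp add: mp_const_def mp_pderiv_single)
lemma mp_pderiv_one [simp]: "mp_pderiv i 1 = 0"
  using mp_pderiv_const[of i 1] by simp
lemma mp_pderiv_var: "mp_pderiv i (mp_var j) = (if i = j then 1 else 0)"
  by (auto simp: mp_var_def mp_pderiv_single lookup_single)
lemma mp_pderiv_minus: "mp_pderiv i (p - q) = mp_pderiv i p - mp_pderiv i (q :: ('n, 'a::comm_ring_1) mpoly)"
  using mp_pderiv_add[of i "p - q" q] by simp
lemma mp_pderiv_commute:
  "mp_pderiv i (mp_pderiv j p) = mp_pderiv j (mp_pderiv i (p :: ('n::finite, 'a::comm_semiring_1) mpoly))"
  by (induction p rule: mp_induct)
    (auto simp: mp_pderiv_add mp_pderiv_mult mp_pderiv_var algebra_simps)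

lemma mp_pderiv_comp:
  "mp_pderiv l (mp_comp F g) = (\<Sum>i\<in>UNIV. mp_comp F (mp_pderiv i g) * mp_pderiv l (F i))"
proof (induction g rule: mp_induct)
  case (var i)
  then show ?case
    by (simp add: mp_pderiv_var if_distrib[where f = "mp_comp F"] if_distrib[where f = "\<lambda>x. x * _"] cong: if_cong)
next
  case (mult p q)
  then show ?case
    by (simp add: mp_pderiv_mult mp_comp_mult mp_comp_add sum.distrib sum_distrib_left sum_distrib_right algebra_simps)
qed (simp_all add: mp_pderiv_add mp_comp_add sum.distrib algebra_simps)

lemma mp_coeff_pderiv:
  fixes f :: "('n::finite, 'a::comm_semiring_1) mpoly"
  shows "mp_coeff (mp_pderiv i f) m = of_nat (expo m i + 1) * mp_coeff f (m + Poly_Mapping.single i 1)"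
proof -
  let ?e = "Poly_Mapping.single i (1::nat)"
  \<comment> \<open>Truncated subtraction also sends a monomial without \<open>x_i\<close> to
    itself; the condition on the exponent excludes it. Such a summand has coefficient 0.\<close>
  have *: "k - ?e = m \<and> expo k i \<noteq> 0 \<longleftrightarrow> k = m + ?e" for k
  proof
    assume k: "k - ?e = m \<and> expo k i \<noteq> 0"
    show "k = m + ?e"
      by (rule poly_mapping_eqI) (use k in \<open>auto simp: lookup_add lookup_minus lookup_single when_def\<close>)
  qed (auto simp: lookup_add)
  have "mp_coeff (mp_pderiv i f) m =
      (\<Sum>k\<in>Poly_Mapping.keys f. if k - ?e = m then of_nat (expo k i) * mp_coeff f k else 0)"
    by (simp add: mp_pderiv_def lookup_sum lookup_single when_def)
  also have "\<dots> = (\<Sum>k\<in>Poly_Mapping.keys f. if k = m + ?e then of_nat (expo k i) * mp_coeff f k else 0)"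
  proof (intro sum.cong refl)
    fix k
    show "(if k - ?e = m then of_nat (expo k i) * mp_coeff f k else 0) =
        (if k = m + ?e then of_nat (expo k i) * mp_coeff f k else 0)"
      using *[of k] by (cases "expo k i = 0") auto
  qed
  also have "\<dots> = of_nat (expo m i + 1) * mp_coeff f (m + ?e)"
    by (simp add: lookup_add in_keys_iff)
  finally show ?thesis .
qed

lemma mp_pderiv_eq_0_imp_coeff:
  fixes f :: "('n::finite, 'a::field_char_0) mpoly"
  assumes "mp_pderiv i f = 0" and i: "expo m i \<noteq> 0"
  shows "mp_coeff f m = 0"
proof -
  let ?k = "m - Poly_Mapping.single i 1"
  have k: "?k + Poly_Mapping.single i 1 = m"
    by (rule poly_mapping_eqI) (use i in \<open>auto simp: lookup_add lookup_minus lookup_single when_def\<close>)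
  have "of_nat (expo ?k i + 1) * mp_coeff f (?k + Poly_Mapping.single i 1) = 0"
    unfolding mp_coeff_pderiv[symmetric] by (simp only: assms(1) lookup_zero)
  then have "of_nat (expo ?k i + 1) = (0::'a) \<or> mp_coeff f m = 0"
    unfolding k mult_eq_0_iff .
  moreover have "of_nat (expo ?k i + 1) \<noteq> (0::'a)"
    unfolding of_nat_eq_0_iff by simp
  ultimately show ?thesis by blast
qed

lemma mp_pderiv_all_zero_imp_const:
  fixes f :: "('n::finite, 'a::field_char_0) mpoly"
  assumes "\<And>i. mp_pderiv i f = 0"
  shows "\<exists>c. f = mp_const c"
proof -
  have "mp_coeff f m = 0" if "m \<noteq> 0" for m
  proof -
    from that obtain i where "expo m i \<noteq> 0" by (metis poly_mapping_eqI lookup_zero)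
    with assms show ?thesis by (rule mp_pderiv_eq_0_imp_coeff)
  qed
  then have "f = mp_const (mp_coeff f 0)"
    unfolding mp_const_def
    by (intro poly_mapping_eqI) (auto simp: lookup_single when_def)
  then show ?thesis ..
qed

lemma mp_coeff_const_mult:
  fixes q :: "('n::finite, 'a::comm_semiring_1) mpoly"
  shows "mp_coeff (mp_const c * q) m = c * mp_coeff q m"
  unfolding mp_const_def mult_map_scale_conv_mult[symmetric]
  by transfer (simp add: when_def)

section \<open>Total degree, and sets closed under partial derivatives\<close>

definition mdeg :: "('n::finite \<Rightarrow>\<^sub>0 nat) \<Rightarrow> nat" where
  "mdeg m = (\<Sum>i\<in>UNIV. expo m i)"

definition mp_deg_less :: "nat \<Rightarrow> ('n::finite, 'a::zero) mpoly \<Rightarrow> bool" where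
  "mp_deg_less N p \<longleftrightarrow> (\<forall>m\<in>Poly_Mapping.keys p. mdeg m < N)"

lemma mdeg_add: "mdeg (m + n) = mdeg m + mdeg n"
  by (simp add: mdeg_def lookup_add sum.distrib)

lemma mdeg_single: "mdeg (Poly_Mapping.single i n) = n"
  by (simp add: mdeg_def lookup_single when_def)

lemma mp_deg_less_exists: "\<exists>N. mp_deg_less N p"
proof -
  have "mdeg m < Suc (sum mdeg (Poly_Mapping.keys p))" if "m \<in> Poly_Mapping.keys p" for m
    using that by (simp add: le_imp_less_Suc member_le_sum)
  then show ?thesis unfolding mp_deg_less_def by blast
qed

lemma mp_deg_less_pderiv:
  fixes p :: "('n::finite, 'a::comm_semiring_1) mpoly"
  assumes "mp_deg_less (Suc N) p"
  shows "mp_deg_less N (mp_pderiv i p)"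
  unfolding mp_deg_less_def
proof
  fix m assume "m \<in> Poly_Mapping.keys (mp_pderiv i p)"
  then have "m + Poly_Mapping.single i 1 \<in> Poly_Mapping.keys p"
    by (auto simp: in_keys_iff mp_coeff_pderiv)
  with assms show "mdeg m < N" by (auto simp: mp_deg_less_def mdeg_add mdeg_single)
qed

text \<open>Differentiation lowers the degree, and in characteristic 0 a polynomial whose partial
  derivatives all vanish is constant, so repeated differentiation ends in a nonzero constant. In the
  applications \<open>T\<close> expresses some kind of vanishing, which a nonzero constant
  contradicts.\<close>

lemma mp_pderiv_closed_contains_const:
  fixes p :: "('n::finite, 'a::field_char_0) mpoly"
  assumes "T p" "p \<noteq> 0" "\<And>q i. T q \<Longrightarrow> T (mp_pderiv i q)"
  shows "\<exists>c. c \<noteq> 0 \<and> T (mp_const c)"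
proof -
  obtain N where "mp_deg_less N p" using mp_deg_less_exists by blast
  with assms(1,2) show ?thesis
  proof (induction N arbitrary: p)
    case 0
    then have "p = 0" by (auto simp: mp_deg_less_def simp flip: keys_eq_empty)
    with 0 show ?case by simp
  next
    case (Suc N)
    show ?case
    proof (cases "\<forall>i. mp_pderiv i p = 0")
      case True
      with mp_pderiv_all_zero_imp_const[of p] Suc.prems show ?thesis by force
    next
      case False
      then obtain i where "mp_pderiv i p \<noteq> 0" by auto
      with Suc assms(3) mp_deg_less_pderiv show ?thesis by blast
    qed
  qed
qed

subsection \<open>Restriction to lines\<close>

definition mp_line :: "('n::finite, 'a::comm_ring_1) mpoly \<Rightarrow> 'a ^ 'n \<Rightarrow> 'a ^ 'n \<Rightarrow> 'a poly" where
  "mp_line p v w = mp_insertion (\<lambda>c. [:c:]) (\<lambda>i. [:v $ i, w $ i:]) p"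

lemma mp_line_zero [simp]: "mp_line 0 v w = 0" by (simp add: mp_line_def)
lemma mp_line_add: "mp_line (p + q) v w = mp_line p v w + mp_line q v w"
  by (simp add: mp_line_def mp_insertion_add)
lemma mp_line_mult: "mp_line (p * q) v w = mp_line p v w * mp_line q v w"
  by (simp add: mp_line_def mp_insertion_mult)
lemma mp_line_const [simp]: "mp_line (mp_const c) v w = [:c:]" by (simp add: mp_line_def)
lemma mp_line_one [simp]: "mp_line 1 v w = 1"
  using mp_line_const[of 1 v w] by (simp)
lemma mp_line_var [simp]: "mp_line (mp_var i) v w = [:v $ i, w $ i:]"
  unfolding mp_line_def by (rule mp_insertion_var) (auto)

lemma poly_mp_line: "poly (mp_line p v w) t = mp_eval p (v + t *s w)"
  by (rule mp_hom_eqI) (simp_all add: mp_line_add mp_line_mult)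

lemma pderiv_mp_line:
  fixes p :: "('n::finite, 'a::idom) mpoly"
  shows
  "pderiv (mp_line p v w) = (\<Sum>i\<in>UNIV. smult (w $ i) (mp_line (mp_pderiv i p) v w))"
proof (induction p rule: mp_induct)
  case (const c)
  then show ?case by (simp add: pderiv_pCons)
next
  case (var j)
  have "(\<Sum>i\<in>UNIV. smult (w $ i) (mp_line (mp_pderiv i (mp_var j)) v w)) =
      (\<Sum>i\<in>UNIV. if i = j then [:w $ i:] else 0)"
    by (intro sum.cong) (auto simp: mp_pderiv_var)
  then show ?case by (simp add: pderiv_pCons)
next
  case (add p q)
  then show ?case by (simp add: mp_pderiv_add mp_line_add pderiv_add smult_add_right sum.distrib)
next
  case (mult p q)
  then show ?case
    by (simp add: mp_pderiv_mult mp_line_add mp_line_mult pderiv_mult smult_add_right sum.distrib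
        sum_distrib_left mult.commute)
qed

lemma mp_eval_pderiv_line:
  fixes p :: "('n::finite, 'a::idom) mpoly"
  shows "poly (pderiv (mp_line p v w)) t = (\<Sum>i\<in>UNIV. w $ i * mp_eval (mp_pderiv i p) (v + t *s w))"
  by (simp add: pderiv_mp_line poly_sum poly_mp_line)

lemma poly_eqI_nonzero:
  fixes P Q :: "'a::field_char_0 poly"
  assumes "\<And>t. t \<noteq> 0 \<Longrightarrow> poly P t = poly Q t"
  shows "P = Q"
proof -
  have "poly ((P - Q) * [:0, 1:]) t = 0" for t using assms by (cases "t = 0") simp_all
  then have "(P - Q) * [:0, 1:] = 0" using poly_all_0_iff_0 by blast
  then show ?thesis by simp
qed

text \<open>Vanishing everywhere is inherited by partial derivatives: on a line parallel to an axis
  the restriction has infinitely many roots, so it is the zero polynomial, and so is its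
  derivative.\<close>

lemma mp_eval_all_zero_imp_zero:
  fixes p :: "('n::finite, 'a::field_char_0) mpoly"
  assumes "\<And>v. mp_eval p v = 0"
  shows "p = 0"
proof (rule ccontr)
  assume "p \<noteq> 0"
  have "\<exists>c. c \<noteq> (0::'a) \<and> (\<forall>v. mp_eval (mp_const c :: ('n, 'a) mpoly) v = 0)"
  proof (rule mp_pderiv_closed_contains_const[where T = "\<lambda>p. \<forall>v. mp_eval p v = 0"])
    fix q :: "('n, 'a) mpoly" and i
    assume q: "\<forall>v. mp_eval q v = 0"
    show "\<forall>v. mp_eval (mp_pderiv i q) v = 0"
    proof
      fix v
      have "mp_line q v (axis i 1) = 0"
        using q by (intro poly_all_0_iff_0[THEN iffD1]) (simp add: poly_mp_line)
      then have "(\<Sum>j\<in>UNIV. axis i 1 $ j * mp_eval (mp_pderiv j q) (v + 0 *s axis i 1)) = 0"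
        unfolding mp_eval_pderiv_line[symmetric] by simp
      then show "mp_eval (mp_pderiv i q) v = 0"
        by (simp add: axis_def if_distrib[where f = "\<lambda>x. x * _"] cong: if_cong)
    qed
  qed (use assms \<open>p \<noteq> 0\<close> in auto)
  then show False by simp
qed

lemma mp_eqI:
  fixes p :: "('n::finite, 'a::field_char_0) mpoly"
  assumes "\<And>v. mp_eval p v = mp_eval q v"
  shows "p = q"
  using mp_eval_all_zero_imp_zero[of "p - q"] assms by simp

lemma mp_nonzero_point:
  fixes p :: "('n::finite, 'a::field_char_0) mpoly"
  assumes "p \<noteq> 0"
  obtains v where "mp_eval p v \<noteq> 0"
  using mp_eval_all_zero_imp_zero assms by blast

lemma mp_const_on_lines_imp_const:
  fixes p :: "('n::finite, 'a::field_char_0) mpoly"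
  assumes "\<And>v. degree (mp_line p 0 v) = 0"
  shows "p = mp_const (mp_eval p 0)"
proof (rule mp_eqI)
  fix v
  from assms[of v] obtain c where c: "mp_line p 0 v = [:c:]" by (metis degree_0_id)
  have "mp_eval p v = c" "mp_eval p 0 = c"
    using poly_mp_line[of p 0 v 1] poly_mp_line[of p 0 v 0] c by simp_all
  then show "mp_eval p v = mp_eval (mp_const (mp_eval p 0)) v" by simp
qed

text \<open>A unit restricts to a unit on each line through the origin, hence has degree 0
  there.\<close>

lemma mp_dvd_one_imp_const:
  fixes p :: "('n::finite, 'a::field_char_0) mpoly"
  assumes "p dvd 1"
  shows "\<exists>c. c \<noteq> 0 \<and> p = mp_const c"
proof -
  from assms obtain q where q: "1 = p * q" by (auto simp: dvd_def)
  have "degree (mp_line p 0 v) = 0" for v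
  proof -
    have "1 = mp_line p 0 v * mp_line q 0 v" using q by (metis mp_line_mult mp_line_one)
    then show ?thesis by (metis dvdI is_unit_iff_degree dvd_0_left_iff one_neq_zero)
  qed
  from mp_const_on_lines_imp_const[OF this] q show ?thesis
    by (metis mp_const_0 mult_zero_left one_neq_zero)
qed


subsection \<open>Homogeneous components\<close>

definition mp_hc :: "nat \<Rightarrow> ('n::finite, 'a::comm_monoid_add) mpoly \<Rightarrow> ('n, 'a) mpoly" where
  "mp_hc n p = (\<Sum>m\<in>{m\<in>Poly_Mapping.keys p. mdeg m = n}. Poly_Mapping.single m (mp_coeff p m))"

lemma mp_coeff_hc: "mp_coeff (mp_hc n p) m = (if mdeg m = n then mp_coeff p m else 0)"
  by (auto simp: mp_hc_def lookup_sum lookup_single when_def in_keys_iff sum.delta)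

lemma mp_homogeneous_iff_coeff: "mp_homogeneous d p \<longleftrightarrow> (\<forall>m. mp_coeff p m \<noteq> 0 \<longrightarrow> mdeg m = d)"
  by (auto simp: mp_homogeneous_def mdeg_def in_keys_iff)

lemma mp_homogeneous_iff_hc: "mp_homogeneous d p \<longleftrightarrow> (\<forall>n. n \<noteq> d \<longrightarrow> mp_hc n p = 0)"
  unfolding mp_homogeneous_iff_coeff poly_mapping_eq_iff fun_eq_iff mp_coeff_hc by auto

lemma mp_homogeneous_hc: "mp_homogeneous n (mp_hc n p)"
  by (auto simp: mp_homogeneous_iff_coeff mp_coeff_hc)

lemma mp_hc_zero [simp]: "mp_hc n 0 = 0"
  by (simp add: mp_hc_def)

lemma mp_homogeneous_zero [simp]: "mp_homogeneous d 0"
  by (simp add: mp_homogeneous_def)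

lemma mp_hc_homogeneous: "mp_homogeneous d p \<Longrightarrow> mp_hc n p = (if n = d then p else 0)"
  by (auto simp: mp_homogeneous_iff_coeff poly_mapping_eq_iff fun_eq_iff mp_coeff_hc)

lemma mp_hc_add: "mp_hc n (p + q) = mp_hc n p + mp_hc n q"
  by (rule poly_mapping_eqI) (simp add: mp_coeff_hc lookup_add)

lemma mp_hc_pderiv:
  fixes p :: "('n::finite, 'a::comm_semiring_1) mpoly"
  shows "mp_hc n (mp_pderiv i p) = mp_pderiv i (mp_hc (Suc n) p)"
  by (rule poly_mapping_eqI) (simp add: mp_coeff_hc mp_coeff_pderiv mdeg_add mdeg_single)

lemma mp_homogeneous_pderiv:
  fixes p :: "('n::finite, 'a::comm_semiring_1) mpoly"
  assumes "mp_homogeneous d p"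
  shows "mp_homogeneous (d - 1) (mp_pderiv i p)"
  using assms unfolding mp_homogeneous_iff_hc mp_hc_pderiv by (cases d) auto

lemma mp_homogeneous_0_imp_const: "mp_homogeneous 0 p \<Longrightarrow> p = mp_const (mp_coeff p 0)"
proof (rule poly_mapping_eqI)
  fix m
  assume p: "mp_homogeneous 0 p"
  show "mp_coeff p m = mp_coeff (mp_const (mp_coeff p 0)) m"
  proof (cases "m = 0")
    case False
    then have "mdeg m \<noteq> 0" by (auto simp: mdeg_def poly_mapping_eq_iff fun_eq_iff)
    with p have "mp_coeff p m = 0" by (auto simp: mp_homogeneous_iff_coeff)
    with False show ?thesis by (simp add: mp_const_def lookup_single when_def)
  qed (simp add: mp_const_def)
qed

lemma mp_homogeneous_0_imp_unit:
  fixes p :: "('n::finite, 'a::field) mpoly"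
  assumes "mp_homogeneous 0 p" "p \<noteq> 0"
  shows "p dvd 1"
proof -
  define c where "c = mp_coeff p 0"
  have p: "p = mp_const c" unfolding c_def by (rule mp_homogeneous_0_imp_const[OF assms(1)])
  with assms(2) have "1 = p * mp_const (inverse c)" by (simp flip: mp_const_mult)
  then show ?thesis by (rule dvdI)
qed

text \<open>This is p(t x), as a polynomial in t. Homogeneity of p turns into being a monomial, and
  the total degree into an ordinary degree, both of which behave well under multiplication.\<close>

definition mp_grading :: "('n::finite, 'a::comm_ring_1) mpoly \<Rightarrow> ('n, 'a) mpoly poly" where
  "mp_grading p = mp_insertion (\<lambda>c. [:mp_const c:]) (\<lambda>i. [:0, mp_var i:]) p"

lemma mp_grading_add: "mp_grading (p + q) = mp_grading p + mp_grading q"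
  by (simp add: mp_grading_def mp_insertion_add mp_const_add)
lemma mp_grading_zero [simp]: "mp_grading 0 = 0" by (simp add: mp_grading_def)
lemma mp_grading_sum: "mp_grading (sum p I) = (\<Sum>i\<in>I. mp_grading (p i))"
  by (induction I rule: infinite_finite_induct) (simp_all add: mp_grading_add)
lemma mp_grading_mult: "mp_grading (p * q) = mp_grading p * mp_grading q"
  by (simp add: mp_grading_def mp_insertion_mult mp_const_add mp_const_mult)

lemma mp_grading_single: "mp_grading (Poly_Mapping.single m a) = monom (Poly_Mapping.single m a) (mdeg m)"
proof -
  have *: "[:0, mp_var i:] ^ k = monom (mp_var i ^ k) k" for i and k :: nat
    by (induction k) (simp_all add: monom_Suc mult_monom flip: monom_0)
  have prod: "(\<Prod>i\<in>S. [:0, mp_var i:] ^ expo m i) = monom (\<Prod>i\<in>S. mp_var i ^ expo m i) (\<Sum>i\<in>S. expo m i)"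
    if "finite S" for S
    using that by (induction S) (simp_all add: * mult_monom)
  have "mp_grading (Poly_Mapping.single m a) = [:mp_const a:] * (\<Prod>i\<in>UNIV. [:0, mp_var i:] ^ expo m i)"
    by (simp add: mp_grading_def mp_insertion_single)
  also have "\<dots> = monom (mp_const a * (\<Prod>i\<in>UNIV. mp_var i ^ expo m i)) (mdeg m)"
    by (simp add: prod mdeg_def smult_monom)
  finally show ?thesis by (simp add: single_eq_prod_var)
qed

lemma coeff_mp_grading: "coeff (mp_grading p) n = mp_hc n p"
proof -
  have "mp_grading p = (\<Sum>m\<in>Poly_Mapping.keys p. monom (Poly_Mapping.single m (mp_coeff p m)) (mdeg m))"
    by (subst mp_sum_singles) (simp add: mp_grading_sum mp_grading_single)
  then show ?thesis by (simp add: coeff_sum mp_hc_def sum.inter_filter)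
qed

lemma poly_mp_grading_1 [simp]: "poly (mp_grading p) 1 = p"
  unfolding mp_grading_def
  by (rule mp_hom_eqI) (auto simp: mp_insertion_add mp_insertion_mult mp_const_add mp_const_mult
      mp_insertion_var)

lemma mp_grading_eq_0_iff [simp]: "mp_grading p = 0 \<longleftrightarrow> p = 0"
  by (metis mp_grading_zero poly_0 poly_mp_grading_1)

lemma mp_homogeneous_iff_grading: "mp_homogeneous d p \<longleftrightarrow> mp_grading p = monom p d"
proof
  assume p: "mp_homogeneous d p"
  show "mp_grading p = monom p d"
    by (rule poly_eqI) (simp add: coeff_mp_grading mp_hc_homogeneous[OF p])
next
  assume "mp_grading p = monom p d"
  then show "mp_homogeneous d p"
    unfolding mp_homogeneous_iff_hc coeff_mp_grading[symmetric] by simp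
qed

lemma mp_homogeneous_mult:
  fixes p q :: "('n::finite, 'a::comm_ring_1) mpoly"
  shows "mp_homogeneous d p \<Longrightarrow> mp_homogeneous e q \<Longrightarrow> mp_homogeneous (d + e) (p * q)"
  by (simp add: mp_homogeneous_iff_grading mp_grading_mult mult_monom)

lemma mp_homogeneous_add:
  fixes p q :: "('n::finite, 'a::comm_ring_1) mpoly"
  shows "mp_homogeneous d p \<Longrightarrow> mp_homogeneous d q \<Longrightarrow> mp_homogeneous d (p + q)"
  by (simp add: mp_homogeneous_iff_hc mp_hc_add)

lemma mp_homogeneous_sum:
  fixes p :: "'i \<Rightarrow> ('n::finite, 'a::comm_ring_1) mpoly"
  shows "(\<And>i. i \<in> I \<Longrightarrow> mp_homogeneous d (p i)) \<Longrightarrow> mp_homogeneous d (sum p I)"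
  by (induction I rule: infinite_finite_induct) (auto intro: mp_homogeneous_add)

lemma mp_homogeneous_const [simp]: "mp_homogeneous 0 (mp_const c)"
  by (auto simp: mp_homogeneous_def mp_const_def split: if_splits)
lemma mp_homogeneous_one [simp]: "mp_homogeneous 0 (1 :: ('n::finite, 'a::comm_ring_1) mpoly)"
  using mp_homogeneous_const[of "1::'a"] by simp
lemma mp_homogeneous_var [simp]: "mp_homogeneous 1 (mp_var i)"
  by (auto simp: mp_homogeneous_iff_coeff mp_var_def lookup_single mdeg_single when_def)
lemma mp_homogeneous_const_mult:
  fixes p :: "('n::finite, 'a::comm_ring_1) mpoly"
  shows "mp_homogeneous d p \<Longrightarrow> mp_homogeneous d (mp_const c * p)"
  using mp_homogeneous_mult[of 0 "mp_const c" d p] by simp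
lemma mp_homogeneous_uminus:
  fixes p :: "('n::finite, 'a::comm_ring_1) mpoly"
  shows "mp_homogeneous d p \<Longrightarrow> mp_homogeneous d (- p)"
  by (simp add: mp_homogeneous_iff_coeff)
lemma mp_homogeneous_minus:
  fixes p q :: "('n::finite, 'a::comm_ring_1) mpoly"
  shows "mp_homogeneous d p \<Longrightarrow> mp_homogeneous d q \<Longrightarrow> mp_homogeneous d (p - q)"
  using mp_homogeneous_add[of d p "- q"] mp_homogeneous_uminus[of d q] by simp
lemma mp_homogeneous_power:
  fixes p :: "('n::finite, 'a::comm_ring_1) mpoly"
  shows "mp_homogeneous d p \<Longrightarrow> mp_homogeneous (n * d) (p ^ n)"
  by (induction n) (auto intro: mp_homogeneous_mult)
lemma mp_homogeneous_prod:
  fixes p :: "'i \<Rightarrow> ('n::finite, 'a::comm_ring_1) mpoly"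
  shows
  "(\<And>i. i \<in> I \<Longrightarrow> mp_homogeneous (e i) (p i)) \<Longrightarrow> mp_homogeneous (sum e I) (prod p I)"
  by (induction I rule: infinite_finite_induct) (auto intro: mp_homogeneous_mult)

lemma mp_homogeneous_comp:
  fixes F :: "'n::finite \<Rightarrow> ('m::finite, 'a::comm_ring_1) mpoly"
  assumes "mp_homogeneous d p" "\<And>i. mp_homogeneous e (F i)"
  shows "mp_homogeneous (d * e) (mp_comp F p)"
proof -
  have "mp_homogeneous (d * e) (mp_const (mp_coeff p m) * (\<Prod>i\<in>UNIV. F i ^ expo m i))"
    if "m \<in> Poly_Mapping.keys p" for m
  proof -
    have "mp_homogeneous (\<Sum>i\<in>UNIV. expo m i * e) (\<Prod>i\<in>UNIV. F i ^ expo m i)"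
      by (intro mp_homogeneous_prod mp_homogeneous_power assms(2))
    moreover have "(\<Sum>i\<in>UNIV. expo m i * e) = d * e"
      using assms(1) that by (auto simp: mp_homogeneous_def simp flip: sum_distrib_right)
    ultimately show ?thesis by (auto intro: mp_homogeneous_const_mult)
  qed
  then show ?thesis
    unfolding mp_comp_def mp_insertion_def by (intro mp_homogeneous_sum)
qed

lemma mp_eval_scale:
  assumes "mp_homogeneous d (p :: ('n::finite, 'a::comm_ring_1) mpoly)"
  shows "mp_eval p (s *s v) = s ^ d * mp_eval p v"
proof -
  have "(\<Prod>i\<in>UNIV. s ^ expo m i) = s ^ d" if "m \<in> Poly_Mapping.keys p" for m
    using that assms by (auto simp: mp_homogeneous_def simp flip: power_sum)
  then show ?thesis
    unfolding mp_eval_def mp_insertion_def sum_distrib_left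
    by (intro sum.cong) (simp_all add: power_mult_distrib prod.distrib mult_ac)
qed

lemma mp_line_homogeneous:
  assumes "mp_homogeneous d (p :: ('n::finite, 'a::field_char_0) mpoly)"
  shows "mp_line p 0 v = monom (mp_eval p v) d"
proof -
  have "poly (mp_line p 0 v) t = poly (monom (mp_eval p v) d) t" for t
    by (simp add: poly_mp_line poly_monom mp_eval_scale[OF assms])
  then show ?thesis by (simp add: fun_eq_iff flip: poly_eq_poly_eq_iff)
qed

lemma mp_eval_homogeneous_0:
  assumes "mp_homogeneous d (p :: ('n::finite, 'a::comm_ring_1) mpoly)" "d > 0"
  shows "mp_eval p 0 = 0"
  using mp_eval_scale[OF assms(1), of 0 0] assms(2) by (simp add: zero_power)

lemma mp_euler:
  fixes p :: "('n::finite, 'a::field_char_0) mpoly"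
  assumes "mp_homogeneous d p"
  shows "(\<Sum>i\<in>UNIV. mp_var i * mp_pderiv i p) = mp_const (of_nat d) * p"
proof (rule mp_eqI)
  fix v
  have "(\<Sum>i\<in>UNIV. v $ i * mp_eval (mp_pderiv i p) v) = poly (pderiv (mp_line p 0 v)) 1"
    by (simp add: mp_eval_pderiv_line)
  also have "\<dots> = of_nat d * mp_eval p v"
    by (simp add: mp_line_homogeneous[OF assms] pderiv_monom poly_monom)
  finally show "mp_eval (\<Sum>i\<in>UNIV. mp_var i * mp_pderiv i p) v = mp_eval (mp_const (of_nat d) * p) v"
    by simp
qed

text \<open>If n > 0, the constant coefficient of p or of q vanishes, so that a factor t can be
  cancelled.\<close>

lemma monom_factor:
  fixes p q :: "'a::idom poly"
  assumes "p * q = monom c n" "c \<noteq> 0"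
  shows "\<exists>b m. p = monom b m"
  using assms
proof (induction n arbitrary: p q)
  case 0
  then have "p \<noteq> 0" "q \<noteq> 0" by auto
  moreover have "degree (p * q) = 0" using 0 by (simp add: degree_monom_eq)
  ultimately have "degree p = 0" by (simp add: degree_mult_eq)
  then show ?case by (metis degree_0_id monom_0)
next
  case (Suc n)
  have "coeff p 0 * coeff q 0 = coeff (p * q) 0" by (simp add: coeff_mult)
  also have "\<dots> = 0" using Suc.prems by simp
  finally consider "coeff p 0 = 0" | "coeff q 0 = 0" by auto
  then show ?case
  proof cases
    case 1
    then obtain p' where p': "p = pCons 0 p'" by (metis coeff_pCons_0 pCons_cases)
    with Suc.prems have "pCons 0 (p' * q) = pCons 0 (monom c n)" by (simp add: monom_Suc)
    with Suc.IH[of p' q] Suc.prems obtain b m where "p' = monom b m" by auto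
    with p' have "p = monom b (Suc m)" by (simp add: monom_Suc)
    then show ?thesis by blast
  next
    case 2
    then obtain q' where q': "q = pCons 0 q'" by (metis coeff_pCons_0 pCons_cases)
    with Suc.prems have "pCons 0 (p * q') = pCons 0 (monom c n)" by (simp add: monom_Suc)
    with Suc.IH[of p q'] Suc.prems show ?thesis by auto
  qed
qed

text \<open>\<open>mp_grading\<close> is multiplicative, and over a domain a factor of a monomial is
  a monomial. The linear order on the indices makes the polynomials a domain.\<close>

lemma mp_homogeneous_factor:
  fixes p q :: "('n::{finite, linorder}, 'a::field_char_0) mpoly"
  assumes "mp_homogeneous d (p * q)" "p * q \<noteq> 0"
  shows "\<exists>e. mp_homogeneous e p"
proof -
  have "mp_grading p * mp_grading q = monom (p * q) d"
    using assms(1) by (simp add: mp_homogeneous_iff_grading mp_grading_mult)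
  from monom_factor[OF this assms(2)] obtain b m where bm: "mp_grading p = monom b m" by blast
  have "b = p" using poly_mp_grading_1[of p] unfolding bm by (simp add: poly_monom)
  with bm show ?thesis by (auto simp: mp_homogeneous_iff_grading)
qed

lemma mp_homogeneous_unique:
  assumes "mp_homogeneous d p" "mp_homogeneous e p" "p \<noteq> 0"
  shows "d = e"
proof -
  from assms(3) obtain m where "m \<in> Poly_Mapping.keys p" by (metis ex_in_conv keys_eq_empty)
  with assms show ?thesis by (auto simp: mp_homogeneous_def)
qed

definition mp_tdeg :: "('n::finite, 'a::comm_ring_1) mpoly \<Rightarrow> nat" where
  "mp_tdeg p = degree (mp_grading p)"

lemma mp_tdeg_mult:
  fixes p q :: "('n::{finite, linorder}, 'a::field_char_0) mpoly"
  shows "p \<noteq> 0 \<Longrightarrow> q \<noteq> 0 \<Longrightarrow> mp_tdeg (p * q) = mp_tdeg p + mp_tdeg q"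
  by (simp add: mp_tdeg_def mp_grading_mult degree_mult_eq)

lemma mp_tdeg_dvd:
  fixes p q :: "('n::{finite, linorder}, 'a::field_char_0) mpoly"
  assumes "p dvd q" "q \<noteq> 0"
  shows "mp_tdeg p \<le> mp_tdeg q"
  using assms by (auto simp: dvd_def mp_tdeg_mult)

subsection \<open>Derivations\<close>

definition mp_dir :: "('n::finite \<Rightarrow> ('n, 'a) mpoly) \<Rightarrow> ('n, 'a::comm_ring_1) mpoly \<Rightarrow> ('n, 'a) mpoly" where
  "mp_dir h q = (\<Sum>i\<in>UNIV. h i * mp_pderiv i q)"

definition mp_dconst :: "'a::comm_ring_1 ^ 'n::finite \<Rightarrow> ('n, 'a) mpoly \<Rightarrow> ('n, 'a) mpoly" where
  "mp_dconst p = mp_dir (\<lambda>i. mp_const (p $ i))"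

lemma mp_dir_zero [simp]: "mp_dir h 0 = 0" by (simp add: mp_dir_def)
lemma mp_dir_const [simp]: "mp_dir h (mp_const c) = 0" by (simp add: mp_dir_def)
lemma mp_dir_add: "mp_dir h (p + q) = mp_dir h p + mp_dir h q"
  by (simp add: mp_dir_def mp_pderiv_add distrib_left sum.distrib)
lemma mp_dir_minus: "mp_dir h (p - q) = mp_dir h p - mp_dir h q"
  by (simp add: mp_dir_def mp_pderiv_minus right_diff_distrib sum_subtractf)
lemma mp_dir_mult: "mp_dir h (p * q) = mp_dir h p * q + p * mp_dir h q"
  by (simp add: mp_dir_def mp_pderiv_mult sum.distrib sum_distrib_left sum_distrib_right algebra_simps)
lemma mp_dir_sum: "mp_dir h (sum p I) = (\<Sum>i\<in>I. mp_dir h (p i))"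
  by (induction I rule: infinite_finite_induct) (simp_all add: mp_dir_add)
lemma mp_dir_var [simp]: "mp_dir h (mp_var i) = h i"
  by (simp add: mp_dir_def mp_pderiv_var if_distrib[where f = "\<lambda>x. _ * x"] cong: if_cong)
lemma mp_dir_smult: "mp_dir (\<lambda>i. r * h i) q = r * mp_dir h q"
  by (simp add: mp_dir_def sum_distrib_left mult.assoc)

lemma mp_eval_dconst: "mp_eval (mp_dconst p q) v = (\<Sum>i\<in>UNIV. p $ i * mp_eval (mp_pderiv i q) v)"
  by (simp add: mp_dconst_def mp_dir_def)

lemma poly_pderiv_mp_line:
  fixes q :: "('n::finite, 'a::idom) mpoly"
  shows "poly (pderiv (mp_line q v w)) t = mp_eval (mp_dconst w q) (v + t *s w)"
  by (simp add: mp_eval_pderiv_line mp_eval_dconst)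

text \<open>A directional derivative has smaller total degree than \<open>G\<close>, so
  \<open>G\<close> can divide it only if it is 0.\<close>

lemma mp_dconst_dvd_imp_zero:
  fixes G :: "('n::{finite, linorder}, 'a::field_char_0) mpoly"
  assumes "G dvd mp_dconst p G"
  shows "mp_dconst p G = 0"
proof (rule ccontr)
  assume nz: "mp_dconst p G \<noteq> 0"
  have hc: "mp_hc n (mp_dconst p G) = mp_dconst p (mp_hc (Suc n) G)" for n
  proof -
    have "mp_hc n (mp_const c * q) = mp_const c * mp_hc n q" for c and q :: "('n, 'a) mpoly"
      by (rule poly_mapping_eqI) (simp add: mp_coeff_hc mp_coeff_const_mult)
    moreover have "mp_hc n (sum f I) = (\<Sum>i\<in>I. mp_hc n (f i))" if "finite I" for f :: "'n \<Rightarrow> ('n, 'a) mpoly" and I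
      using that by (induction I) (simp_all add: mp_hc_add mp_hc_homogeneous[OF mp_homogeneous_zero])
    ultimately show ?thesis by (simp add: mp_dconst_def mp_dir_def mp_hc_pderiv)
  qed
  have "coeff (mp_grading (mp_dconst p G)) n = 0" if "n \<ge> mp_tdeg G" for n
  proof -
    have "mp_hc (Suc n) G = 0"
      using that unfolding mp_tdeg_def coeff_mp_grading[symmetric] by (intro coeff_eq_0) simp
    then show ?thesis by (simp add: coeff_mp_grading hc) (simp add: mp_dconst_def)
  qed
  then have "mp_tdeg (mp_dconst p G) < mp_tdeg G"
    using nz unfolding mp_tdeg_def[of "mp_dconst p G"]
    by (metis leading_coeff_0_iff linorder_not_le mp_grading_eq_0_iff)
  with mp_tdeg_dvd[OF assms nz] show False by simp
qed

section \<open>The flow of a vector field that annihilates its own components\<close>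

definition mp_flow :: "('n::finite \<Rightarrow> ('n, 'a) mpoly) \<Rightarrow> ('n, 'a::comm_ring_1) mpoly \<Rightarrow> ('n, 'a) mpoly poly" where
  "mp_flow h q = mp_insertion (\<lambda>c. [:mp_const c:]) (\<lambda>i. [:mp_var i, h i:]) q"

lemma mp_flow_add: "mp_flow h (p + q) = mp_flow h p + mp_flow h q"
  by (simp add: mp_flow_def mp_insertion_add mp_const_add)
lemma mp_flow_mult: "mp_flow h (p * q) = mp_flow h p * mp_flow h q"
  by (simp add: mp_flow_def mp_insertion_mult mp_const_add mp_const_mult)
lemma mp_flow_const [simp]: "mp_flow h (mp_const c) = [:mp_const c:]" by (simp add: mp_flow_def)
lemma mp_flow_var [simp]: "mp_flow h (mp_var i) = [:mp_var i, h i:]"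
  unfolding mp_flow_def by (rule mp_insertion_var) (auto)

lemma poly_mp_flow: "poly (mp_flow h q) r = mp_comp (\<lambda>i. mp_var i + r * h i) q"
  by (rule mp_hom_eqI) (simp_all add: mp_flow_add mp_flow_mult mp_comp_add mp_comp_mult)

lemma mp_comp_id: "mp_comp mp_var q = q"
  by (rule mp_hom_eqI) (simp_all add: mp_comp_add mp_comp_mult)

lemma coeff_mp_flow_0: "coeff (mp_flow h q) 0 = q"
  using poly_mp_flow[of h q 0] by (simp add: poly_0_coeff_0 mp_comp_id)

text \<open>The flow is the exponential of the derivation D = \<open>mp_dir h\<close>: since D kills
  the components of \<open>h\<close>, the derivative by t and the coefficientwise D agree on the
  images of constants and variables, and both satisfy the product rule.\<close>

lemma pderiv_mp_flow:
  fixes h :: "'n::{finite, linorder} \<Rightarrow> ('n, 'a::idom) mpoly"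
  assumes "\<And>i. mp_dir h (h i) = 0"
  shows "pderiv (mp_flow h q) = map_poly (mp_dir h) (mp_flow h q)"
proof (induction q rule: mp_induct)
  case (const c)
  have "map_poly (mp_dir h) [:mp_const c:] = 0"
    by (rule poly_eqI) (simp add: coeff_map_poly coeff_pCons split: nat.split)
  then show ?case by (simp add: pderiv_pCons)
next
  case (var i)
  have "map_poly (mp_dir h) [:mp_var i, h i:] = [:h i:]"
    by (rule poly_eqI) (simp add: coeff_map_poly coeff_pCons assms split: nat.split)
  then show ?case by (simp add: pderiv_pCons)
next
  case (add p q)
  then show ?case
    by (simp add: mp_flow_add pderiv_add) (rule poly_eqI, simp add: coeff_map_poly mp_dir_add)
next
  case (mult p q)
  have "map_poly (mp_dir h) (P * Q) = map_poly (mp_dir h) P * Q + P * map_poly (mp_dir h) Q"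
    for P Q :: "('n, 'a) mpoly poly"
    by (rule poly_eqI) (simp add: coeff_map_poly coeff_mult mp_dir_sum mp_dir_mult sum.distrib)
  with mult show ?case by (simp add: mp_flow_mult pderiv_mult algebra_simps)
qed

text \<open>The coefficients c_n of the flow satisfy (n + 1) c_(n+1) = D c_n and c_0 = q. If D q =
  0, all of them with n > 0 vanish in characteristic 0.\<close>

lemma mp_dir_eq_0_imp_flow:
  fixes h :: "'n::{finite, linorder} \<Rightarrow> ('n, 'a::field_char_0) mpoly"
  assumes h: "\<And>i. mp_dir h (h i) = 0" and q: "mp_dir h q = 0"
  shows "mp_flow h q = [:q:]"
proof -
  have step: "of_nat (Suc n) * coeff (mp_flow h q) (Suc n) = mp_dir h (coeff (mp_flow h q) n)" for n
    using arg_cong[OF pderiv_mp_flow[OF h, of q], of "\<lambda>p. coeff p n"]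
    by (simp add: coeff_pderiv coeff_map_poly)
  have "coeff (mp_flow h q) (Suc n) = 0" for n
  proof (induction n)
    case 0
    with step[of 0] q show ?case by (simp add: coeff_mp_flow_0)
  next
    case (Suc n)
    with step[of "Suc n"] have "of_nat (Suc (Suc n)) * coeff (mp_flow h q) (Suc (Suc n)) = 0" by simp
    then show ?case unfolding mult_eq_0_iff of_nat_eq_0_iff by simp
  qed
  then show ?thesis
    by (intro poly_eqI) (auto simp: coeff_pCons coeff_mp_flow_0 split: nat.splits)
qed

lemma mp_eval_flow_invariant:
  fixes h :: "'n::{finite, linorder} \<Rightarrow> ('n, 'a::field_char_0) mpoly"
  assumes "\<And>i. mp_dir h (h i) = 0" "mp_dir h q = 0"
  shows "mp_eval q (v + t *s (\<chi> i. mp_eval (h i) v)) = mp_eval q v"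
proof -
  have "mp_comp (\<lambda>i. mp_var i + mp_const t * h i) q = q"
    using poly_mp_flow[of h q "mp_const t"] mp_dir_eq_0_imp_flow[OF assms] by simp
  then have "mp_eval q v = mp_eval (mp_comp (\<lambda>i. mp_var i + mp_const t * h i) q) v" by simp
  also have "\<dots> = mp_eval q (\<chi> i. mp_eval (mp_var i + mp_const t * h i) v)"
    by (rule mp_eval_comp)
  also have "(\<chi> i. mp_eval (mp_var i + mp_const t * h i) v) = v + t *s (\<chi> i. mp_eval (h i) v)"
    by (simp add: vec_eq_iff)
  finally show ?thesis by simp
qed

text \<open>
  The derivation \<open>mp_dir h\<close> is locally nilpotent, and its exponential \<open>mp_flow h\<close> is a homomorphism
  into a polynomial ring over a domain, in which degrees add up.
\<close>

lemma mp_dir_factor: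
  fixes h :: "'n::{finite, linorder} \<Rightarrow> ('n, 'a::field_char_0) mpoly"
  assumes h: "\<And>i. mp_dir h (h i) = 0" and qr: "mp_dir h (q * r) = 0" "q * r \<noteq> 0"
  shows "mp_dir h q = 0"
proof -
  have eq: "mp_flow h q * mp_flow h r = [:q * r:]"
    using mp_dir_eq_0_imp_flow[OF h qr(1)] by (simp add: mp_flow_mult)
  then have "mp_flow h q \<noteq> 0" "mp_flow h r \<noteq> 0" using qr(2) by auto
  then have "degree (mp_flow h q) + degree (mp_flow h r) = 0"
    using arg_cong[OF eq, of degree] by (simp add: degree_mult_eq)
  then have "coeff (mp_flow h q) 1 = 0" by (simp add: coeff_eq_0)
  with arg_cong[OF pderiv_mp_flow[OF h, of q], of "\<lambda>p. coeff p 0"] show ?thesis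
    by (simp add: coeff_pderiv coeff_map_poly coeff_mp_flow_0)
qed

lemma mp_dconst_invariant:
  fixes q :: "('n::{finite, linorder}, 'a::field_char_0) mpoly"
  assumes "mp_dconst p q = 0"
  shows "mp_eval q (v + t *s p) = mp_eval q v"
  using mp_eval_flow_invariant[of "\<lambda>i. mp_const (p $ i)" q v t] assms
  by (simp add: mp_dconst_def)

subsection \<open>Unique factorization and elimination\<close>

lemma prime_factor_positive_degree:
  fixes r :: "'a::ufd poly"
  assumes "degree r > 0"
  shows "\<exists>\<rho>. prime_elem \<rho> \<and> degree \<rho> > 0 \<and> \<rho> dvd r"
proof -
  from assms have "r \<noteq> 0" by auto
  moreover have "\<not> r dvd 1"
  proof
    assume "r dvd 1"
    then obtain s where s: "1 = r * s" by (auto simp: dvd_def)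
    then have "degree (r * s) = degree r + degree s"
      by (intro degree_mult_eq) auto
    with s assms show False by (metis add_is_0 degree_1 less_numeral_extra(3))
  qed
  ultimately obtain F where F: "mset_factors F r" using mset_factors_exist by blast
  have "\<exists>\<rho>\<in>#F. degree \<rho> > 0"
  proof (rule ccontr)
    assume "\<not> ?thesis"
    then have "\<forall>\<rho>\<in>#F. degree \<rho> = 0" by auto
    then have "degree (prod_mset F) = 0"
    proof (induction F)
      case (add x F)
      then have "degree (x * prod_mset F) \<le> 0" by (metis degree_mult_le add_0 insert_iff set_mset_add_mset_insert)
      then show ?case by simp
    qed simp
    with F assms show False by (auto simp: mset_factors_def)
  qed
  then obtain \<rho> where "\<rho> \<in># F" "degree \<rho> > 0" by blast
  with F show ?thesis by (auto simp: mset_factors_def intro!: exI[of _ \<rho>] dvd_prod_mset)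
qed

text \<open>Let \<open>r\<close> be a nonzero element of least degree in the ideal \<open>J\<close>
  of the \<open>q i\<close>. If its degree is positive, pseudo-division shows that \<open>r\<close>
  divides a multiple of each \<open>q i\<close> by a nonzero coefficient. A prime factor of
  \<open>r\<close> of positive degree cannot divide that coefficient, so it divides
  \<open>q i\<close>.\<close>

lemma poly_elimination:
  fixes q :: "'i::finite \<Rightarrow> 'a::ufd poly"
  assumes "q i0 \<noteq> 0"
  shows "(\<exists>\<rho>. prime_elem \<rho> \<and> (\<forall>i. \<rho> dvd q i)) \<or>
    (\<exists>A. (\<Sum>i\<in>UNIV. A i * q i) \<noteq> 0 \<and> degree (\<Sum>i\<in>UNIV. A i * q i) = 0)"
proof -
  define J where "J = {r. \<exists>A. r = (\<Sum>i\<in>UNIV. A i * q i)}"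
  have qJ: "q i \<in> J" for i
  proof -
    have "q i = (\<Sum>j\<in>UNIV. (if j = i then 1 else 0) * q j)"
      by (simp add: if_distrib[where f = "\<lambda>x. x * _"] cong: if_cong)
    then show ?thesis unfolding J_def by (intro CollectI exI[of _ "\<lambda>j. if j = i then 1 else 0"])
  qed
  have J: "a * x - b * y \<in> J" if "x \<in> J" "y \<in> J" for a b x y
  proof -
    from that obtain A B where "x = (\<Sum>i\<in>UNIV. A i * q i)" "y = (\<Sum>i\<in>UNIV. B i * q i)"
      by (auto simp: J_def)
    then have "a * x - b * y = (\<Sum>i\<in>UNIV. (a * A i - b * B i) * q i)"
      by (simp add: sum_distrib_left sum_subtractf left_diff_distrib mult.assoc)
    then show ?thesis by (auto simp: J_def)
  qed
  define r where "r = arg_min degree (\<lambda>r. r \<in> J \<and> r \<noteq> 0)"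
  have r: "r \<in> J \<and> r \<noteq> 0" "\<And>s. s \<in> J \<and> s \<noteq> 0 \<Longrightarrow> degree r \<le> degree s"
    using arg_min_nat_lemma[of "\<lambda>r. r \<in> J \<and> r \<noteq> 0" "q i0" degree] qJ assms
    unfolding r_def by auto
  show ?thesis
  proof (cases "degree r = 0")
    case True
    with r show ?thesis by (auto simp: J_def)
  next
    case False
    then obtain \<rho> where \<rho>: "prime_elem \<rho>" "degree \<rho> > 0" "\<rho> dvd r"
      using prime_factor_positive_degree[of r] by auto
    have "\<rho> dvd q i" for i
    proof -
      from pseudo_mod(1)[of r "q i"] r obtain a b
        where ab: "a \<noteq> 0" "smult a (q i) = r * b + pseudo_mod (q i) r" by blast
      then have "pseudo_mod (q i) r = [:a:] * q i - b * r" by (simp add: algebra_simps)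
      with J[of "q i" r "[:a:]" b] qJ r have "pseudo_mod (q i) r \<in> J" by simp
      then have "pseudo_mod (q i) r = 0"
        using r(2)[of "pseudo_mod (q i) r"] r(1) pseudo_mod(2)[of r "q i"] by linarith
      with ab have "[:a:] * q i = r * b" by simp
      then have "\<rho> dvd [:a:] * q i" using \<rho>(3) by (simp only: dvd_mult2)
      from prime_elem_dvd_multD[OF \<rho>(1) this] consider "\<rho> dvd [:a:]" | "\<rho> dvd q i" by blast
      then show ?thesis
      proof cases
        case 1
        then obtain c where c: "[:a:] = \<rho> * c" by (rule dvdE)
        with ab(1) have "\<rho> \<noteq> 0" "c \<noteq> 0" by auto
        then have "degree \<rho> = 0" using arg_cong[OF c, of degree] by (simp add: degree_mult_eq)
        with \<rho>(2) show ?thesis by simp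
      qed
    qed
    then show ?thesis by (intro disjI1 exI[of _ \<rho>] conjI allI \<rho>(1))
  qed
qed

section \<open>Ring homomorphisms between polynomials in four variables and iterated univariate
  ones\<close>

definition hom_laws :: "('a::comm_ring_1 \<Rightarrow> 'b::comm_ring_1) \<Rightarrow> bool" where
  "hom_laws h \<longleftrightarrow> h 0 = 0 \<and> h 1 = 1 \<and> (\<forall>x y. h (x + y) = h x + h y) \<and> (\<forall>x y. h (x * y) = h x * h y)"

definition extend_hom :: "('a::comm_ring_1 \<Rightarrow> 'b::comm_ring_1) \<Rightarrow> 'b \<Rightarrow> 'a poly \<Rightarrow> 'b" where
  "extend_hom h a p = poly (map_poly h p) a"

lemma extend_hom_pCons: "h 0 = 0 \<Longrightarrow> extend_hom h a (pCons c p) = h c + a * extend_hom h a p"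
proof -
  assume "h 0 = 0"
  then have "map_poly h (pCons c p) = pCons (h c) (map_poly h p)"
    by (intro poly_eqI) (simp add: coeff_map_poly coeff_pCons split: nat.split)
  then show ?thesis by (simp add: extend_hom_def)
qed

lemma extend_hom_zero [simp]: "extend_hom h a 0 = 0"
  by (simp add: extend_hom_def)

lemma extend_hom_one: "h 0 = 0 \<Longrightarrow> extend_hom h a 1 = h 1"
  using extend_hom_pCons[of h a 1 0] by simp

lemma hom_laws_extend:
  assumes "hom_laws h"
  shows "hom_laws (extend_hom h a)"
proof -
  note h = assms[unfolded hom_laws_def]
  have add: "extend_hom h a (p + q) = extend_hom h a p + extend_hom h a q" for p q
    by (induction p q rule: poly_induct2) (simp_all add: extend_hom_pCons h algebra_simps)
  have smult: "extend_hom h a (smult c q) = h c * extend_hom h a q" for c q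
    by (induction q) (simp_all add: extend_hom_pCons h algebra_simps)
  have "extend_hom h a (p * q) = extend_hom h a p * extend_hom h a q" for p q
    by (induction p) (simp_all add: extend_hom_pCons h add smult algebra_simps)
  moreover have "extend_hom h a 1 = 1" by (simp add: extend_hom_one h)
  ultimately show ?thesis by (simp add: hom_laws_def add)
qed

lemma poly_hom_laws_eqI:
  assumes "hom_laws F" "hom_laws G" "\<And>c. F [:c:] = G [:c:]" "F [:0, 1:] = G [:0, 1:]"
  shows "F p = G p"
proof (induction p)
  case (pCons c p)
  have F: "F (x + y) = F x + F y" "F (x * y) = F x * F y" for x y
    using assms(1) by (simp_all add: hom_laws_def)
  have G: "G (x + y) = G x + G y" "G (x * y) = G x * G y" for x y
    using assms(2) by (simp_all add: hom_laws_def)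
  have "pCons c p = [:c:] + [:0, 1:] * p" by simp
  then show ?case by (simp only: F G assms(3,4) pCons)
qed (use assms in \<open>simp add: hom_laws_def\<close>)

lemma hom_laws_comp: "hom_laws F \<Longrightarrow> hom_laws G \<Longrightarrow> hom_laws (\<lambda>x. F (G x))"
  by (simp add: hom_laws_def)

lemma hom_laws_mp_const: "hom_laws mp_const"
  by (simp add: hom_laws_def mp_const_add mp_const_mult)

lemma hom_laws_insertion: "hom_laws c \<Longrightarrow> hom_laws (mp_insertion c b)"
  by (simp add: hom_laws_def mp_insertion_add mp_insertion_mult)

lemma extend_hom_const [simp]: "hom_laws h \<Longrightarrow> extend_hom h a [:c:] = h c"
  by (simp add: hom_laws_def extend_hom_pCons)

lemma extend_hom_X [simp]: "hom_laws h \<Longrightarrow> extend_hom h a (pCons 0 1) = a"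
  by (simp add: hom_laws_def extend_hom_pCons extend_hom_one)

lemma mp_pderiv_extend_hom:
  assumes "hom_laws h" "\<And>c. mp_pderiv l (h c) = 0" "mp_pderiv l a = 0"
  shows "mp_pderiv l (extend_hom h a p) = 0"
  using assms by (induction p) (simp_all add: extend_hom_pCons hom_laws_def mp_pderiv_add mp_pderiv_mult)

lemma num4_eq: "(UNIV :: 4 set) = {0, 1, 2, 3}"
proof -
  have "x \<in> {0, 1, 2, 3}" for x :: 4
  proof (induction x)
    case (of_int z)
    then have "z = 0 \<or> z = 1 \<or> z = 2 \<or> z = 3" by auto
    then show ?case by auto
  qed
  then show ?thesis by auto
qed

text \<open>
  Iterated univariate polynomials over a field form a UFD. Making the given variable the outermost
  one identifies them with polynomials in four variables.
\<close>

lemma mp4_iso_iterated_poly: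
  fixes l :: 4
  shows "\<exists>(\<Phi> :: (4, 'a::field_char_0) mpoly \<Rightarrow> 'a poly poly poly poly) \<Psi>.
    hom_laws \<Phi> \<and> hom_laws \<Psi> \<and> (\<forall>p. \<Psi> (\<Phi> p) = p) \<and> (\<forall>P. \<Phi> (\<Psi> P) = P) \<and>
    (\<forall>c. mp_pderiv l (\<Psi> [:c:]) = 0)"
proof -
  \<comment> \<open>The transposition of 0 and \<open>l\<close>. The generator with number 0 is the
    outermost variable, so \<open>x_l\<close> becomes outermost and the constants
    \<open>[:c:]\<close> correspond to polynomials free of \<open>x_l\<close>.\<close>
  define \<sigma> where "\<sigma> i = (if i = l then 0 else if i = 0 then l else i)" for i :: 4
  have \<sigma>: "\<sigma> (\<sigma> i) = i" for i by (auto simp: \<sigma>_def)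
  have \<sigma>_eq: "\<sigma> i = l \<longleftrightarrow> i = 0" for i by (auto simp: \<sigma>_def)
  define gen :: "4 \<Rightarrow> 'a poly poly poly poly" where
    "gen i = (if i = 0 then [:0, 1:] else if i = 1 then [:[:0, 1:]:]
      else if i = 2 then [:[:[:0, 1:]:]:] else [:[:[:[:0, 1:]:]:]:])" for i
  define \<Phi> :: "(4, 'a) mpoly \<Rightarrow> 'a poly poly poly poly" where
    "\<Phi> = mp_insertion (\<lambda>c. [:[:[:[:c:]:]:]:]) (\<lambda>i. gen (\<sigma> i))"
  define e1 :: "'a poly \<Rightarrow> (4, 'a) mpoly" where "e1 = extend_hom mp_const (mp_var (\<sigma> 3))"
  define e2 where "e2 = extend_hom e1 (mp_var (\<sigma> 2))"
  define e3 where "e3 = extend_hom e2 (mp_var (\<sigma> 1))"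
  define \<Psi> where "\<Psi> = extend_hom e3 (mp_var (\<sigma> 0))"
  have e1: "hom_laws e1" unfolding e1_def by (intro hom_laws_extend hom_laws_mp_const)
  have e2: "hom_laws e2" unfolding e2_def by (intro hom_laws_extend e1)
  have e3: "hom_laws e3" unfolding e3_def by (intro hom_laws_extend e2)
  have \<Psi>: "hom_laws \<Psi>" unfolding \<Psi>_def by (intro hom_laws_extend e3)
  have \<Phi>: "hom_laws \<Phi>" unfolding \<Phi>_def
    by (intro hom_laws_insertion) (simp add: hom_laws_def)
  have \<Phi>_const: "\<Phi> (mp_const c) = [:[:[:[:c:]:]:]:]" for c by (simp add: \<Phi>_def)
  have \<Phi>_var: "\<Phi> (mp_var i) = gen (\<sigma> i)" for i
    unfolding \<Phi>_def by (rule mp_insertion_var) simp_all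
  have \<Psi>c: "\<Psi> [:c:] = e3 c" for c by (simp add: \<Psi>_def e3)
  have e3c: "e3 [:c:] = e2 c" for c by (simp add: e3_def e2)
  have e2c: "e2 [:c:] = e1 c" for c by (simp add: e2_def e1)
  have e1c: "e1 [:c:] = mp_const c" for c by (simp add: e1_def hom_laws_mp_const)
  have X1: "e1 (pCons 0 1) = mp_var (\<sigma> 3)" by (simp add: e1_def hom_laws_mp_const)
  have X2: "e2 (pCons 0 1) = mp_var (\<sigma> 2)" by (simp add: e2_def e1)
  have X3: "e3 (pCons 0 1) = mp_var (\<sigma> 1)" by (simp add: e3_def e2)
  have X4: "\<Psi> (pCons 0 1) = mp_var (\<sigma> 0)" by (simp add: \<Psi>_def e3)
  have \<Psi>_gen: "\<Psi> (gen i) = mp_var (\<sigma> i)" for i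
  proof -
    have "i = 0 \<or> i = 1 \<or> i = 2 \<or> i = 3" using num4_eq by auto
    then show ?thesis
      using X1 X2 X3 X4 by (auto simp: gen_def \<Psi>c e3c e2c)
  qed
  have "\<Psi> (\<Phi> p) = p" for p
    by (rule mp_hom_eqI) (use \<Phi> \<Psi> in \<open>auto simp: hom_laws_def \<Phi>_const \<Phi>_var \<Psi>_gen \<sigma> \<Psi>c e3c e2c e1c\<close>)
  moreover have "\<Phi> (\<Psi> P) = P" for P
  proof -
    have id: "hom_laws (\<lambda>x. x)" by (simp add: hom_laws_def)
    have v: "\<Phi> (mp_var (\<sigma> i)) = gen i" for i by (simp add: \<Phi>_var \<sigma>)
    have 1: "\<Phi> (e1 c) = [:[:[:c:]:]:]" for c
      by (rule poly_hom_laws_eqI[of "\<lambda>c. \<Phi> (e1 c)" "\<lambda>c. [:[:[:c:]:]:]"])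
        (use \<Phi> e1 in \<open>simp_all add: hom_laws_comp e1c \<Phi>_const X1 v\<close>, simp_all add: hom_laws_def gen_def)
    have 2: "\<Phi> (e2 c) = [:[:c:]:]" for c
      by (rule poly_hom_laws_eqI[of "\<lambda>c. \<Phi> (e2 c)" "\<lambda>c. [:[:c:]:]"])
        (use \<Phi> e2 in \<open>simp_all add: hom_laws_comp e2c 1 X2 v\<close>, simp_all add: hom_laws_def gen_def)
    have 3: "\<Phi> (e3 c) = [:c:]" for c
      by (rule poly_hom_laws_eqI[of "\<lambda>c. \<Phi> (e3 c)" "\<lambda>c. [:c:]"])
        (use \<Phi> e3 in \<open>simp_all add: hom_laws_comp e3c 2 X3 v\<close>, simp_all add: hom_laws_def gen_def)
    show ?thesis
      by (rule poly_hom_laws_eqI[of "\<lambda>c. \<Phi> (\<Psi> c)" "\<lambda>c. c"])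
        (use \<Phi> \<Psi> in \<open>simp_all add: hom_laws_comp \<Psi>c 3 X4 v\<close>, simp_all add: hom_laws_def gen_def)
  qed
  moreover have "mp_pderiv l (\<Psi> [:c:]) = 0" for c
  proof -
    have v: "mp_pderiv l (mp_var (\<sigma> i)) = 0" if "i \<noteq> 0" for i
      using that \<sigma>_eq[of i] by (auto simp: mp_pderiv_var)
    have "mp_pderiv l (e1 c) = 0" for c
      unfolding e1_def by (rule mp_pderiv_extend_hom) (auto intro: hom_laws_mp_const v)
    then have "mp_pderiv l (e2 c) = 0" for c
      unfolding e2_def by (rule mp_pderiv_extend_hom[OF e1]) (auto intro: v)
    then have "mp_pderiv l (e3 c) = 0" for c
      unfolding e3_def by (rule mp_pderiv_extend_hom[OF e2]) (auto intro: v)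
    then show ?thesis by (simp add: \<Psi>c)
  qed
  ultimately show ?thesis using \<Phi> \<Psi> by blast
qed

text \<open>This is \<open>poly_elimination\<close>, transported along the isomorphism. Degree 0 in
  the outermost variable becomes a vanishing derivative by \<open>x_l\<close>, a condition that is
  inherited by partial derivatives.\<close>

lemma mp4_elimination:
  fixes q :: "'i::finite \<Rightarrow> (4, 'a::field_char_0) mpoly" and l :: 4
  assumes "q i0 \<noteq> 0"
  shows "(\<exists>G. prime_elem G \<and> (\<forall>i. G dvd q i)) \<or>
    (\<exists>A. (\<Sum>i\<in>UNIV. A i * q i) \<noteq> 0 \<and> mp_pderiv l (\<Sum>i\<in>UNIV. A i * q i) = 0)"
proof -
  obtain \<Phi> :: "(4, 'a) mpoly \<Rightarrow> 'a poly poly poly poly" and \<Psi>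
    where \<Phi>: "hom_laws \<Phi>" and \<Psi>: "hom_laws \<Psi>" and inv: "\<And>p. \<Psi> (\<Phi> p) = p" "\<And>P. \<Phi> (\<Psi> P) = P"
      and l: "\<And>c. mp_pderiv l (\<Psi> [:c:]) = 0"
    using mp4_iso_iterated_poly[of l] by blast
  have zero: "\<Psi> 0 = 0" "\<Phi> 0 = 0" using \<Phi> \<Psi> by (auto simp: hom_laws_def)
  have \<Psi>0: "\<Psi> p = 0 \<longleftrightarrow> p = 0" for p using inv(2)[of p] zero by auto
  have \<Phi>0: "\<Phi> p = 0 \<longleftrightarrow> p = 0" for p using inv(1)[of p] zero by auto
  have \<Psi>m: "\<Psi> (a * b) = \<Psi> a * \<Psi> b" for a b using \<Psi> by (simp add: hom_laws_def)
  have \<Phi>m: "\<Phi> (a * b) = \<Phi> a * \<Phi> b" for a b using \<Phi> by (simp add: hom_laws_def)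
  have dvd: "\<Psi> a dvd b \<longleftrightarrow> a dvd \<Phi> b" for a b
  proof
    assume "\<Psi> a dvd b"
    then obtain k where "b = \<Psi> a * k" by (auto simp: dvd_def)
    then show "a dvd \<Phi> b" by (simp add: \<Phi>m inv)
  next
    assume "a dvd \<Phi> b"
    then obtain k where "\<Phi> b = a * k" by (auto simp: dvd_def)
    then have "\<Psi> (\<Phi> b) = \<Psi> a * \<Psi> k" by (simp add: \<Psi>m)
    then show "\<Psi> a dvd b" by (simp add: inv)
  qed
  have "(\<exists>\<rho>. prime_elem \<rho> \<and> (\<forall>i. \<rho> dvd \<Phi> (q i))) \<or>
    (\<exists>A. (\<Sum>i\<in>UNIV. A i * \<Phi> (q i)) \<noteq> 0 \<and> degree (\<Sum>i\<in>UNIV. A i * \<Phi> (q i)) = 0)"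
    using poly_elimination[of "\<lambda>i. \<Phi> (q i)" i0] assms by (simp only: \<Phi>0 not_False_eq_True)
  then show ?thesis
  proof (elim disjE exE conjE)
    fix \<rho> assume \<rho>: "prime_elem \<rho>" "\<forall>i. \<rho> dvd \<Phi> (q i)"
    have "prime_elem (\<Psi> \<rho>)"
    proof (rule prime_elemI)
      show "\<Psi> \<rho> \<noteq> 0" using \<rho>(1) unfolding \<Psi>0 prime_elem_def by simp
      show "\<not> \<Psi> \<rho> dvd 1" using \<rho>(1) \<Phi> unfolding dvd hom_laws_def prime_elem_def by simp
      show "\<Psi> \<rho> dvd a \<or> \<Psi> \<rho> dvd b" if "\<Psi> \<rho> dvd a * b" for a b
        using that \<rho>(1) unfolding dvd \<Phi>m by (rule prime_elem_dvd_multD[rotated])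
    qed
    with \<rho> show ?thesis by (auto simp: dvd)
  next
    fix A assume A: "(\<Sum>i\<in>UNIV. A i * \<Phi> (q i)) \<noteq> 0" "degree (\<Sum>i\<in>UNIV. A i * \<Phi> (q i)) = 0"
    have sum: "\<Psi> (sum f I) = (\<Sum>i\<in>I. \<Psi> (f i))" for f and I :: "'i set"
      by (induction I rule: infinite_finite_induct) (use \<Psi> in \<open>simp_all add: hom_laws_def\<close>)
    then have eq: "(\<Sum>i\<in>UNIV. \<Psi> (A i) * q i) = \<Psi> (\<Sum>i\<in>UNIV. A i * \<Phi> (q i))"
      by (simp add: \<Psi>m inv)
    from A(2) obtain c where "(\<Sum>i\<in>UNIV. A i * \<Phi> (q i)) = [:c:]" by (rule degree_eq_zeroE)
    with l have "mp_pderiv l (\<Sum>i\<in>UNIV. \<Psi> (A i) * q i) = 0" unfolding eq by simp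
    moreover have "(\<Sum>i\<in>UNIV. \<Psi> (A i) * q i) \<noteq> 0" unfolding eq \<Psi>0 by (fact A)
    ultimately show ?thesis by (intro disjI2 exI[of _ "\<lambda>i. \<Psi> (A i)"]) simp
  qed
qed

subsection \<open>Homogeneous quasi-translations in four variables\<close>

lemma derivation_power:
  fixes E :: "'a::comm_ring_1 \<Rightarrow> 'a"
  assumes "\<And>x y. E (x * y) = E x * y + x * E y"
  shows "w * E (w ^ N) = of_nat N * w ^ N * E w"
proof (induction N)
  case 0
  have "E (1 * 1) = E 1 + E 1" by (subst assms) simp
  then show ?case by simp
next
  case (Suc N)
  have "w * E (w ^ Suc N) = w * (E w * w ^ N) + w * (w * E (w ^ N))"
    by (simp add: assms distrib_left)
  also have "\<dots> = of_nat (Suc N) * w ^ Suc N * E w" unfolding Suc.IH by (simp add: algebra_simps)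
  finally show ?case .
qed

text \<open>By the product rule, \<open>w ^ Suc N * E x\<close> is the difference of
  \<open>w * E (w ^ N * x)\<close> and a multiple of \<open>w ^ N * x\<close>. Hence the set of all
  \<open>x\<close> with some \<open>w ^ N * x\<close> in the ideal \<open>I\<close> is closed under
  \<open>E\<close>.\<close>

lemma derivation_saturation:
  fixes E :: "'a::comm_ring_1 \<Rightarrow> 'a"
  assumes E: "\<And>x y. E (x * y) = E x * y + x * E y"
    and I: "\<And>r x. x \<in> I \<Longrightarrow> r * x \<in> I" "\<And>x y. x \<in> I \<Longrightarrow> y \<in> I \<Longrightarrow> x - y \<in> I"
    and stable: "\<And>x. x \<in> I \<Longrightarrow> w * E x \<in> I"
    and x: "w ^ N * x \<in> I"
  shows "w ^ Suc N * E x \<in> I"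
proof -
  have "w * E (w ^ N * x) - (of_nat N * E w) * (w ^ N * x) \<in> I"
    by (intro I stable x)
  also have "w * E (w ^ N * x) = (w * E (w ^ N)) * x + w ^ Suc N * E x"
    by (simp add: E algebra_simps)
  also have "\<dots> - (of_nat N * E w) * (w ^ N * x) = w ^ Suc N * E x"
    unfolding derivation_power[OF E] by (simp add: algebra_simps)
  finally show ?thesis .
qed

text \<open>The quotient of \<alpha> and \<beta> has derivative 0. To avoid fractions,
  \<open>q\<close> is the combination that vanishes at a point \<open>b\<close> where \<beta> does
  not. The saturation of the ideal of \<open>q\<close> with respect to \<beta> is closed under
  partial derivatives; if \<open>q\<close> were nonzero, \<open>q\<close> would divide a nonzero
  multiple of a power of \<beta>, which is absurd at \<open>b\<close>.\<close>

lemma mp_const_ratio: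
  fixes \<alpha> \<beta> :: "('n::{finite, linorder}, 'a::field_char_0) mpoly"
  assumes eq: "\<And>i. mp_pderiv i \<alpha> * \<beta> = mp_pderiv i \<beta> * \<alpha>" and "\<beta> \<noteq> 0"
  shows "\<exists>c. \<alpha> = mp_const c * \<beta>"
proof -
  obtain b where b: "mp_eval \<beta> b \<noteq> 0" using mp_nonzero_point \<open>\<beta> \<noteq> 0\<close> by blast
  define q where "q = mp_const (mp_eval \<beta> b) * \<alpha> - mp_const (mp_eval \<alpha> b) * \<beta>"
  have q_deriv: "\<beta> * mp_pderiv i q = q * mp_pderiv i \<beta>" for i
  proof -
    have "\<beta> * mp_pderiv i q = mp_const (mp_eval \<beta> b) * (mp_pderiv i \<alpha> * \<beta>) - mp_const (mp_eval \<alpha> b) * \<beta> * mp_pderiv i \<beta>"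
      by (simp add: q_def mp_pderiv_minus mp_pderiv_mult algebra_simps)
    also have "\<dots> = q * mp_pderiv i \<beta>" unfolding eq by (simp add: q_def algebra_simps)
    finally show ?thesis .
  qed
  have "q = 0"
  proof (rule ccontr)
    assume "q \<noteq> 0"
    have "\<exists>c. c \<noteq> (0::'a) \<and> (\<exists>N. \<beta> ^ N * mp_const c \<in> {x. q dvd x})"
    proof (rule mp_pderiv_closed_contains_const[where T = "\<lambda>x. \<exists>N. \<beta> ^ N * x \<in> {x. q dvd x}" and p = q])
      show "\<exists>N. \<beta> ^ N * q \<in> {x. q dvd x}" by simp
      fix x i assume "\<exists>N. \<beta> ^ N * x \<in> {x. q dvd x}"
      then obtain N where N: "\<beta> ^ N * x \<in> {x. q dvd x}" by blast
      have "\<beta> ^ Suc N * mp_pderiv i x \<in> {x. q dvd x}"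
      proof (rule derivation_saturation[where E = "mp_pderiv i", OF mp_pderiv_mult _ _ _ N])
        fix y assume "y \<in> {x. q dvd x}"
        then obtain k where "y = q * k" by auto
        then have "\<beta> * mp_pderiv i y = q * (mp_pderiv i \<beta> * k + \<beta> * mp_pderiv i k)"
          using q_deriv[of i] by (simp add: mp_pderiv_mult algebra_simps)
        then show "\<beta> * mp_pderiv i y \<in> {x. q dvd x}" by simp
      qed auto
      then show "\<exists>N. \<beta> ^ N * mp_pderiv i x \<in> {x. q dvd x}" by blast
    qed fact
    then obtain c N k where c: "c \<noteq> 0" "\<beta> ^ N * mp_const c = q * k" by (auto simp: dvd_def)
    have "mp_eval q b = 0" by (simp add: q_def)
    then have "mp_eval (\<beta> ^ N * mp_const c) b = 0" unfolding c(2) by simp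
    with b c(1) show False by simp
  qed
  then have "mp_const (mp_eval \<beta> b) * \<alpha> = mp_const (mp_eval \<alpha> b) * \<beta>" by (simp add: q_def)
  moreover have "\<alpha> = mp_const (inverse (mp_eval \<beta> b) * mp_eval \<beta> b) * \<alpha>" using b by simp
  ultimately have "\<alpha> = mp_const (inverse (mp_eval \<beta> b) * mp_eval \<alpha> b) * \<beta>"
    by (simp only: mp_const_mult mult.assoc)
  then show ?thesis ..
qed

section \<open>Linear forms, minors and hyperplanes\<close>

abbreviation dotp :: "'a::comm_ring_1 ^ 'n::finite \<Rightarrow> 'a ^ 'n \<Rightarrow> 'a" where
  "dotp v w \<equiv> \<Sum>i\<in>UNIV. v $ i * w $ i"

definition mp_linform :: "'a::comm_ring_1 ^ 'n::finite \<Rightarrow> ('n, 'a) mpoly" where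
  "mp_linform c = (\<Sum>i\<in>UNIV. mp_const (c $ i) * mp_var i)"

lemma mp_eval_linform: "mp_eval (mp_linform c) v = dotp c v"
  by (simp add: mp_linform_def)

lemma mp_homogeneous_linform: "mp_homogeneous 1 (mp_linform c)"
  unfolding mp_linform_def by (intro mp_homogeneous_sum mp_homogeneous_const_mult mp_homogeneous_var)

lemma mp_linform_not_unit: "\<not> mp_linform (c :: 'a::field_char_0 ^ 'n::finite) dvd 1"
proof
  assume "mp_linform c dvd 1"
  then obtain k where "k \<noteq> 0" "mp_linform c = mp_const k" using mp_dvd_one_imp_const by blast
  then show False using mp_eval_linform[of c 0] by simp
qed

lemma mp_linform_dvd:
  fixes q :: "('n::finite, 'a::field_char_0) mpoly"
  assumes "c $ k \<noteq> 0" and van: "\<And>v. dotp c v = 0 \<Longrightarrow> mp_eval q v = 0"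
  shows "mp_linform c dvd q"
proof -
  let ?l = "mp_linform c"
  define w where "w = axis k (inverse (c $ k))"
  have cw: "dotp c w = 1"
    using assms(1) by (simp add: w_def axis_def if_distrib[where f = "\<lambda>x. _ * x"] cong: if_cong)
  \<comment> \<open>With c . w = 1, this substitution projects along \<open>w\<close> onto the
    hyperplane. It changes \<open>q\<close> only modulo the linear form, and after it
    \<open>q\<close> vanishes everywhere.\<close>
  let ?F = "\<lambda>i. mp_var i - mp_const (w $ i) * ?l"
  have "?l dvd q - mp_comp ?F q"
  proof (induction q rule: mp_induct)
    case (add p q)
    have *: "p + q - mp_comp ?F (p + q) = (p - mp_comp ?F p) + (q - mp_comp ?F q)"
      by (simp add: mp_comp_add)
    show ?case unfolding * using add by (rule dvd_add)
  next
    case (mult p q)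
    have *: "p * q - mp_comp ?F (p * q) = p * (q - mp_comp ?F q) + (p - mp_comp ?F p) * mp_comp ?F q"
      by (simp add: mp_comp_mult algebra_simps)
    show ?case unfolding * using mult by (intro dvd_add dvd_mult dvd_mult2)
  qed simp_all
  moreover have "mp_comp ?F q = 0"
  proof (rule mp_eval_all_zero_imp_zero)
    fix v
    have "mp_eval (mp_comp ?F q) v = mp_eval q (\<chi> i. v $ i - w $ i * mp_eval ?l v)"
      by (simp add: mp_eval_comp)
    also have "\<dots> = 0"
    proof (rule van)
      have "(\<Sum>i\<in>UNIV. c $ i * (\<chi> i. v $ i - w $ i * mp_eval ?l v) $ i) =
          mp_eval ?l v - dotp c w * mp_eval ?l v"
        by (simp add: right_diff_distrib sum_subtractf sum_distrib_right mult.assoc mp_eval_linform)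
      then show "(\<Sum>i\<in>UNIV. c $ i * (\<chi> i. v $ i - w $ i * mp_eval ?l v) $ i) = 0" by (simp add: cw)
    qed
    finally show "mp_eval (mp_comp ?F q) v = 0" .
  qed
  ultimately show ?thesis by simp
qed

definition minor3 :: "('i \<Rightarrow> 'a::comm_ring_1) \<Rightarrow> ('i \<Rightarrow> 'a) \<Rightarrow> ('i \<Rightarrow> 'a) \<Rightarrow> 'i \<Rightarrow> 'i \<Rightarrow> 'i \<Rightarrow> 'a" where
  "minor3 x y z i j k = x i * (y j * z k - y k * z j) - x j * (y i * z k - y k * z i) + x k * (y i * z j - y j * z i)"

lemma UNIV_4_distinct:
  assumes "distinct [i, j, k, m :: 4]"
  shows "UNIV = {i, j, k, m}"
  using assms by (intro card_subset_eq[symmetric]) auto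

lemma sum_4_distinct:
  fixes g :: "4 \<Rightarrow> 'b::comm_monoid_add"
  assumes "distinct [i, j, k, m]"
  shows "sum g UNIV = g i + g j + g k + g m"
  unfolding UNIV_4_distinct[OF assms] using assms by (auto simp: add_ac)

lemma fourth_index:
  assumes "distinct [i, j, k :: 4]"
  obtains m where "distinct [i, j, k, m]"
proof -
  have "card {i, j, k} < card (UNIV :: 4 set)" using assms by simp
  then have "{i, j, k} \<noteq> UNIV" by auto
  then obtain m where "m \<notin> {i, j, k}" by blast
  with assms have "distinct [i, j, k, m]" by auto
  then show ?thesis by (rule that)
qed

text \<open>Cramer's rule: each entry of \<open>v\<close> times the determinant is a combination of
  the three relations.\<close>

lemma minor3_eq_0_if_left_kernel:
  fixes x y z :: "'i \<Rightarrow> 'a::idom"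
  assumes "v i * x i + v j * x j + v k * x k = 0"
    and "v i * y i + v j * y j + v k * y k = 0"
    and "v i * z i + v j * z j + v k * z k = 0"
    and "v i \<noteq> 0 \<or> v j \<noteq> 0 \<or> v k \<noteq> 0"
  shows "minor3 x y z i j k = 0"
proof -
  have "v i * minor3 x y z i j k = (v i * x i + v j * x j + v k * x k) * (y j * z k - y k * z j)
      - (v i * y i + v j * y j + v k * y k) * (x j * z k - x k * z j)
      + (v i * z i + v j * z j + v k * z k) * (x j * y k - x k * y j)"
    by (simp add: minor3_def algebra_simps)
  moreover have "v j * minor3 x y z i j k = (v i * x i + v j * x j + v k * x k) * (y k * z i - y i * z k)
      - (v i * y i + v j * y j + v k * y k) * (x k * z i - x i * z k)
      + (v i * z i + v j * z j + v k * z k) * (x k * y i - x i * y k)"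
    by (simp add: minor3_def algebra_simps)
  moreover have "v k * minor3 x y z i j k = (v i * x i + v j * x j + v k * x k) * (y i * z j - y j * z i)
      - (v i * y i + v j * y j + v k * y k) * (x i * z j - x j * z i)
      + (v i * z i + v j * z j + v k * z k) * (x i * y j - x j * y i)"
    by (simp add: minor3_def algebra_simps)
  ultimately show ?thesis using assms by auto
qed

lemma hyperplane_span3:
  fixes p q r :: "'a::field ^ 4"
  assumes nz: "minor3 (($) p) (($) q) (($) r) i j k \<noteq> 0" and dist: "distinct [i, j, k, m]"
  shows "\<exists>c. c $ m \<noteq> 0 \<and> (\<forall>v. dotp c v = 0 \<longrightarrow>
    (\<exists>\<alpha> \<beta> \<gamma>. v = \<alpha> *s p + \<beta> *s q + \<gamma> *s r))"
proof -
  let ?M = "minor3 (($) p) (($) q) (($) r)"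
  let ?D = "?M i j k"
  \<comment> \<open>The generalized cross product of \<open>p\<close>, \<open>q\<close>,
    \<open>r\<close>, whose entries are signed 3 by 3 minors.\<close>
  define c where "c = (\<chi> n. if n = i then - ?M j k m else if n = j then ?M i k m
    else if n = k then - ?M i j m else ?D)"
  have c: "c $ i = - ?M j k m" "c $ j = ?M i k m" "c $ k = - ?M i j m" "c $ m = ?D"
    using dist by (auto simp: c_def)
  have orth: "dotp c p = 0" "dotp c q = 0" "dotp c r = 0"
    unfolding sum_4_distinct[OF dist] c minor3_def by (simp_all add: algebra_simps)
  show ?thesis
  proof (intro exI[of _ c] conjI allI impI)
    show "c $ m \<noteq> 0" using nz by (simp add: c)
    fix v assume v: "dotp c v = 0"
    \<comment> \<open>Cramer's rule for the coordinates \<open>i\<close>, \<open>j\<close>,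
      \<open>k\<close>. The coordinate \<open>m\<close> is then forced by orthogonality to
      \<open>c\<close>, as \<open>c $ m\<close> is not 0.\<close>
    define \<alpha> where "\<alpha> = minor3 (($) v) (($) q) (($) r) i j k / ?D"
    define \<beta> where "\<beta> = minor3 (($) p) (($) v) (($) r) i j k / ?D"
    define \<gamma> where "\<gamma> = minor3 (($) p) (($) q) (($) v) i j k / ?D"
    define y where "y = \<alpha> *s p + \<beta> *s q + \<gamma> *s r"
    have coord: "y $ n = v $ n" if "n = i \<or> n = j \<or> n = k" for n
    proof -
      have "minor3 (($) v) (($) q) (($) r) i j k * p $ n + minor3 (($) p) (($) v) (($) r) i j k * q $ n
          + minor3 (($) p) (($) q) (($) v) i j k * r $ n = ?D * v $ n"
        using that by (elim disjE) (simp_all add: minor3_def algebra_simps)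
      with nz show ?thesis by (simp add: y_def \<alpha>_def \<beta>_def \<gamma>_def field_simps)
    qed
    have "dotp c y = \<alpha> * dotp c p + \<beta> * dotp c q
        + \<gamma> * dotp c r"
      by (simp add: y_def sum_distrib_left sum.distrib algebra_simps)
    then have "dotp c y = dotp c v" using orth v by simp
    then have "c $ m * y $ m = c $ m * v $ m"
      unfolding sum_4_distinct[OF dist] by (simp add: coord)
    then have "y $ m = v $ m" using nz by (simp add: c)
    then have "y $ n = v $ n" for n using coord UNIV_4_distinct[OF dist] by blast
    then have "v = y" by (simp add: vec_eq_iff)
    then show "\<exists>\<alpha> \<beta> \<gamma>. v = \<alpha> *s p + \<beta> *s q + \<gamma> *s r" unfolding y_def by blast
  qed
qed

abbreviation mp_evals :: "('n \<Rightarrow> ('n::finite, 'a::comm_ring_1) mpoly) \<Rightarrow> 'a ^ 'n \<Rightarrow> 'a ^ 'n" where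
  "mp_evals h v \<equiv> (\<chi> i. mp_eval (h i) v)"

text \<open>
  A function that is constant along the lines in direction \<open>h\<close> takes the value \<open>q(0)\<close> at the points
  of the image of \<open>h\<close>: replace \<open>v\<close> by \<open>s v\<close> and let \<open>s\<close> tend to \<open>0\<close>.
\<close>

lemma mp_eval_at_image:
  fixes h :: "'n::{finite, linorder} \<Rightarrow> ('n, 'a::field_char_0) mpoly"
  assumes h: "\<And>i. mp_dir h (h i) = 0" "\<And>i. mp_homogeneous e (h i)" and q: "mp_dir h q = 0"
  shows "mp_eval q (t *s mp_evals h v) = mp_eval q 0"
proof -
  let ?P = "mp_line q (t *s mp_evals h v) v" and ?Q = "mp_line q 0 v"
  have "poly ?P s = poly ?Q s" if "s \<noteq> 0" for s
  proof -
    have "s *s v + (t / s ^ e) *s mp_evals h (s *s v) = t *s mp_evals h v + s *s v"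
      using that by (simp add: vec_eq_iff mp_eval_scale[OF h(2)])
    with mp_eval_flow_invariant[of h q "s *s v" "t / s ^ e"] h(1) q show ?thesis
      by (simp add: poly_mp_line)
  qed
  then have "?P = ?Q" by (rule poly_eqI_nonzero)
  then have "poly ?P 0 = poly ?Q 0" by simp
  then show ?thesis by (simp add: poly_mp_line)
qed

text \<open>By \<open>Dh\<close> the map x \<mapsto> x + h(x) has the inverse x \<mapsto> x - h(x);
  such maps are called quasi-translations. A positive degree makes \<open>h\<close> vanish at 0,
  hence on its own image.\<close>

locale quasi_translation =
  fixes h :: "4 \<Rightarrow> (4, 'a::field_char_0) mpoly" and e :: nat
  assumes hom: "mp_homogeneous e (h i)" and e_pos: "e > 0"
    and Dh: "mp_dir h (h i) = 0"
    and primitive: "(\<And>i. G dvd h i) \<Longrightarrow> G dvd 1"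
begin

lemma h_nonzero: "\<exists>i. h i \<noteq> 0"
proof (rule ccontr)
  assume "\<not> ?thesis"
  then have "(0 :: (4, 'a) mpoly) dvd h i" for i by simp
  from primitive[OF this] show False by simp
qed

lemma eval_h_at_image: "mp_eval (h i) (t *s mp_evals h v) = 0"
  using mp_eval_at_image[OF Dh hom Dh] mp_eval_homogeneous_0[OF hom e_pos] by simp

text \<open>
  Eliminating \<open>x\<^sub>l\<close> from the components of \<open>h\<close> gives a relation between these components in which the
  \<open>l\<close>-th one does not occur. The gradient of such a relation is the required vector.
\<close>

lemma left_kernel:
  "\<exists>v. v \<noteq> (\<lambda>_. 0) \<and> v l = 0 \<and> (\<forall>j. (\<Sum>i\<in>UNIV. v i * mp_pderiv j (h i)) = 0)"
proof (rule ccontr)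
  assume no: "\<not> ?thesis"
  \<comment> \<open>As \<open>h\<close> vanishes on its image, every combination of the
    \<open>h i\<close> is a relation between them.\<close>
  have comp_h: "mp_comp h (h i) = 0" for i
    using eval_h_at_image[of i 1] by (intro mp_eval_all_zero_imp_zero) (simp add: mp_eval_comp)
  obtain i0 where "h i0 \<noteq> 0" using h_nonzero by blast
  from mp4_elimination[where q = h and l = l, OF \<open>h i0 \<noteq> 0\<close>]
  have "\<exists>A. (\<Sum>i\<in>UNIV. A i * h i) \<noteq> 0 \<and> mp_pderiv l (\<Sum>i\<in>UNIV. A i * h i) = 0"
  proof (elim disjE)
    assume "\<exists>G. prime_elem G \<and> (\<forall>i. G dvd h i)"
    then obtain G where "prime_elem G" "\<And>i. G dvd h i" by auto
    with primitive[of G] show ?thesis by (simp add: prime_elem_def)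
  qed
  then obtain A where A: "(\<Sum>i\<in>UNIV. A i * h i) \<noteq> 0" "mp_pderiv l (\<Sum>i\<in>UNIV. A i * h i) = 0"
    by (elim exE conjE) (rule that)
  \<comment> \<open>If the gradient of every relation free of \<open>x_l\<close> vanished on the
    image of \<open>h\<close>, these relations would be closed under partial derivatives and would
    include a nonzero constant.\<close>
  have "\<exists>c. c \<noteq> (0::'a) \<and> (mp_pderiv l (mp_const c) = 0 \<and> mp_comp h (mp_const c) = 0)"
  proof (rule mp_pderiv_closed_contains_const[where T = "\<lambda>r. mp_pderiv l r = 0 \<and> mp_comp h r = 0"
        and p = "\<Sum>i\<in>UNIV. A i * h i"])
    show "mp_pderiv l (\<Sum>i\<in>UNIV. A i * h i) = 0 \<and> mp_comp h (\<Sum>i\<in>UNIV. A i * h i) = 0"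
      using A by (simp add: mp_comp_sum mp_comp_mult comp_h)
    fix r i assume r: "mp_pderiv l r = 0 \<and> mp_comp h r = 0"
    define v where "v = (\<lambda>i. mp_comp h (mp_pderiv i r))"
    have "v l = 0" using r by (simp add: v_def)
    moreover have "(\<Sum>i\<in>UNIV. v i * mp_pderiv j (h i)) = 0" for j
      using mp_pderiv_comp[of j h r] r by (simp add: v_def)
    ultimately have "v = (\<lambda>_. 0)" using no by blast
    then have "mp_comp h (mp_pderiv i r) = 0" unfolding v_def by (rule fun_cong)
    moreover have "mp_pderiv l (mp_pderiv i r) = 0" using r mp_pderiv_commute[of l i r] by simp
    ultimately show "mp_pderiv l (mp_pderiv i r) = 0 \<and> mp_comp h (mp_pderiv i r) = 0" by simp
  qed (use A in blast)
  then show False by simp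
qed

text \<open>The Jacobian matrix of \<open>h\<close> has rank at most \<open>2\<close>, and \<open>h\<close> is in its column space by Euler's identity.\<close>

lemma jacobian_minor3: "minor3 h (\<lambda>i. mp_pderiv s (h i)) (\<lambda>i. mp_pderiv t (h i)) i j k = 0"
proof (cases "distinct [i, j, k]")
  case True
  \<comment> \<open>A left kernel vector with entry 0 at the remaining index \<open>m\<close> is a
    left kernel vector for the rows \<open>i\<close>, \<open>j\<close>, \<open>k\<close>
    alone.\<close>
  then obtain m where dist: "distinct [i, j, k, m]" by (rule fourth_index)
  obtain v where v: "v \<noteq> (\<lambda>_. 0)" "v m = 0" "\<And>j. (\<Sum>i\<in>UNIV. v i * mp_pderiv j (h i)) = 0"
    using left_kernel[of m] by blast
  have "mp_const (of_nat e) * (\<Sum>i\<in>UNIV. v i * h i) = (\<Sum>i\<in>UNIV. v i * (\<Sum>j\<in>UNIV. mp_var j * mp_pderiv j (h i)))"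
    by (simp add: mp_euler[OF hom] sum_distrib_left mult_ac)
  also have "\<dots> = (\<Sum>i\<in>UNIV. \<Sum>j\<in>UNIV. mp_var j * (v i * mp_pderiv j (h i)))"
    by (simp add: sum_distrib_left mult_ac)
  also have "\<dots> = (\<Sum>j\<in>UNIV. mp_var j * (\<Sum>i\<in>UNIV. v i * mp_pderiv j (h i)))"
    by (subst sum.swap) (simp add: sum_distrib_left)
  finally have vh: "(\<Sum>i\<in>UNIV. v i * h i) = 0" using e_pos v(3) by simp
  have "v i \<noteq> 0 \<or> v j \<noteq> 0 \<or> v k \<noteq> 0"
  proof (rule ccontr)
    assume "\<not> ?thesis"
    then have "\<forall>n\<in>{i, j, k, m}. v n = 0" using v(2) by simp
    then have "v n = 0" for n unfolding UNIV_4_distinct[OF dist, symmetric] by simp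
    with v(1) show False by blast
  qed
  then show ?thesis
    using vh v(3)[of s] v(3)[of t] v(2) unfolding sum_4_distinct[OF dist]
    by (intro minor3_eq_0_if_left_kernel[where v = v]) simp_all
qed (auto simp: minor3_def algebra_simps)

text \<open>The numerator, over \<open>h a\<close> squared, of the j-th derivative of the quotient
  of \<open>h b\<close> by \<open>h a\<close>.\<close>

definition phi :: "4 \<Rightarrow> 4 \<Rightarrow> 4 \<Rightarrow> (4, 'a) mpoly" where
  "phi a b j = h a * mp_pderiv j (h b) - h b * mp_pderiv j (h a)"

text \<open>For \<open>p $ a\<close> nonzero, these are the equations of proportionality of
  \<open>h\<close> to \<open>p\<close>: the fibre over \<open>p\<close>, together with the zeros of
  \<open>h\<close>.\<close>

definition fibre_eq :: "4 \<Rightarrow> 'a ^ 4 \<Rightarrow> 4 \<Rightarrow> (4, 'a) mpoly" where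
  "fibre_eq a p j = mp_const (p $ a) * h j - mp_const (p $ j) * h a"

text \<open>Otherwise the quotient of \<open>h b\<close> by \<open>h a\<close> would be constant,
  and \<open>phi a b l\<close> would be 0.\<close>

lemma fibre_eq_nonzero:
  assumes u: "mp_eval (h a * phi a b l) u \<noteq> 0"
  shows "fibre_eq a (mp_evals h u) b \<noteq> 0"
proof
  define p where "p = mp_evals h u"
  have pa: "p $ a \<noteq> 0" using u by (simp add: p_def)
  assume "fibre_eq a (mp_evals h u) b = 0"
  then have eq: "mp_const (p $ a) * h b = mp_const (p $ b) * h a" by (simp add: fibre_eq_def p_def)
  from arg_cong[OF this, of "mp_pderiv l"]
  have eq': "mp_const (p $ a) * mp_pderiv l (h b) = mp_const (p $ b) * mp_pderiv l (h a)"
    by (simp add: mp_pderiv_mult)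
  have "mp_const (p $ a) * phi a b l =
      h a * (mp_const (p $ a) * mp_pderiv l (h b)) - (mp_const (p $ a) * h b) * mp_pderiv l (h a)"
    by (simp add: phi_def algebra_simps)
  also have "\<dots> = 0" unfolding eq eq' by (simp add: algebra_simps)
  finally have "phi a b l = 0" using pa by simp
  with u show False by simp
qed

text \<open>
  The vector fields \<open>E\<close> below are tangent to the fibres of the map to projective space that is
  given by \<open>h\<close>. So these fibres are three-dimensional, and their equations have a common factor.
\<close>

lemma fibre_common_factor:
  assumes u: "mp_eval (h a * phi a b l) u \<noteq> 0"
  shows "\<exists>G. prime_elem G \<and> (\<forall>j. G dvd fibre_eq a (mp_evals h u) j)"
proof (rule ccontr)
  assume no: "\<not> ?thesis"
  define p where "p = mp_evals h u"
  \<comment> \<open>The factor \<open>h a\<close> makes the ideal \<open>I\<close> stable under the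
    fields \<open>E j\<close>; the factor \<open>phi a b l\<close> comes from passing between
    \<open>E j\<close> and the partial derivative on polynomials free of \<open>x_l\<close>. Both
    are nonzero at \<open>u\<close>.\<close>
  define w where "w = phi a b l * h a"
  define I where "I = {x. \<exists>A. x = (\<Sum>i\<in>UNIV. A i * fibre_eq a p i)}"
  have pa: "p $ a \<noteq> 0" using u by (simp add: p_def)
  have "fibre_eq a p b \<noteq> 0" unfolding p_def by (rule fibre_eq_nonzero[OF u])
  from mp4_elimination[where q = "fibre_eq a p" and l = l, OF this]
  have "\<exists>A. (\<Sum>i\<in>UNIV. A i * fibre_eq a p i) \<noteq> 0 \<and>
      mp_pderiv l (\<Sum>i\<in>UNIV. A i * fibre_eq a p i) = 0"
  proof (elim disjE)
    assume "\<exists>G. prime_elem G \<and> (\<forall>i. G dvd fibre_eq a p i)"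
    with no[folded p_def] show ?thesis by (rule notE)
  qed
  then obtain A where A: "(\<Sum>i\<in>UNIV. A i * fibre_eq a p i) \<noteq> 0"
      "mp_pderiv l (\<Sum>i\<in>UNIV. A i * fibre_eq a p i) = 0"
    by (elim exE conjE) (rule that)
  have I: "r * x \<in> I" if "x \<in> I" for r x
  proof -
    from that obtain B where "x = (\<Sum>i\<in>UNIV. B i * fibre_eq a p i)" by (auto simp: I_def)
    then have "r * x = (\<Sum>i\<in>UNIV. (r * B i) * fibre_eq a p i)" by (simp add: sum_distrib_left mult.assoc)
    then show ?thesis unfolding I_def by (intro CollectI exI[of _ "\<lambda>i. r * B i"])
  qed
  have I_minus: "x - y \<in> I" if "x \<in> I" "y \<in> I" for x y
  proof -
    from that obtain B C where "x = (\<Sum>i\<in>UNIV. B i * fibre_eq a p i)" "y = (\<Sum>i\<in>UNIV. C i * fibre_eq a p i)"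
      by (auto simp: I_def)
    then have "x - y = (\<Sum>i\<in>UNIV. (B i - C i) * fibre_eq a p i)" by (simp add: sum_subtractf left_diff_distrib)
    then show ?thesis unfolding I_def by (intro CollectI exI[of _ "\<lambda>i. B i - C i"])
  qed
  \<comment> \<open>The combination of two partial derivatives that annihilates the quotient of
    \<open>h b\<close> by \<open>h a\<close>. As the Jacobian minors vanish, it annihilates all
    quotients by \<open>h a\<close>, which is \<open>E_h\<close> without denominators.\<close>
  define E where "E j x = phi a b l * mp_pderiv j x - phi a b j * mp_pderiv l x" for j x
  have E_mult: "E j (x * y) = E j x * y + x * E j y" for j x y
    by (simp add: E_def mp_pderiv_mult algebra_simps)
  have E_add: "E j (x + y) = E j x + E j y" for j x y
    by (simp add: E_def mp_pderiv_add algebra_simps)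
  have E_sum: "E j (sum g S) = (\<Sum>i\<in>S. E j (g i))" for j g and S :: "4 set"
    by (induction S rule: infinite_finite_induct) (simp_all add: E_add, simp_all add: E_def)
  have E_h: "h a * E j (h i) = h i * E j (h a)" for i j
  proof -
    have "h a * E j (h i) - h i * E j (h a) =
        - (h a * minor3 h (\<lambda>i. mp_pderiv j (h i)) (\<lambda>i. mp_pderiv l (h i)) a b i)"
      by (simp add: E_def phi_def minor3_def algebra_simps)
    then show ?thesis by (simp add: jacobian_minor3)
  qed
  have E_fibre: "h a * E j (fibre_eq a p i) = E j (h a) * fibre_eq a p i" for i j
  proof -
    have "E j (fibre_eq a p i) = mp_const (p $ a) * E j (h i) - mp_const (p $ i) * E j (h a)"
      by (simp add: E_def fibre_eq_def mp_pderiv_minus mp_pderiv_mult algebra_simps)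
    then have "h a * E j (fibre_eq a p i) = h a * (mp_const (p $ a) * E j (h i) - mp_const (p $ i) * E j (h a))"
      by simp
    also have "\<dots> = mp_const (p $ a) * (h a * E j (h i)) - mp_const (p $ i) * h a * E j (h a)"
      by (simp add: algebra_simps)
    finally show ?thesis unfolding E_h by (simp add: fibre_eq_def algebra_simps)
  qed
  have stable: "w * E j x \<in> I" if "x \<in> I" for j x
  proof -
    from that obtain B where B: "x = (\<Sum>i\<in>UNIV. B i * fibre_eq a p i)" by (auto simp: I_def)
    have "h a * E j x = (\<Sum>i\<in>UNIV. h a * E j (B i) * fibre_eq a p i + B i * (h a * E j (fibre_eq a p i)))"
      unfolding B by (simp add: E_sum E_mult sum_distrib_left algebra_simps)
    also have "\<dots> = (\<Sum>i\<in>UNIV. (h a * E j (B i) + B i * E j (h a)) * fibre_eq a p i)"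
      unfolding E_fibre by (simp add: algebra_simps)
    finally have "h a * E j x \<in> I"
      unfolding I_def by (intro CollectI exI[of _ "\<lambda>i. h a * E j (B i) + B i * E j (h a)"])
    from I[OF this, of "phi a b l"] show ?thesis by (simp add: w_def mult.assoc)
  qed
  \<comment> \<open>On polynomials free of \<open>x_l\<close>, \<open>E j\<close> is
    \<open>phi a b l\<close> times the j-th derivative. So those in the saturation of
    \<open>I\<close> are closed under partial derivatives. A nonzero constant among them puts a
    multiple of a power of \<open>w\<close> into \<open>I\<close>, but \<open>I\<close> vanishes at
    \<open>u\<close>.\<close>
  have "\<exists>c. c \<noteq> (0::'a) \<and> (mp_pderiv l (mp_const c) = 0 \<and> (\<exists>N. w ^ N * mp_const c \<in> I))"
  proof (rule mp_pderiv_closed_contains_const[where T = "\<lambda>x. mp_pderiv l x = 0 \<and> (\<exists>N. w ^ N * x \<in> I)"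
        and p = "\<Sum>i\<in>UNIV. A i * fibre_eq a p i"])
    have "w ^ 0 * (\<Sum>i\<in>UNIV. A i * fibre_eq a p i) \<in> I" by (auto simp: I_def)
    with A(2) show "mp_pderiv l (\<Sum>i\<in>UNIV. A i * fibre_eq a p i) = 0 \<and>
        (\<exists>N. w ^ N * (\<Sum>i\<in>UNIV. A i * fibre_eq a p i) \<in> I)" by blast
    fix x j assume "mp_pderiv l x = 0 \<and> (\<exists>N. w ^ N * x \<in> I)"
    then obtain N where x: "mp_pderiv l x = 0" "w ^ N * x \<in> I" by blast
    have "w ^ Suc N * E j x \<in> I"
      using derivation_saturation[where E = "E j" and I = I and w = w, OF E_mult I I_minus stable x(2)] .
    then have "h a * (w ^ Suc N * E j x) \<in> I" by (rule I)
    also have "h a * (w ^ Suc N * E j x) = w ^ Suc (Suc N) * mp_pderiv j x"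
      using x(1) by (simp add: E_def w_def algebra_simps)
    finally have "\<exists>N. w ^ N * mp_pderiv j x \<in> I" by blast
    moreover have "mp_pderiv l (mp_pderiv j x) = 0" using x(1) mp_pderiv_commute[of l j x] by simp
    ultimately show "mp_pderiv l (mp_pderiv j x) = 0 \<and> (\<exists>N. w ^ N * mp_pderiv j x \<in> I)" by blast
  qed (use A in blast)
  then obtain c N B where c: "c \<noteq> 0" "w ^ N * mp_const c = (\<Sum>i\<in>UNIV. B i * fibre_eq a p i)"
    by (auto simp: I_def)
  have "mp_eval (fibre_eq a p i) u = 0" for i by (simp add: fibre_eq_def p_def)
  then have "mp_eval (w ^ N * mp_const c) u = 0" unfolding c(2) by simp
  with c(1) u show False by (simp add: w_def)
qed

text \<open>\<open>G\<close> divides a nonzero homogeneous invariant of the flow, so it is itself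
  homogeneous and invariant. It has positive degree and therefore vanishes on the image of
  \<open>h\<close>. If it divided \<open>h a\<close>, the fibre equations would make it a common
  factor of \<open>h\<close>.\<close>

lemma fibre_factor_properties:
  assumes G: "prime_elem G" "\<And>j. G dvd fibre_eq a p j" and pa: "p $ a \<noteq> 0" and nz: "fibre_eq a p b \<noteq> 0"
  shows "mp_dir h G = 0" "mp_eval G (t *s mp_evals h v) = 0" "\<not> G dvd h a"
    "mp_eval G y = 0 \<Longrightarrow> p $ a * mp_eval (h j) y = p $ j * mp_eval (h a) y"
proof -
  obtain K where K: "fibre_eq a p b = G * K" using G(2) by (auto simp: dvd_def)
  have "mp_dir h (G * K) = 0"
    unfolding K[symmetric] by (simp add: fibre_eq_def mp_dir_minus mp_dir_mult Dh)
  then show D: "mp_dir h G = 0" using mp_dir_factor[of h G K] Dh nz K by simp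
  have "mp_homogeneous e (G * K)"
    unfolding K[symmetric] fibre_eq_def
    by (intro mp_homogeneous_minus mp_homogeneous_const_mult hom)
  with nz K obtain g where g: "mp_homogeneous g G" using mp_homogeneous_factor[of e G K] by auto
  have "g > 0"
    using mp_homogeneous_0_imp_unit[of G] g G(1) by (cases g) (auto simp: prime_elem_def)
  then show "mp_eval G (t *s mp_evals h v) = 0"
    using mp_eval_at_image[OF Dh hom D] mp_eval_homogeneous_0[OF g] by simp
  show "\<not> G dvd h a"
  proof
    assume a: "G dvd h a"
    have "G dvd h j" for j
    proof -
      have "G dvd fibre_eq a p j + mp_const (p $ j) * h a" using a G(2) by (intro dvd_add dvd_mult)
      then have "G dvd mp_const (inverse (p $ a)) * (mp_const (p $ a) * h j)"
        by (simp add: fibre_eq_def)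
      then show ?thesis using pa by (simp flip: mult.assoc mp_const_mult)
    qed
    from primitive[OF this] G(1) show False by (simp add: prime_elem_def)
  qed
  show "p $ a * mp_eval (h j) y = p $ j * mp_eval (h a) y" if "mp_eval G y = 0"
  proof -
    have "mp_eval (fibre_eq a p j) y = 0" using G(2)[of j] that by (auto simp: dvd_def)
    then show ?thesis by (simp add: fibre_eq_def)
  qed
qed

text \<open>On the hypersurface \<open>G = 0\<close> the vector field \<open>h\<close> is proportional to \<open>p\<close>.\<close>

lemma fibre_factor_translation:
  assumes G: "prime_elem G" "\<And>j. G dvd fibre_eq a p j" "p $ a \<noteq> 0" "fibre_eq a p b \<noteq> 0"
    and H: "mp_dir h H = 0" and y: "mp_eval G y = 0"
  shows "mp_eval H (y + t *s p) = mp_eval H y"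
proof -
  \<comment> \<open>Modulo the fibre equations, hence modulo \<open>G\<close>, \<open>h a\<close>
    times the derivative along \<open>p\<close> is \<open>p $ a\<close> times the derivative along
    \<open>h\<close>. The prime \<open>G\<close> does not divide \<open>h a\<close>.\<close>
  have dvd: "G dvd mp_dconst p K" if K: "mp_dir h K = 0" for K
  proof -
    have "h a * mp_dconst p K = mp_const (p $ a) * mp_dir h K - (\<Sum>i\<in>UNIV. fibre_eq a p i * mp_pderiv i K)"
      by (simp add: mp_dconst_def mp_dir_def fibre_eq_def sum_distrib_left sum_subtractf algebra_simps)
    moreover have "G dvd (\<Sum>i\<in>UNIV. fibre_eq a p i * mp_pderiv i K)" by (intro dvd_sum dvd_mult2 G(2))
    ultimately have "G dvd h a * mp_dconst p K" using K by simp
    with G(1) fibre_factor_properties(3)[OF G] show ?thesis by (auto dest: prime_elem_dvd_multD)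
  qed
  \<comment> \<open>The case K = G: by reasons of degree \<open>G\<close> is invariant along
    \<open>p\<close>. So the whole line through \<open>y\<close> in direction \<open>p\<close> lies
    in G = 0, where the derivative of \<open>H\<close> along \<open>p\<close> vanishes.\<close>
  have G0: "mp_dconst p G = 0"
    using mp_dconst_dvd_imp_zero dvd fibre_factor_properties(1)[OF G] by blast
  have "poly (pderiv (mp_line H y p)) s = 0" for s
  proof -
    obtain k where "mp_dconst p H = G * k" using dvd[OF H] by (auto simp: dvd_def)
    then show ?thesis using mp_dconst_invariant[OF G0, of y s] y by (simp add: poly_pderiv_mp_line)
  qed
  then have "pderiv (mp_line H y p) = 0" using poly_all_0_iff_0 by blast
  then have "degree (mp_line H y p) = 0" by (simp add: pderiv_eq_0_iff)
  then obtain c where c: "mp_line H y p = [:c:]" by (rule degree_eq_zeroE)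
  show ?thesis using poly_mp_line[of H y p t] poly_mp_line[of H y p 0] unfolding c by simp
qed

text \<open>G = 0 and H = 0 both contain the image of \<open>h\<close>. On H = 0, \<open>G\<close>
  is constant in direction \<open>q\<close>, and on G = 0 it is constant in direction
  \<open>p\<close>; thus \<open>G\<close> vanishes on the whole span, and likewise \<open>H\<close>.
  There \<open>h\<close> is proportional to both \<open>p\<close> and \<open>q\<close>, which are
  independent.\<close>

lemma h_vanishes_on_span:
  assumes G: "prime_elem G" "\<And>j. G dvd fibre_eq a p j" "p $ a \<noteq> 0" "fibre_eq a p b \<noteq> 0" "p = mp_evals h u"
    and H: "prime_elem H" "\<And>j. H dvd fibre_eq a q j" "q $ a \<noteq> 0" "fibre_eq a q b \<noteq> 0" "q = mp_evals h u'"
    and pq: "q $ a * p $ n \<noteq> p $ a * q $ n"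
  shows "mp_eval (h j) (\<alpha> *s p + \<beta> *s q + \<gamma> *s mp_evals h v) = 0"
proof -
  note PG = fibre_factor_properties[OF G(1-4)] and PH = fibre_factor_properties[OF H(1-4)]
  let ?r = "\<gamma> *s mp_evals h v" and ?y = "\<alpha> *s p + \<beta> *s q + \<gamma> *s mp_evals h v"
  have "mp_eval G (?r + \<beta> *s q) = 0"
    using fibre_factor_translation[OF H(1-4) PG(1) PH(2)] PG(2) by simp
  from fibre_factor_translation[OF G(1-4) PG(1) this, of \<alpha>] this
  have Gy: "mp_eval G ?y = 0" by (simp add: add_ac)
  have "mp_eval H (?r + \<alpha> *s p) = 0"
    using fibre_factor_translation[OF G(1-4) PH(1) PG(2)] PH(2) by simp
  from fibre_factor_translation[OF H(1-4) PH(1) this, of \<beta>] this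
  have Hy: "mp_eval H ?y = 0" by (simp add: add_ac)
  have "mp_eval (h a) ?y = 0"
  proof (rule ccontr)
    assume nz: "mp_eval (h a) ?y \<noteq> 0"
    have "(q $ a * p $ n) * mp_eval (h a) ?y = q $ a * (p $ a * mp_eval (h n) ?y)"
      using PG(4)[OF Gy, of n] by simp
    also have "\<dots> = p $ a * (q $ n * mp_eval (h a) ?y)" using PH(4)[OF Hy, of n] by simp
    finally show False using nz pq by simp
  qed
  with PG(4)[OF Gy, of j] G(3) show ?thesis by simp
qed

lemma image_in_plane: "\<exists>p q \<alpha> \<beta>. \<forall>k. h k = mp_const (p $ k) * \<alpha> + mp_const (q $ k) * \<beta>"
proof (cases "\<exists>a b l. h a * phi a b l \<noteq> 0")
  case True
  then obtain a b l where ab: "h a * phi a b l \<noteq> 0" by blast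
  then obtain u where u: "mp_eval (h a * phi a b l) u \<noteq> 0" by (rule mp_nonzero_point)
  define p where "p = mp_evals h u"
  have nz_p: "fibre_eq a p b \<noteq> 0" unfolding p_def by (rule fibre_eq_nonzero[OF u])
  obtain G where G: "prime_elem G" "\<And>j. G dvd fibre_eq a p j"
    using fibre_common_factor[OF u, folded p_def] by (elim exE conjE) (erule that, erule spec)
  \<comment> \<open>The second point is general and lies outside the fibre over \<open>p\<close>, so
    that \<open>p\<close> and \<open>q\<close> differ already in the ratio of the coordinates
    \<open>a\<close> and \<open>b\<close>.\<close>
  from ab nz_p have "h a * phi a b l * fibre_eq a p b \<noteq> 0" by simp
  then obtain u' where "mp_eval (h a * phi a b l * fibre_eq a p b) u' \<noteq> 0" by (rule mp_nonzero_point)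
  then have u': "mp_eval (h a * phi a b l) u' \<noteq> 0" "mp_eval (fibre_eq a p b) u' \<noteq> 0" by auto
  define q where "q = mp_evals h u'"
  have nz_q: "fibre_eq a q b \<noteq> 0" unfolding q_def by (rule fibre_eq_nonzero[OF u'(1)])
  obtain H where H: "prime_elem H" "\<And>j. H dvd fibre_eq a q j"
    using fibre_common_factor[OF u'(1), folded q_def] by (elim exE conjE) (erule that, erule spec)
  have pq: "p $ a \<noteq> 0" "q $ a \<noteq> 0" using u u'(1) by (simp_all add: p_def q_def)
  define \<delta> where "\<delta> = p $ a * q $ b - p $ b * q $ a"
  have \<delta>: "\<delta> \<noteq> 0" using u'(2) by (simp add: fibre_eq_def \<delta>_def q_def)
  have pqb: "q $ a * p $ b \<noteq> p $ a * q $ b"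
  proof
    assume "q $ a * p $ b = p $ a * q $ b"
    then have "\<delta> = 0" by (simp add: \<delta>_def mult.commute)
    with \<delta> show False ..
  qed
  \<comment> \<open>A value of \<open>h\<close> independent of \<open>p\<close> and \<open>q\<close>
    would span a hyperplane with them. Since \<open>h\<close> vanishes on it, its linear form would
    be a common factor.\<close>
  have minor: "minor3 (($) p) (($) q) (($) (mp_evals h v)) a b k = 0" for v k
  proof (rule ccontr)
    assume nz: "minor3 (($) p) (($) q) (($) (mp_evals h v)) a b k \<noteq> 0"
    then have "distinct [a, b, k]" by (auto simp: minor3_def algebra_simps)
    then obtain m where dist: "distinct [a, b, k, m]" by (rule fourth_index)
    from hyperplane_span3[OF nz dist] obtain c where c: "c $ m \<noteq> 0"
      "\<And>y. dotp c y = 0 \<Longrightarrow> \<exists>\<alpha> \<beta> \<gamma>. y = \<alpha> *s p + \<beta> *s q + \<gamma> *s mp_evals h v"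
      by blast
    have "mp_linform c dvd h j" for j
    proof (rule mp_linform_dvd[OF c(1)])
      fix y :: "'a ^ 4" assume "dotp c y = 0"
      with c(2) obtain \<alpha> \<beta> \<gamma> where "y = \<alpha> *s p + \<beta> *s q + \<gamma> *s mp_evals h v" by blast
      then show "mp_eval (h j) y = 0"
        using h_vanishes_on_span[OF G pq(1) nz_p p_def H pq(2) nz_q q_def pqb] by simp
    qed
    from primitive[OF this] mp_linform_not_unit show False by blast
  qed
  \<comment> \<open>Cramer's rule in the coordinates \<open>a\<close> and \<open>b\<close>; the
    vanishing minors yield the other coordinates.\<close>
  define \<alpha> where "\<alpha> = mp_const (inverse \<delta>) * (mp_const (q $ b) * h a - mp_const (q $ a) * h b)"
  define \<beta> where "\<beta> = mp_const (inverse \<delta>) * (mp_const (p $ a) * h b - mp_const (p $ b) * h a)"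
  have "h k = mp_const (p $ k) * \<alpha> + mp_const (q $ k) * \<beta>" for k
  proof (rule mp_eqI)
    fix v
    have "\<delta> * mp_eval (h k) v = p $ k * (q $ b * mp_eval (h a) v - q $ a * mp_eval (h b) v) +
        q $ k * (p $ a * mp_eval (h b) v - p $ b * mp_eval (h a) v)"
      using minor[of v k] by (simp add: minor3_def \<delta>_def algebra_simps)
    moreover have "mp_eval (h k) v = inverse \<delta> * (\<delta> * mp_eval (h k) v)" using \<delta> by simp
    ultimately have "mp_eval (h k) v = inverse \<delta> *
        (p $ k * (q $ b * mp_eval (h a) v - q $ a * mp_eval (h b) v) +
        q $ k * (p $ a * mp_eval (h b) v - p $ b * mp_eval (h a) v))" by simp
    also have "\<dots> = mp_eval (mp_const (p $ k) * \<alpha> + mp_const (q $ k) * \<beta>) v"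
      by (simp add: \<alpha>_def \<beta>_def algebra_simps)
    finally show "mp_eval (h k) v = mp_eval (mp_const (p $ k) * \<alpha> + mp_const (q $ k) * \<beta>) v" .
  qed
  then show ?thesis by blast
next
  case False
  obtain a where a: "h a \<noteq> 0" using h_nonzero by blast
  \<comment> \<open>All \<open>phi a b j\<close> vanish for this \<open>a\<close>, so the components
    are constant multiples of \<open>h a\<close> and one direction suffices.\<close>
  have "\<exists>c. h b = mp_const c * h a" for b
  proof (rule mp_const_ratio[OF _ a])
    fix j
    have "phi a b j = 0" using False a by auto
    then show "mp_pderiv j (h b) * h a = mp_pderiv j (h a) * h b" by (simp add: phi_def mult.commute)
  qed
  then have "\<forall>b. \<exists>c. h b = mp_const c * h a" ..
  from choice[OF this] obtain c where c: "\<forall>b. h b = mp_const (c b) * h a" ..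
  have "\<forall>k. h k = mp_const ((\<chi> k. c k) $ k) * h a + mp_const ((0 :: 'a ^ 4) $ k) * 0"
  proof
    fix k
    from c have "h k = mp_const (c k) * h a" ..
    then show "h k = mp_const ((\<chi> k. c k) $ k) * h a + mp_const ((0 :: 'a ^ 4) $ k) * 0" by simp
  qed
  then show ?thesis by (intro exI)
qed

lemma mp_dconst_combination:
  assumes "\<And>k. h k = mp_const (p $ k) * \<alpha> + mp_const (q $ k) * \<beta>"
  shows "mp_dconst (mp_evals h v) g =
    mp_const (mp_eval \<alpha> v) * mp_dconst p g + mp_const (mp_eval \<beta> v) * mp_dconst q g"
    "mp_dir h g = \<alpha> * mp_dconst p g + \<beta> * mp_dconst q g"
  by (simp_all add: assms mp_dconst_def mp_dir_def mp_const_add mp_const_mult sum_distrib_left sum.distrib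
      algebra_simps)

text \<open>With P, Q the derivatives of \<open>f\<close> along \<open>p\<close>, \<open>q\<close>,
  differentiate \<alpha> P + \<beta> Q = 0. Invariance of the partial derivatives of
  \<open>f\<close> leaves the same relation between the derivatives of \<alpha> and \<beta>. Unless
  P = Q = 0, the ratio of \<alpha> and \<beta> is therefore constant, \<open>h\<close> has a fixed
  direction, and the given relation is invariance along it.\<close>

lemma invariant_of_image_directions:
  assumes f: "mp_dir h f = 0" "\<And>i. mp_dir h (mp_pderiv i f) = 0"
  shows "mp_dconst (mp_evals h v) f = 0"
proof -
  obtain p q \<alpha> \<beta> where h: "\<And>k. h k = mp_const (p $ k) * \<alpha> + mp_const (q $ k) * \<beta>"
    using image_in_plane by blast
  note comb = mp_dconst_combination[OF h]
  define P where "P = mp_dconst p f"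
  define Q where "Q = mp_dconst q f"
  have PQ: "\<alpha> * P + \<beta> * Q = 0" using comb(2)[of f] f(1) by (simp add: P_def Q_def)
  have dP: "mp_pderiv i (mp_dconst r f) = mp_dconst r (mp_pderiv i f)" for i r
    by (simp add: mp_dconst_def mp_dir_def mp_pderiv_sum mp_pderiv_mult mp_pderiv_commute[of i])
  have dPQ: "mp_pderiv i \<alpha> * P + mp_pderiv i \<beta> * Q = 0" for i
  proof -
    have "0 = mp_pderiv i (\<alpha> * P + \<beta> * Q)" using PQ by simp
    also have "\<dots> = mp_pderiv i \<alpha> * P + mp_pderiv i \<beta> * Q + mp_dir h (mp_pderiv i f)"
      unfolding comb(2) P_def Q_def by (simp add: mp_pderiv_add mp_pderiv_mult dP algebra_simps)
    finally show ?thesis using f(2) by simp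
  qed
  show ?thesis
  proof (cases "P = 0 \<and> Q = 0")
    case True
    then show ?thesis by (simp add: comb(1) P_def Q_def)
  next
    case False
    have eq: "mp_pderiv i \<alpha> * \<beta> = mp_pderiv i \<beta> * \<alpha>" for i
    proof -
      have "P * (mp_pderiv i \<alpha> * \<beta> - mp_pderiv i \<beta> * \<alpha>) =
          (mp_pderiv i \<alpha> * P + mp_pderiv i \<beta> * Q) * \<beta> - mp_pderiv i \<beta> * (\<alpha> * P + \<beta> * Q)"
        "Q * (mp_pderiv i \<alpha> * \<beta> - mp_pderiv i \<beta> * \<alpha>) =
          mp_pderiv i \<alpha> * (\<alpha> * P + \<beta> * Q) - (mp_pderiv i \<alpha> * P + mp_pderiv i \<beta> * Q) * \<alpha>"
        by (simp_all add: algebra_simps)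
      with False show ?thesis unfolding PQ dPQ by auto
    qed
    show ?thesis
    proof (cases "\<beta> = 0")
      case True
      with PQ have "\<alpha> = 0 \<or> P = 0" by simp
      with True show ?thesis by (auto simp: comb(1) P_def)
    next
      case False
      from mp_const_ratio[OF eq this] obtain c where c: "\<alpha> = mp_const c * \<beta>" by blast
      with PQ have "\<beta> * (mp_const c * P + Q) = 0" by (simp add: algebra_simps)
      with False have 0: "mp_const c * P + Q = 0" by simp
      have "mp_dconst (mp_evals h v) f = mp_const (mp_eval \<beta> v) * (mp_const c * P + Q)"
        by (simp add: comb(1) c P_def Q_def mp_const_mult algebra_simps)
      with 0 show ?thesis by simp
    qed
  qed
qed

end

lemma mp_dconst_scale: "mp_dconst (s *s p) g = mp_const s * mp_dconst p g"
  by (simp add: mp_dconst_def mp_dir_def mp_const_mult sum_distrib_left mult.assoc)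

text \<open>Induction on the degree: a common factor \<open>G\<close> that is not a unit can be
  split off, as \<open>mp_dir_factor\<close> makes the quotient \<open>k\<close> a quasi-translation
  with the same invariants. The values of \<open>h\<close> are multiples of those of
  \<open>k\<close>. Coprime components fall under the locale, and for degree 0 \<open>h\<close> is a
  constant direction.\<close>

theorem quasi_translation_invariant:
  fixes h :: "4 \<Rightarrow> (4, 'a::field_char_0) mpoly"
  assumes "\<And>i. mp_homogeneous e (h i)" "\<And>i. mp_dir h (h i) = 0"
    and "mp_dir h f = 0" "\<And>i. mp_dir h (mp_pderiv i f) = 0"
  shows "mp_dconst (mp_evals h v) f = 0"
  using assms
proof (induction e arbitrary: h rule: less_induct)
  case (less e h)
  consider (zero) "\<forall>i. h i = 0" | (factor) i0 G where "h i0 \<noteq> 0" "\<And>i. G dvd h i" "\<not> G dvd 1"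
    | (prim) "\<And>G. (\<And>i. G dvd h i) \<Longrightarrow> G dvd 1" by blast
  then show ?case
  proof cases
    case zero
    then show ?thesis by (simp add: mp_dconst_def mp_dir_def)
  next
    case factor
    then obtain k where k: "\<And>i. h i = G * k i" unfolding dvd_def by metis
    have G0: "G \<noteq> 0" using factor(1) k by auto
    obtain g where g: "mp_homogeneous g G"
      using mp_homogeneous_factor[of e G "k i0"] less.prems(1)[of i0] factor(1) k[of i0] by auto
    have "g \<noteq> 0"
    proof
      assume "g = 0"
      with g G0 have "G dvd 1" using mp_homogeneous_0_imp_unit by blast
      with factor(3) show False ..
    qed
    have deg: "\<exists>d. mp_homogeneous d (k i) \<and> g + d = e" if "k i \<noteq> 0" for i
    proof -
      have hi: "mp_homogeneous e (k i * G)" "k i * G \<noteq> 0"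
        using less.prems(1)[of i] k[of i] that G0 by (simp_all add: mult.commute)
      from mp_homogeneous_factor[OF this] obtain d where d: "mp_homogeneous d (k i)" by blast
      from mp_homogeneous_unique[OF mp_homogeneous_mult[OF d g] hi] d show ?thesis by auto
    qed
    have hom_k: "mp_homogeneous (e - g) (k i)" for i
      using deg[of i] by (cases "k i = 0") auto
    have "k i0 \<noteq> 0" using factor(1) k by auto
    from deg[OF this] \<open>g \<noteq> 0\<close> have "e - g < e" by auto
    have h_eq: "h = (\<lambda>i. G * k i)" using k by blast
    have dir: "mp_dir h q = G * mp_dir k q" for q unfolding h_eq by (rule mp_dir_smult)
    have "mp_dir k (k i) = 0" for i
    proof (cases "k i = 0")
      case False
      have "mp_dir h (k i * G) = 0" using less.prems(2)[of i] k[of i] by (simp add: mult.commute)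
      from mp_dir_factor[OF less.prems(2) this] False G0 have "mp_dir h (k i) = 0" by simp
      with dir G0 show ?thesis by simp
    qed simp
    with less.IH[OF \<open>e - g < e\<close> hom_k] less.prems(3,4) dir G0
    have "mp_dconst (mp_evals k v) f = 0" by simp
    moreover have "mp_evals h v = mp_eval G v *s mp_evals k v" by (simp add: vec_eq_iff k)
    ultimately show ?thesis by (simp add: mp_dconst_scale)
  next
    case prim
    show ?thesis
    proof (cases "e = 0")
      case True
      have "h i = mp_const (mp_eval (h i) v)" for i
      proof -
        obtain c where "h i = mp_const c"
          using mp_homogeneous_0_imp_const less.prems(1)[of i] True by blast
        then show ?thesis by simp
      qed
      then have "mp_dconst (mp_evals h v) f = mp_dir h f" by (simp add: mp_dconst_def mp_dir_def)
      with less.prems(3) show ?thesis by simp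
    next
      case False
      interpret quasi_translation h e
        by unfold_locales (use less.prems False prim in auto)
      show ?thesis by (rule invariant_of_image_directions[OF less.prems(3,4)])
    qed
  qed
qed

subsection \<open>The Jacobian criterion\<close>

lemma underdetermined_system:
  fixes c :: "'i \<Rightarrow> 'k \<Rightarrow> 'a::field"
  assumes "finite K" "finite I" "card K < card I"
  shows "\<exists>a. (\<exists>i\<in>I. a i \<noteq> 0) \<and> (\<forall>k\<in>K. (\<Sum>i\<in>I. a i * c i k) = 0)"
  using assms
proof (induction K arbitrary: I c rule: finite_induct)
  case empty
  then obtain i where "i \<in> I" by fastforce
  then show ?case by (intro exI[of _ "\<lambda>_. 1"]) auto
next
  case (insert k0 K)
  show ?case
  proof (cases "\<forall>i\<in>I. c i k0 = 0")
    case True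
    have "card K < card I" using insert by simp
    from insert.IH[OF insert.prems(1) this, of c] True show ?thesis by auto
  next
    case False
    then obtain i0 where i0: "i0 \<in> I" "c i0 k0 \<noteq> 0" by blast
    \<comment> \<open>The equation \<open>k0\<close> is solved for the unknown \<open>i0\<close>,
      which is then substituted into the others.\<close>
    define c' where "c' i k = c i k - c i k0 / c i0 k0 * c i0 k" for i k
    have "card K < card (I - {i0})" using insert i0 by simp
    with insert.IH[of "I - {i0}" c'] insert.prems(1) obtain a
      where a: "\<exists>i\<in>I - {i0}. a i \<noteq> 0" "\<forall>k\<in>K. (\<Sum>i\<in>I - {i0}. a i * c' i k) = 0" by auto
    define s where "s = (\<Sum>i\<in>I - {i0}. a i * c i k0)"
    define b where "b = a(i0 := - s / c i0 k0)"
    have sum_b: "(\<Sum>i\<in>I. b i * c i k) = - s / c i0 k0 * c i0 k + (\<Sum>i\<in>I - {i0}. a i * c i k)" for k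
      using insert.prems(1) i0(1) by (simp add: sum.remove[of I i0] b_def)
    have "(\<Sum>i\<in>I. b i * c i k) = 0" if "k \<in> K" for k
    proof -
      have "0 = (\<Sum>i\<in>I - {i0}. a i * c' i k)" using a(2) that by simp
      also have "\<dots> = (\<Sum>i\<in>I - {i0}. a i * c i k) - (\<Sum>i\<in>I - {i0}. a i * c i k0) / c i0 k0 * c i0 k"
        by (simp add: c'_def sum_subtractf right_diff_distrib sum_divide_distrib sum_distrib_right mult.assoc)
      finally show ?thesis unfolding sum_b s_def by simp
    qed
    moreover have "(\<Sum>i\<in>I. b i * c i k0) = 0" unfolding sum_b s_def using i0(2) by simp
    moreover have "\<exists>i\<in>I. b i \<noteq> 0" using a(1) by (auto simp: b_def)
    ultimately show ?thesis by auto
  qed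
qed

text \<open>Bounding each exponent separately makes the admissible monomials a box, whose size is a
  power.\<close>

definition mp_expo_le :: "nat \<Rightarrow> ('n, 'a::zero) mpoly \<Rightarrow> bool" where
  "mp_expo_le B p \<longleftrightarrow> (\<forall>m\<in>Poly_Mapping.keys p. \<forall>i. expo m i \<le> B)"

lemma mp_expo_le_mult:
  "mp_expo_le A p \<Longrightarrow> mp_expo_le B q \<Longrightarrow> mp_expo_le (A + B) (p * q :: ('n, 'a::comm_semiring_1) mpoly)"
  using keys_mult[of p q] by (fastforce simp: mp_expo_le_def lookup_add intro: add_mono)

lemma mp_expo_le_one: "mp_expo_le 0 (1 :: ('n, 'a::comm_semiring_1) mpoly)"
  by (simp add: mp_expo_le_def)

lemma mp_expo_le_power:
  "mp_expo_le A p \<Longrightarrow> mp_expo_le (n * A) (p ^ n :: ('n, 'a::comm_semiring_1) mpoly)"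
  by (induction n) (auto intro: mp_expo_le_mult mp_expo_le_one)

lemma mp_expo_le_prod:
  "finite I \<Longrightarrow> (\<And>i. i \<in> I \<Longrightarrow> mp_expo_le (A i) (p i)) \<Longrightarrow>
    mp_expo_le (sum A I) (prod p I :: ('n, 'a::comm_semiring_1) mpoly)"
  by (induction I rule: finite_induct) (auto intro: mp_expo_le_mult mp_expo_le_one)

lemma mp_expo_le_mono: "mp_expo_le A p \<Longrightarrow> A \<le> B \<Longrightarrow> mp_expo_le B p"
  unfolding mp_expo_le_def using le_trans by blast

lemma mp_expo_le_exists: "\<exists>B. mp_expo_le B (p :: ('n::finite, 'a::zero) mpoly)"
proof -
  have "expo m i \<le> (\<Sum>m\<in>Poly_Mapping.keys p. \<Sum>i\<in>UNIV. expo m i)" if "m \<in> Poly_Mapping.keys p" for m i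
  proof -
    have "expo m i \<le> (\<Sum>i\<in>UNIV. expo m i)" by (simp add: member_le_sum)
    also have "\<dots> \<le> (\<Sum>m\<in>Poly_Mapping.keys p. \<Sum>i\<in>UNIV. expo m i)"
      using that by (intro member_le_sum) auto
    finally show ?thesis .
  qed
  then show ?thesis unfolding mp_expo_le_def by blast
qed

definition expo_box :: "nat \<Rightarrow> ('n::finite \<Rightarrow>\<^sub>0 nat) set" where
  "expo_box N = {m. \<forall>i. expo m i \<le> N}"

lemma card_expo_box: "finite (expo_box N :: ('n::finite \<Rightarrow>\<^sub>0 nat) set)"
  "card (expo_box N :: ('n::finite \<Rightarrow>\<^sub>0 nat) set) = (N + 1) ^ CARD('n)"
proof -
  have eq: "expo ` (expo_box N :: ('n \<Rightarrow>\<^sub>0 nat) set) = PiE UNIV (\<lambda>_. {..N})"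
  proof safe
    fix g :: "'n \<Rightarrow> nat" assume g: "g \<in> PiE UNIV (\<lambda>_. {..N})"
    have "Abs_poly_mapping g \<in> expo_box N" using g by (auto simp: expo_box_def)
    then show "g \<in> expo ` (expo_box N :: ('n \<Rightarrow>\<^sub>0 nat) set)"
      by (rule image_eqI[rotated]) simp
  qed (auto simp: expo_box_def)
  have inj: "inj_on expo (expo_box N :: ('n \<Rightarrow>\<^sub>0 nat) set)"
    by (rule inj_onI) (rule poly_mapping_eqI, rule fun_cong)
  have "finite (expo ` (expo_box N :: ('n \<Rightarrow>\<^sub>0 nat) set))" unfolding eq by (intro finite_PiE) auto
  then show "finite (expo_box N :: ('n \<Rightarrow>\<^sub>0 nat) set)" using inj by (rule finite_imageD)
  show "card (expo_box N :: ('n \<Rightarrow>\<^sub>0 nat) set) = (N + 1) ^ CARD('n)"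
    unfolding card_image[OF inj, symmetric] eq by (simp add: card_PiE)
qed

text \<open>
  The number of monomials of partial degree at most \<open>N\<close> in \<open>x\<close> and the \<open>F i\<close> grows like \<open>N^5\<close>, but
  these are polynomials of partial degree \<open>O(N)\<close> in only four variables.
\<close>

lemma algebraic_over_subalgebra:
  fixes F :: "4 \<Rightarrow> (4, 'a::field) mpoly" and x :: "(4, 'a) mpoly"
  shows "\<exists>P. P \<noteq> 0 \<and> poly (map_poly (mp_comp F) P) x = 0"
proof -
  have "\<forall>i. \<exists>B. mp_expo_le B (F i)" using mp_expo_le_exists by blast
  from choice[OF this] obtain B where B: "\<And>i. mp_expo_le (B i) (F i)" by blast
  obtain C where C: "mp_expo_le C x" using mp_expo_le_exists by blast
  define \<delta> where "\<delta> = C + (\<Sum>i\<in>UNIV. B i)"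
  have F\<delta>: "mp_expo_le \<delta> (F i)" for i
    using B[of i] member_le_sum[of i UNIV B] by (intro mp_expo_le_mono[OF B]) (simp add: \<delta>_def trans_le_add2)
  have x\<delta>: "mp_expo_le \<delta> x" by (rule mp_expo_le_mono[OF C]) (simp add: \<delta>_def)
  \<comment> \<open>Products of powers of \<open>x\<close> and of the four \<open>F i\<close>, with
    exponents at most \<open>N\<close>, have partial degrees at most 5 N \<delta>. With this
    \<open>N\<close>, the bound for \<open>card K\<close> is N (N + 1)^4, just below
    \<open>card I\<close> = (N + 1)^5.\<close>
  define N where "N = (5 * \<delta> + 1) ^ 4"
  define I :: "(nat \<times> (4 \<Rightarrow>\<^sub>0 nat)) set" where "I = {..N} \<times> expo_box N"
  define K :: "(4 \<Rightarrow>\<^sub>0 nat) set" where "K = expo_box (5 * N * \<delta>)"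
  define M where "M = (\<lambda>(a, m). x ^ a * (\<Prod>i\<in>UNIV. F i ^ expo m i))"
  have fin: "finite I" "finite K" by (simp_all add: I_def K_def card_expo_box)
  have "card K = (5 * N * \<delta> + 1) ^ 4" by (simp add: K_def card_expo_box)
  also have "\<dots> \<le> ((5 * \<delta> + 1) * (N + 1)) ^ 4" by (intro power_mono) (simp_all add: algebra_simps)
  also have "\<dots> = N * (N + 1) ^ 4" by (simp only: power_mult_distrib N_def)
  also have "\<dots> < (N + 1) * (N + 1) ^ 4" by simp
  also have "\<dots> = card I" by (simp add: I_def card_cartesian_product card_expo_box)
  finally have "card K < card I" .
  from underdetermined_system[OF fin(2,1) this, of "\<lambda>i k. mp_coeff (M i) k"]
  obtain a where a: "\<exists>i\<in>I. a i \<noteq> 0" "\<forall>k\<in>K. (\<Sum>i\<in>I. a i * mp_coeff (M i) k) = 0" by blast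
  have zero: "(\<Sum>i\<in>I. mp_const (a i) * M i) = 0"
  proof (rule poly_mapping_eqI)
    fix k
    have "mp_coeff (M i) k = 0" if "i \<in> I" "k \<notin> K" for i
    proof (rule ccontr)
      assume "mp_coeff (M i) k \<noteq> 0"
      then have k: "k \<in> Poly_Mapping.keys (M i)" by (simp add: in_keys_iff)
      obtain b m where i: "i = (b, m)" by (cases i)
      with that have bm: "b \<le> N" "\<And>i. expo m i \<le> N" by (auto simp: I_def expo_box_def)
      have "mp_expo_le (b * \<delta> + (\<Sum>i\<in>UNIV. expo m i * \<delta>)) (M i)"
        unfolding M_def i prod.case
        by (intro mp_expo_le_mult mp_expo_le_power mp_expo_le_prod x\<delta> F\<delta>) simp
      moreover have "b * \<delta> + (\<Sum>i\<in>UNIV. expo m i * \<delta>) \<le> N * \<delta> + (\<Sum>i\<in>(UNIV :: 4 set). N * \<delta>)"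
        using bm by (intro add_mono sum_mono mult_right_mono) auto
      ultimately have "mp_expo_le (5 * N * \<delta>) (M i)" by (elim mp_expo_le_mono) simp
      with k that(2) show False by (auto simp: mp_expo_le_def K_def expo_box_def)
    qed
    then show "mp_coeff (\<Sum>i\<in>I. mp_const (a i) * M i) k = mp_coeff 0 k"
      using a(2) by (cases "k \<in> K") (simp_all add: lookup_sum mp_coeff_const_mult)
  qed
  \<comment> \<open>The relation sorted by powers of \<open>x\<close>. \<open>Q b\<close> is a
    formal polynomial, into which the \<open>F i\<close> are still to be substituted; this keeps P
    nonzero.\<close>
  define Q where "Q b = (\<Sum>m\<in>expo_box N. Poly_Mapping.single m (a (b, m)))" for b
  define P where "P = (\<Sum>b\<le>N. monom (Q b) b)"
  have coeff_P: "coeff P b = Q b" if "b \<le> N" for b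
    using that by (simp add: P_def coeff_sum coeff_monom if_distrib cong: if_cong)
  from a(1) obtain b m where bm: "b \<le> N" "m \<in> expo_box N" "a (b, m) \<noteq> 0" by (auto simp: I_def)
  have "mp_coeff (Q b) m = a (b, m)"
    using bm(2) by (simp add: Q_def lookup_sum lookup_single when_def card_expo_box)
  with bm have "P \<noteq> 0" using coeff_P[of b] by auto
  have map_monom: "map_poly (mp_comp F) (monom c b) = monom (mp_comp F c) b" for c b
    by (rule poly_eqI) (simp add: coeff_map_poly)
  have map_add: "map_poly (mp_comp F) (p + q) = map_poly (mp_comp F) p + map_poly (mp_comp F) q" for p q
    by (rule poly_eqI) (simp add: coeff_map_poly mp_comp_add)
  have map_sum: "map_poly (mp_comp F) (sum p S) = (\<Sum>i\<in>S. map_poly (mp_comp F) (p i))" if "finite S"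
    for p and S :: "nat set"
    using that by (induction S) (simp_all add: map_add)
  have comp_single: "mp_comp F (Poly_Mapping.single m c) = mp_const c * (\<Prod>i\<in>UNIV. F i ^ expo m i)" for m c
    by (simp add: mp_comp_def mp_insertion_single)
  have "poly (map_poly (mp_comp F) P) x = (\<Sum>b\<le>N. \<Sum>m\<in>expo_box N. mp_const (a (b, m)) * M (b, m))"
    by (simp add: P_def map_sum map_monom poly_sum poly_monom Q_def mp_comp_sum comp_single M_def
        sum_distrib_right sum_distrib_left mult_ac)
  also have "\<dots> = (\<Sum>i\<in>I. mp_const (a i) * M i)"
    unfolding I_def sum.cartesian_product by (simp add: case_prod_unfold)
  finally show ?thesis using zero \<open>P \<noteq> 0\<close> by auto
qed

lemma pderiv_poly_comp:
  fixes F :: "4 \<Rightarrow> (4, 'a::field_char_0) mpoly" and x :: "(4, 'a) mpoly"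
  shows "mp_pderiv l (poly (map_poly (mp_comp F) P) x) =
    (\<Sum>i\<in>UNIV. poly (map_poly (\<lambda>c. mp_comp F (mp_pderiv i c)) P) x * mp_pderiv l (F i)) +
    poly (map_poly (mp_comp F) (pderiv P)) x * mp_pderiv l x"
proof (induction P)
  case (pCons c P)
  have map_pCons: "map_poly g (pCons c P) = pCons (g c) (map_poly g P)" if "g 0 = 0"
    for g :: "(4, 'a) mpoly \<Rightarrow> (4, 'a) mpoly" and c P
    using that by (intro poly_eqI) (simp add: coeff_map_poly coeff_pCons split: nat.split)
  have map_add: "map_poly (mp_comp F) (p + q) = map_poly (mp_comp F) p + map_poly (mp_comp F) q" for p q
    by (rule poly_eqI) (simp add: coeff_map_poly mp_comp_add)
  show ?case
    by (simp add: map_pCons map_add mp_pderiv_add mp_pderiv_mult mp_pderiv_comp pderiv_pCons pCons.IH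
        sum.distrib sum_distrib_left algebra_simps)
qed simp

text \<open>Without a relation, each variable \<open>x_j\<close> has a polynomial P of least degree
  over the formal coefficients, of positive degree, and its derivative does not vanish at
  \<open>x_j\<close>. Differentiating P(F, x_j) = 0 shows that a combination of the rows of the
  Jacobian matrix is nonzero exactly in column j. Hence a multiple of the matrix is diagonal with
  nonzero determinant.\<close>

lemma jacobian_criterion:
  fixes F :: "4 \<Rightarrow> (4, 'a::field_char_0) mpoly"
  assumes "det (\<chi> i l. mp_pderiv l (F i)) = 0"
  shows "\<exists>g. g \<noteq> 0 \<and> mp_comp F g = 0"
proof (rule ccontr)
  assume no: "\<not> ?thesis"
  have "\<exists>q t. t \<noteq> 0 \<and> (\<forall>l. (\<Sum>i\<in>UNIV. q i * mp_pderiv l (F i)) = (if l = j then t else 0))" for j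
  proof -
    define root where "root P \<longleftrightarrow> P \<noteq> 0 \<and> poly (map_poly (mp_comp F) P) (mp_var j) = 0" for P
    obtain P0 where "root P0" using algebraic_over_subalgebra[of F "mp_var j"] by (auto simp: root_def)
    then obtain P where P: "root P" "\<And>Q. root Q \<Longrightarrow> degree P \<le> degree Q"
      using arg_min_nat_lemma[of root P0 degree] by blast
    have "degree P \<noteq> 0"
    proof
      assume "degree P = 0"
      then obtain c where c: "P = [:c:]" by (rule degree_eq_zeroE)
      have "map_poly (mp_comp F) [:c:] = [:mp_comp F c:]"
        by (rule poly_eqI) (simp add: coeff_map_poly coeff_pCons split: nat.split)
      with P(1) have "c \<noteq> 0" "mp_comp F c = 0" by (auto simp: root_def c)
      with no show False by blast
    qed
    then have "pderiv P \<noteq> 0" by (simp add: pderiv_eq_0_iff)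
    moreover have "degree (pderiv P) < degree P"
      using \<open>degree P \<noteq> 0\<close> by (simp add: degree_pderiv)
    ultimately have t: "poly (map_poly (mp_comp F) (pderiv P)) (mp_var j) \<noteq> 0"
      using P(2)[of "pderiv P"] by (auto simp: root_def)
    let ?q = "\<lambda>i. poly (map_poly (\<lambda>c. mp_comp F (mp_pderiv i c)) P) (mp_var j)"
    have "(\<Sum>i\<in>UNIV. ?q i * mp_pderiv l (F i)) =
        (if l = j then - poly (map_poly (mp_comp F) (pderiv P)) (mp_var j) else 0)" for l
      using pderiv_poly_comp[of l F P "mp_var j"] P(1)
      by (simp add: root_def mp_pderiv_var eq_neg_iff_add_eq_0 split: if_splits)
    with t show ?thesis
      by (intro exI[of _ ?q] exI[of _ "- poly (map_poly (mp_comp F) (pderiv P)) (mp_var j)"]) simp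
  qed
  then have "\<forall>j. \<exists>q t. t \<noteq> 0 \<and> (\<forall>l. (\<Sum>i\<in>UNIV. q i * mp_pderiv l (F i)) = (if l = j then t else 0))" ..
  from choice[OF this] obtain q
    where "\<forall>j. \<exists>t. t \<noteq> 0 \<and> (\<forall>l. (\<Sum>i\<in>UNIV. q j i * mp_pderiv l (F i)) = (if l = j then t else 0))" ..
  from choice[OF this] obtain t
    where "\<forall>j. t j \<noteq> 0 \<and> (\<forall>l. (\<Sum>i\<in>UNIV. q j i * mp_pderiv l (F i)) = (if l = j then t j else 0))" ..
  then have qt: "\<And>j. t j \<noteq> 0"
    "\<And>j l. (\<Sum>i\<in>UNIV. q j i * mp_pderiv l (F i)) = (if l = j then t j else 0)" by simp_all
  have "(\<chi> j i. q j i) ** (\<chi> i l. mp_pderiv l (F i)) = (\<chi> j l. if l = j then t j else 0)"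
    by (simp add: matrix_matrix_mult_def qt(2))
  then have "det (\<chi> j i. q j i) * det (\<chi> i l. mp_pderiv l (F i)) = det (\<chi> j l. if l = j then t j else 0)"
    by (simp only: det_mul[symmetric])
  also have "\<dots> = (\<Prod>j\<in>UNIV. t j)" by (subst det_diagonal) simp_all
  finally show False using assms qt(1) by simp
qed


subsection \<open>Relations between the partial derivatives\<close>

lemma mp_hc_sum: "mp_hc n (sum q I) = (\<Sum>i\<in>I. mp_hc n (q i))"
  by (induction I rule: infinite_finite_induct) (simp_all add: mp_hc_add)

lemma mp_sum_hc: "mp_deg_less N p \<Longrightarrow> p = (\<Sum>n<N. mp_hc n p)"
  by (rule poly_mapping_eqI)
    (auto simp: lookup_sum mp_coeff_hc mp_deg_less_def in_keys_iff)

text \<open>Substituting forms of the same positive degree sends components of different degrees to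
  different degrees, so each component of a relation is a relation.\<close>

lemma homogeneous_relation:
  fixes F :: "'n::finite \<Rightarrow> ('m::finite, 'a::comm_ring_1) mpoly" and g :: "('n, 'a) mpoly"
  assumes F: "\<And>i. mp_homogeneous e (F i)" "e > 0" and g: "g \<noteq> 0" "mp_comp F g = 0"
  shows "\<exists>n g'. mp_homogeneous n g' \<and> g' \<noteq> 0 \<and> mp_comp F g' = 0"
proof -
  obtain N where N: "mp_deg_less N g" using mp_deg_less_exists by blast
  have "mp_comp F (mp_hc n g) = 0" if "n < N" for n
  proof -
    have "0 = mp_hc (n * e) (mp_comp F (\<Sum>k<N. mp_hc k g))" using g(2) by (simp flip: mp_sum_hc[OF N])
    also have "\<dots> = (\<Sum>k<N. if k = n then mp_comp F (mp_hc k g) else 0)"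
      unfolding mp_comp_sum mp_hc_sum
      using F(2) by (intro sum.cong refl, subst mp_hc_homogeneous[OF mp_homogeneous_comp[OF mp_homogeneous_hc F(1)]]) auto
    also have "\<dots> = mp_comp F (mp_hc n g)" using that by simp
    finally show ?thesis by simp
  qed
  moreover have "\<exists>n<N. mp_hc n g \<noteq> 0"
  proof (rule ccontr)
    assume "\<not> ?thesis"
    then have "(\<Sum>n<N. mp_hc n g) = 0" by (intro sum.neutral) auto
    with g(1) mp_sum_hc[OF N] show False by simp
  qed
  ultimately show ?thesis using mp_homogeneous_hc by blast
qed

text \<open>The values of \<open>h\<close> lie in the vertex space and are orthogonal to
  \<open>w\<close>. This says that the derivative of \<open>g\<close> along \<open>w\<close> is
  again a relation between the partial derivatives of \<open>f\<close>, of smaller degree. By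
  induction it vanishes at \<open>w\<close>, and Euler's identity gives g(w) = 0.\<close>

lemma polar_relation_vanishes:
  fixes f g :: "(4, 'a::field_char_0) mpoly"
  assumes f: "mp_homogeneous d f" "d \<ge> 2"
    and g: "mp_homogeneous n g" "mp_comp (\<lambda>i. mp_pderiv i f) g = 0"
    and w: "\<And>q. mp_dconst q f = 0 \<Longrightarrow> dotp q w = 0"
  shows "mp_eval g w = 0"
  using g w
proof (induction n arbitrary: g w)
  case 0
  then obtain c where "g = mp_const c" using mp_homogeneous_0_imp_const by blast
  with 0 show ?case by simp
next
  case (Suc n g w)
  let ?F = "\<lambda>i. mp_pderiv i f"
  define h where "h i = mp_comp ?F (mp_pderiv i g)" for i
  \<comment> \<open>The chain rule for g(\<nabla>f) = 0, combined with the symmetry of the second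
    derivatives of \<open>f\<close>.\<close>
  have hF: "mp_dir h (?F j) = 0" for j
  proof -
    have "mp_dir h (?F j) = (\<Sum>i\<in>UNIV. h i * mp_pderiv j (?F i))"
      by (simp add: mp_dir_def mp_pderiv_commute[of _ j])
    also have "\<dots> = 0" using mp_pderiv_comp[of j ?F g] Suc.prems(2) by (simp add: h_def)
    finally show ?thesis .
  qed
  have hh: "mp_dir h (h k) = 0" for k
  proof -
    have "mp_dir h (h k) = (\<Sum>i\<in>UNIV. \<Sum>m\<in>UNIV. mp_comp ?F (mp_pderiv m (mp_pderiv k g)) * (h i * mp_pderiv i (?F m)))"
      by (simp add: mp_dir_def h_def[of k] mp_pderiv_comp sum_distrib_left mult_ac)
    also have "\<dots> = (\<Sum>m\<in>UNIV. mp_comp ?F (mp_pderiv m (mp_pderiv k g)) * mp_dir h (?F m))"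
      by (subst sum.swap) (simp add: mp_dir_def sum_distrib_left)
    also have "\<dots> = 0" by (simp add: hF)
    finally show ?thesis .
  qed
  \<comment> \<open>Applying the derivation to Euler's identity gives d times D f on one side and D
    f on the other, as D kills the partial derivatives; here d is not 1.\<close>
  have hf: "mp_dir h f = 0"
  proof -
    have "mp_const (of_nat d) * mp_dir h f = mp_dir h (\<Sum>j\<in>UNIV. mp_var j * ?F j)"
      by (simp add: mp_euler[OF f(1)] mp_dir_mult)
    also have "\<dots> = mp_dir h f" by (simp add: mp_dir_sum mp_dir_mult hF) (simp add: mp_dir_def)
    finally have "mp_const (of_nat d - 1) * mp_dir h f = 0" by (simp add: mp_const_minus left_diff_distrib)
    moreover have "of_nat d - 1 \<noteq> (0::'a)" using f(2) by (simp add: flip: of_nat_diff)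
    ultimately show ?thesis by simp
  qed
  have hom: "mp_homogeneous (n * (d - 1)) (h i)" for i
    unfolding h_def using mp_homogeneous_pderiv[OF Suc.prems(1)] mp_homogeneous_pderiv[OF f(1)]
    by (intro mp_homogeneous_comp) simp_all
  have inv: "mp_dconst (mp_evals h v) f = 0" for v
    by (rule quasi_translation_invariant[OF hom hh hf hF])
  define gw where "gw = mp_dconst w g"
  have "mp_comp ?F gw = 0"
  proof (rule mp_eval_all_zero_imp_zero)
    fix v
    have "mp_eval (mp_comp ?F gw) v = (\<Sum>i\<in>UNIV. mp_evals h v $ i * w $ i)"
      by (simp add: gw_def mp_dconst_def mp_dir_def h_def mp_comp_sum mp_comp_mult mult.commute)
    then show "mp_eval (mp_comp ?F gw) v = 0" using Suc.prems(3)[OF inv] by simp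
  qed
  moreover have "mp_homogeneous n gw"
    unfolding gw_def mp_dconst_def mp_dir_def using mp_homogeneous_pderiv[OF Suc.prems(1)]
    by (intro mp_homogeneous_sum mp_homogeneous_const_mult) simp
  ultimately have "mp_eval gw w = 0" using Suc.IH Suc.prems(3) by blast
  moreover have "mp_eval gw w = of_nat (Suc n) * mp_eval g w"
    using arg_cong[OF mp_euler[OF Suc.prems(1)], of "\<lambda>p. mp_eval p w"]
    by (simp add: gw_def mp_eval_dconst del: of_nat_Suc)
  ultimately show ?case by (simp del: of_nat_Suc)
qed

lemma hessian_zero_imp_vertex:
  fixes f :: "(4, 'a::field_char_0) mpoly"
  assumes f: "mp_homogeneous d f" "d \<ge> 2" and hess: "hessian f = 0"
  shows "\<exists>q. q \<noteq> 0 \<and> mp_dconst q f = 0"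
proof (rule ccontr)
  assume no: "\<not> ?thesis"
  let ?F = "\<lambda>i. mp_pderiv i f"
  have "det (\<chi> i l. mp_pderiv l (?F i)) = 0"
    using hess by (simp add: hessian_def mp_pderiv_commute)
  then obtain g0 where "g0 \<noteq> 0" "mp_comp ?F g0 = 0" using jacobian_criterion[of ?F] by blast
  moreover have "mp_homogeneous (d - 1) (?F i)" for i by (rule mp_homogeneous_pderiv[OF f(1)])
  ultimately obtain n g where g: "mp_homogeneous n g" "g \<noteq> 0" "mp_comp ?F g = 0"
    using homogeneous_relation[of "d - 1" ?F g0] f(2) by auto
  have "mp_eval g w = 0" for w
  proof (rule polar_relation_vanishes[OF f g(1,3)])
    fix q assume "mp_dconst q f = 0"
    with no have "q = 0" by blast
    then show "dotp q w = 0" by simp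
  qed
  then have "g = 0" by (rule mp_eval_all_zero_imp_zero)
  with g(2) show False ..
qed

subsection \<open>Linear algebra\<close>

lemma independent_columns_of_invertible:
  fixes B :: "('a::field ^ 'n) set"
  assumes B: "vec.independent B"
  shows "\<exists>(A :: 'a ^ 'n ^ 'n) \<phi>. invertible A \<and> inj_on \<phi> B \<and> (\<forall>v\<in>B. column (\<phi> v) A = v)"
proof -
  define E where "E = vec.extend_basis B"
  have E: "B \<subseteq> E" "vec.independent E" "vec.span E = UNIV"
    using vec.extend_basis_superset[OF B] vec.independent_extend_basis[OF B] vec.span_extend_basis[OF B]
    by (auto simp: E_def)
  have "finite E" using E(2) by (rule vec.finiteI_independent)
  moreover have "card E = card (UNIV :: 'n set)"
    using vec.dim_eq_card_independent[OF E(2)] E(3) vec.dim_span[of E] by (simp add: vec.dim_UNIV card_cart_basis)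
  ultimately obtain \<phi> :: "'a ^ 'n \<Rightarrow> 'n" where \<phi>: "bij_betw \<phi> E UNIV"
    using finite_same_card_bij[of E "UNIV :: 'n set"] by auto
  define A :: "'a ^ 'n ^ 'n" where "A = (\<chi> i j. inv_into E \<phi> j $ i)"
  have col: "column j A = inv_into E \<phi> j" for j by (simp add: A_def column_def vec_eq_iff)
  have "columns A = E"
  proof -
    have "columns A = inv_into E \<phi> ` UNIV" by (auto simp: columns_def col)
    also have "\<dots> = E" using bij_betw_imp_surj_on[OF bij_betw_inv_into[OF \<phi>]] .
    finally show ?thesis .
  qed
  then have "invertible A"
    unfolding invertible_right_inverse matrix_right_invertible_span_columns using E(3) by simp
  moreover have "inj_on \<phi> B" using \<phi> E(1) by (auto simp: bij_betw_def intro: inj_on_subset)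
  moreover have "column (\<phi> v) A = v" if "v \<in> B" for v
    unfolding col using \<phi> E(1) that by (auto simp: bij_betw_def)
  ultimately show ?thesis by (intro exI conjI ballI)
qed

text \<open>For an invertible matrix with a basis of \<open>S\<close> among its columns, the
  transpose maps the orthogonal complement onto a coordinate subspace.\<close>

lemma dim_orthogonal_complement:
  fixes S :: "('a::field ^ 'n) set"
  assumes S: "vec.subspace S"
  shows "vec.dim {w. \<forall>q\<in>S. dotp q w = 0} = CARD('n) - vec.dim S"
proof -
  obtain B where B: "B \<subseteq> S" "vec.independent B" "S \<subseteq> vec.span B" "card B = vec.dim S"
    using vec.basis_exists[of S] by blast
  obtain A :: "'a ^ 'n ^ 'n" and \<phi> where A: "invertible A" "inj_on \<phi> B" "\<forall>v\<in>B. column (\<phi> v) A = v"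
    using independent_columns_of_invertible[OF B(2)] by (elim exE conjE)
  let ?U = "{w. \<forall>q\<in>S. dotp q w = 0}"
  let ?T = "transpose A"
  have T: "(?T *v w) $ \<phi> v = dotp v w" if "v \<in> B" for v w
  proof -
    have "A $ i $ \<phi> v = v $ i" for i using arg_cong[OF A(3)[THEN bspec, OF that], of "\<lambda>x. x $ i"] by (simp add: column_def)
    then show ?thesis by (simp add: matrix_vector_mult_def transpose_def)
  qed
  have U: "w \<in> ?U \<longleftrightarrow> (\<forall>v\<in>B. (?T *v w) $ \<phi> v = 0)" for w
  proof
    assume "w \<in> ?U"
    then show "\<forall>v\<in>B. (?T *v w) $ \<phi> v = 0" using B(1) T by auto
  next
    assume w: "\<forall>v\<in>B. (?T *v w) $ \<phi> v = 0"
    let ?K = "{q. dotp q w = 0}"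
    have "vec.subspace ?K"
      by (rule vec.subspaceI)
        (auto simp: distrib_right sum.distrib mult.assoc simp flip: sum_distrib_left)
    moreover have "B \<subseteq> ?K" using w T by auto
    ultimately have "vec.span B \<subseteq> ?K" by (rule vec.span_minimal[rotated])
    with B(3) show "w \<in> ?U" by auto
  qed
  obtain C where C: "?T ** C = mat 1" "C ** ?T = mat 1"
    using A(1) unfolding invertible_def by (metis matrix_transpose_mul transpose_mat)
  have CT: "C *v (?T *v w) = w" "?T *v (C *v w) = w" for w
    by (simp_all only: matrix_vector_mul_assoc C matrix_vector_mul_lid)
  have inj: "inj ((*v) ?T)" using CT(1) by (metis injI)
  have "(*v) ?T ` ?U = {x. \<forall>i. i \<notin> - (\<phi> ` B) \<longrightarrow> x $ i = 0}"
  proof (intro equalityI subsetI)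
    fix x :: "'a ^ 'n" assume x: "x \<in> {x. \<forall>i. i \<notin> - (\<phi> ` B) \<longrightarrow> x $ i = 0}"
    have "C *v x \<in> ?U" unfolding U CT(2) using x by simp
    then show "x \<in> (*v) ?T ` ?U" using CT(2)[of x, symmetric] by (rule image_eqI[rotated])
  next
    fix x assume "x \<in> (*v) ?T ` ?U"
    then obtain w where w: "w \<in> ?U" "x = ?T *v w" by (elim imageE)
    from w(1) have "\<forall>v\<in>B. (?T *v w) $ \<phi> v = 0" unfolding U .
    then show "x \<in> {x. \<forall>i. i \<notin> - (\<phi> ` B) \<longrightarrow> x $ i = 0}" unfolding w(2) by auto
  qed
  then have "vec.dim ((*v) ?T ` ?U) = card (- (\<phi> ` B))" by (simp only: dim_substandard_cart)
  moreover have "vec.dim ((*v) ?T ` ?U) = vec.dim ?U"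
    using inj by (intro vec.dim_image_eq matrix_vector_mul_linear_gen) (auto intro: inj_on_subset)
  moreover have "card (- (\<phi> ` B)) = CARD('n) - vec.dim S"
    using B(4) card_image[OF A(2)] by (simp add: Compl_eq_Diff_UNIV card_Diff_subset)
  ultimately show ?thesis by simp
qed

lemma dim_hyperplane_kernel:
  fixes c :: "'a::field ^ 'n"
  assumes "c \<noteq> 0"
  shows "vec.dim {w. dotp c w = 0} = CARD('n) - 1"
proof -
  have "{w. \<forall>q\<in>vec.span {c}. dotp q w = 0} = {w. dotp c w = 0}"
  proof safe
    fix w q assume w: "dotp c w = 0" and "q \<in> vec.span {c}"
    then obtain k where "q = k *s c" by (auto simp: vec.span_singleton)
    then have "dotp q w = k * dotp c w"
      by (simp add: sum_distrib_left mult.assoc)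
    with w show "dotp q w = 0" by simp
  qed (auto intro: vec.span_base)
  moreover have "vec.dim (vec.span {c}) = 1"
    using assms by (simp add: vec.dim_span_eq_card_independent del: vec.dim_span)
  ultimately show ?thesis
    using dim_orthogonal_complement[OF vec.subspace_span, of "{c}"] by simp
qed

lemma subspace_kernel: "vec.subspace {w. dotp c w = (0 :: 'a::field)}"
  by (rule vec.subspaceI)
    (auto simp: distrib_left sum.distrib mult.left_commute[of _ "_ :: 'a"] simp flip: sum_distrib_left)


subsection \<open>Points of projective space\<close>

lemma proj_point_iff: "w \<in> proj_point v \<longleftrightarrow> (\<exists>c. w = c *s v)"
  by (auto simp: proj_point_def vec.span_singleton)

lemma self_in_proj_point: "v \<in> proj_point v"
  by (simp add: proj_point_def vec.span_base)

lemma proj_spaceE: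
  assumes "p \<in> proj_space"
  obtains v where "v \<noteq> 0" "p = proj_point v"
  using assms by (auto simp: proj_space_def)

lemma proj_point_in_space: "v \<noteq> 0 \<Longrightarrow> proj_point v \<in> proj_space"
  by (auto simp: proj_space_def)

lemma proj_point_in_linear:
  assumes "v \<noteq> 0" "vec.subspace W"
  shows "proj_point v \<in> proj_linear W \<longleftrightarrow> v \<in> W"
  using assms vec.span_minimal[of "{v}" W] vec.span_base[of v "{v}"]
  by (auto simp: proj_linear_def proj_point_in_space) (auto simp: proj_point_def)

lemma proj_point_in_zeros:
  fixes G :: "('n::finite, 'a::field) mpoly set"
  assumes "v \<noteq> 0" "\<And>g. g \<in> G \<Longrightarrow> \<exists>e. mp_homogeneous e g"
  shows "proj_point v \<in> proj_zeros G \<longleftrightarrow> (\<forall>g\<in>G. mp_eval g v = 0)"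
proof
  assume "proj_point v \<in> proj_zeros G"
  then show "\<forall>g\<in>G. mp_eval g v = 0" using self_in_proj_point[of v] by (auto simp: proj_zeros_def)
next
  assume z: "\<forall>g\<in>G. mp_eval g v = 0"
  have "mp_eval g w = 0" if "g \<in> G" "w \<in> proj_point v" for g w
  proof -
    from that(2) obtain c where "w = c *s v" by (auto simp: proj_point_iff)
    with assms(2)[OF that(1)] z that(1) show ?thesis by (auto simp: mp_eval_scale)
  qed
  with assms(1) show "proj_point v \<in> proj_zeros G" by (auto simp: proj_zeros_def proj_point_in_space)
qed

lemma proj_point_in_hypersurface:
  fixes f :: "('n::finite, 'a::field) mpoly"
  assumes "v \<noteq> 0" "mp_homogeneous d f"
  shows "proj_point v \<in> proj_hypersurface f \<longleftrightarrow> mp_eval f v = 0"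
  unfolding proj_hypersurface_def using assms by (subst proj_point_in_zeros) auto

lemma proj_linearE:
  assumes "y \<in> proj_linear W"
  obtains v where "v \<noteq> 0" "y = proj_point v"
  using assms by (auto simp: proj_linear_def elim: proj_spaceE)

lemma proj_hypersurfaceE:
  assumes "y \<in> proj_hypersurface f"
  obtains v where "v \<noteq> 0" "y = proj_point v"
  using assms by (auto simp: proj_hypersurface_def proj_zeros_def elim: proj_spaceE)

lemma proj_point_in_line_through:
  fixes y a b :: "'a::field ^ 'n"
  assumes "y \<noteq> 0"
  shows "proj_point y \<in> proj_line_through (proj_point a) (proj_point b) \<longleftrightarrow> (\<exists>s t. y = s *s a + t *s b)"
proof -
  have "vec.span (proj_point a \<union> proj_point b) = vec.span {a, b}"
  proof (rule antisym)
    show "vec.span (proj_point a \<union> proj_point b) \<subseteq> vec.span {a, b}"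
      unfolding proj_point_def by (intro vec.span_minimal Un_least vec.span_mono vec.subspace_span) auto
    show "vec.span {a, b} \<subseteq> vec.span (proj_point a \<union> proj_point b)"
      using self_in_proj_point by (intro vec.span_mono) auto
  qed
  moreover have "y \<in> vec.span {a, b} \<longleftrightarrow> (\<exists>s t. y = s *s a + t *s b)"
  proof
    assume "y \<in> vec.span {a, b}"
    then obtain s t where "y - s *s a = t *s b"
      unfolding vec.span_breakdown_eq[of y a] vec.span_singleton by blast
    then have "y = s *s a + t *s b" by (simp add: algebra_simps)
    then show "\<exists>s t. y = s *s a + t *s b" by blast
  next
    assume "\<exists>s t. y = s *s a + t *s b"
    then obtain s t where y: "y = s *s a + t *s b" by blast
    show "y \<in> vec.span {a, b}"
      unfolding y by (intro vec.span_add vec.span_scale vec.span_base) simp_all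
  qed
  ultimately show ?thesis
    unfolding proj_line_through_def
    using proj_point_in_linear[OF assms, of "vec.span (proj_point a \<union> proj_point b)"] by simp
qed

lemma zariski_closed_hypersurface: "mp_homogeneous d f \<Longrightarrow> zariski_closed (proj_hypersurface f)"
  unfolding zariski_closed_def proj_hypersurface_def by (intro exI[of _ "{f}"]) auto

lemma zariski_closed_orthogonal:
  fixes S :: "('a::field ^ 'n::finite) set"
  shows "zariski_closed (proj_linear {w. \<forall>q\<in>S. dotp q w = 0})"
proof -
  have "proj_linear {w. \<forall>q\<in>S. dotp q w = 0} = proj_zeros (mp_linform ` S)"
    by (auto simp: proj_linear_def proj_zeros_def mp_eval_linform)
  moreover have "\<forall>g\<in>mp_linform ` S. \<exists>e. mp_homogeneous e g" using mp_homogeneous_linform by auto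
  ultimately show ?thesis unfolding zariski_closed_def by (intro exI conjI)
qed


subsection \<open>The vertex of a hypersurface\<close>

definition vertex_space :: "('n::finite, 'a::comm_ring_1) mpoly \<Rightarrow> ('a ^ 'n) set" where
  "vertex_space f = {q. mp_dconst q f = 0}"

lemma subspace_vertex_space: "vec.subspace (vertex_space (f :: ('n::finite, 'a::field) mpoly))"
proof (rule vec.subspaceI)
  show "0 \<in> vertex_space f" by (simp add: vertex_space_def mp_dconst_def mp_dir_def)
  show "x + y \<in> vertex_space f" if "x \<in> vertex_space f" "y \<in> vertex_space f" for x y
    using that by (simp add: vertex_space_def mp_dconst_def mp_dir_def mp_const_add distrib_right sum.distrib)
  show "c *s x \<in> vertex_space f" if "x \<in> vertex_space f" for c x
    using that
    by (simp add: vertex_space_def mp_dconst_def mp_dir_def mp_const_mult mult.assoc flip: sum_distrib_left)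
qed

lemma vertex_space_translate:
  fixes f :: "('n::{finite, linorder}, 'a::field_char_0) mpoly"
  assumes "q \<in> vertex_space f"
  shows "mp_eval f (v + t *s q) = mp_eval f v" "mp_eval f (v + q) = mp_eval f v"
  using mp_dconst_invariant[of q f v t] mp_dconst_invariant[of q f v 1] assms
  by (simp_all add: vertex_space_def)

text \<open>
  If the zero set is stable under translation along \<open>q\<close>, the restriction of \<open>f\<close> to a line in
  direction \<open>q\<close> vanishes identically or has no root.
\<close>

lemma vertex_spaceI:
  fixes f :: "('n::{finite, linorder}, 'a::{alg_closed_field, field_char_0}) mpoly"
  assumes "\<And>v t. mp_eval f v = 0 \<Longrightarrow> mp_eval f (v + t *s q) = 0"
  shows "q \<in> vertex_space f"
proof -
  have "mp_eval (mp_dconst q f) v = 0" for v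
  proof -
    have "degree (mp_line f v q) = 0"
    proof (rule ccontr)
      assume deg: "degree (mp_line f v q) \<noteq> 0"
      then obtain t where t: "poly (mp_line f v q) t = 0"
        using alg_closed_imp_poly_has_root[of "mp_line f v q"] by auto
      have "poly (mp_line f v q) s = 0" for s
      proof -
        have "v + t *s q + (s - t) *s q = v + s *s q" by (simp add: vec_eq_iff algebra_simps)
        with assms[of "v + t *s q" "s - t"] t show ?thesis by (simp add: poly_mp_line)
      qed
      then have "mp_line f v q = 0" using poly_all_0_iff_0 by blast
      with deg show False by simp
    qed
    then have "pderiv (mp_line f v q) = 0" by (simp add: pderiv_eq_0_iff)
    then show ?thesis using poly_pderiv_mp_line[of f v q 0] by simp
  qed
  then show ?thesis unfolding vertex_space_def by (auto intro: mp_eval_all_zero_imp_zero)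
qed

lemma mp_pderiv_lin_subst:
  "mp_pderiv k (mp_lin_subst A f) = mp_lin_subst A (mp_dconst (column k A) f)"
proof -
  have eq: "mp_lin_subst A = mp_comp (\<lambda>i. \<Sum>j\<in>UNIV. mp_const (A $ i $ j) * mp_var j)"
    by (simp add: fun_eq_iff mp_lin_subst_def mp_comp_def)
  have "mp_pderiv k (\<Sum>j\<in>UNIV. mp_const (A $ i $ j) * mp_var j) = mp_const (A $ i $ k)" for i
    by (simp add: mp_pderiv_sum mp_pderiv_mult mp_pderiv_var if_distrib[where f = "\<lambda>x. _ * x"] cong: if_cong)
  then show ?thesis
    unfolding eq mp_pderiv_comp
    by (simp add: mp_dconst_def mp_dir_def mp_comp_sum mp_comp_mult column_def mult.commute)
qed

lemma mp_eval_lin_subst: "mp_eval (mp_lin_subst A f) v = mp_eval f (A *v v)"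
proof -
  have "mp_lin_subst A f = mp_comp (\<lambda>i. \<Sum>j\<in>UNIV. mp_const (A $ i $ j) * mp_var j) f"
    by (simp add: mp_lin_subst_def mp_comp_def)
  then show ?thesis by (simp add: mp_eval_comp matrix_vector_mult_def)
qed

lemma not_in_vars_iff:
  fixes f :: "('n::finite, 'a::field_char_0) mpoly"
  shows "k \<notin> mp_vars f \<longleftrightarrow> mp_pderiv k f = 0"
proof
  assume "k \<notin> mp_vars f"
  then have "expo m k = 0" if "m \<in> Poly_Mapping.keys f" for m
    using that by (auto simp: mp_vars_def in_keys_iff)
  then show "mp_pderiv k f = 0" by (simp add: mp_pderiv_def)
next
  assume "mp_pderiv k f = 0"
  then have "expo m k = 0" if "m \<in> Poly_Mapping.keys f" for m
    using mp_pderiv_eq_0_imp_coeff that by (auto simp: in_keys_iff)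
  then show "k \<notin> mp_vars f" by (auto simp: mp_vars_def in_keys_iff)
qed

text \<open>After the substitution \<open>A\<close>, the k-th partial derivative is the derivative
  along the k-th column. So a missing variable is the same as a column in the vertex space, and
  every nonzero vector is a column of some invertible matrix.\<close>

lemma is_cone_iff:
  fixes f :: "('n::finite, 'a::field_char_0) mpoly"
  shows "is_cone f \<longleftrightarrow> (\<exists>q. q \<noteq> 0 \<and> q \<in> vertex_space f)"
proof
  assume "is_cone f"
  then obtain A k where A: "invertible A" "k \<notin> mp_vars (mp_lin_subst A f)" by (auto simp: is_cone_def)
  then obtain B where B: "A ** B = mat 1" "B ** A = mat 1" by (auto simp: invertible_def)
  have 0: "mp_lin_subst A (mp_dconst (column k A) f) = 0"
    using A(2) by (simp add: not_in_vars_iff mp_pderiv_lin_subst)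
  have "mp_eval (mp_dconst (column k A) f) v = 0" for v
  proof -
    have "v = A *v (B *v v)" by (simp add: matrix_vector_mul_assoc B)
    then have "mp_eval (mp_dconst (column k A) f) v = mp_eval (mp_lin_subst A (mp_dconst (column k A) f)) (B *v v)"
      by (simp add: mp_eval_lin_subst)
    then show ?thesis by (simp add: 0)
  qed
  then have "mp_dconst (column k A) f = 0" by (rule mp_eval_all_zero_imp_zero)
  moreover have "column k A \<noteq> 0"
  proof
    assume "column k A = 0"
    then have "A *v axis k 1 = 0" unfolding matrix_mult_sum
      by (intro sum.neutral) (simp add: axis_def)
    then have "B *v (A *v axis k 1) = 0" by (simp only: matrix_vector_mult_0_right)
    then have "axis k (1::'a) $ k = 0" by (simp add: matrix_vector_mul_assoc B)
    then show False by simp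
  qed
  ultimately show "\<exists>q. q \<noteq> 0 \<and> q \<in> vertex_space f" by (auto simp: vertex_space_def)
next
  assume "\<exists>q. q \<noteq> 0 \<and> q \<in> vertex_space f"
  then obtain q where q: "q \<noteq> 0" "mp_dconst q f = 0" by (auto simp: vertex_space_def)
  have "vec.independent {q}" using q(1) by simp
  from independent_columns_of_invertible[OF this]
  obtain A :: "'a ^ 'n ^ 'n" and \<phi> where A: "invertible A" "inj_on \<phi> {q}" "\<forall>v\<in>{q}. column (\<phi> v) A = v"
    by (elim exE conjE)
  then have "mp_pderiv (\<phi> q) (mp_lin_subst A f) = 0"
    using q(2) by (simp add: mp_pderiv_lin_subst) (simp add: mp_lin_subst_def)
  then have "mp_vars (mp_lin_subst A f) \<noteq> UNIV" using not_in_vars_iff by blast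
  with A(1) show "is_cone f" by (auto simp: is_cone_def)
qed

lemma mp_eval_of_int: "mp_eval (of_int z) v = (of_int z :: 'a::comm_ring_1)"
  by (cases z rule: int_cases2) (simp_all add: of_nat_eq_mp_const)

text \<open>The matrix of second derivatives sends \<open>q\<close> to the gradient of D_q f, which
  is 0.\<close>

lemma hessian_zero_if_vertex:
  fixes f :: "('n::finite, 'a::field_char_0) mpoly"
  assumes "q \<noteq> 0" "q \<in> vertex_space f"
  shows "hessian f = 0"
proof (rule mp_eval_all_zero_imp_zero)
  fix v
  define H where "H = (\<chi> i j. mp_eval (mp_pderiv i (mp_pderiv j f)) v)"
  have "mp_eval (hessian f) v = det H"
    by (simp add: hessian_def Determinants.det_def mp_eval_of_int H_def)
  moreover have "H *v q = 0"
  proof -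
    have "(H *v q) $ i = 0" for i
    proof -
      have "(H *v q) $ i = mp_eval (mp_pderiv i (mp_dconst q f)) v"
        by (simp add: H_def matrix_vector_mult_def mp_dconst_def mp_dir_def mp_pderiv_sum mp_pderiv_mult mult.commute)
      then show ?thesis using assms(2) by (simp add: vertex_space_def)
    qed
    then show ?thesis by (simp add: vec_eq_iff)
  qed
  then have "\<not> invertible H"
    using assms(1) unfolding invertible_left_inverse matrix_left_invertible_ker by blast
  ultimately show "mp_eval (hessian f) v = 0" by (simp add: invertible_det_nz)
qed

subsection \<open>Cones and their polar images\<close>

text \<open>f(b + t a) is the reversal of f(a + t b), whose constant term f(a) is nonzero. Comparing
  the powers of t on both sides determines the degree.\<close>

lemma form_line_degree:
  fixes f :: "('n::finite, 'a::field_char_0) mpoly"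
  assumes f: "mp_homogeneous d f" and fa: "mp_eval f a \<noteq> 0"
  shows "degree (mp_line f b a) = d"
proof -
  define L where "L = mp_line f b a"
  define M where "M = mp_line f a b"
  have "poly (monom 1 (degree L) * M) t = poly (monom 1 d * reflect_poly L) t" if t: "t \<noteq> 0" for t
  proof -
    have eq: "a + t *s b = t *s (b + inverse t *s a)" using t by (simp add: vec_eq_iff distrib_left)
    have "poly M t = t ^ d * poly L (inverse t)"
      by (simp only: M_def L_def poly_mp_line mp_eval_scale[OF f] eq)
    then show ?thesis using t by (simp add: poly_monom poly_reflect_poly_nz)
  qed
  then have eq: "monom 1 (degree L) * M = monom 1 d * reflect_poly L" by (rule poly_eqI_nonzero)
  have M0: "poly M 0 \<noteq> 0" using fa by (simp add: M_def poly_mp_line)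
  have cancel: "monom 1 (i + k) * p = monom 1 i * q \<Longrightarrow> monom 1 k * p = (q :: 'a poly)" for i k p q
  proof -
    assume "monom 1 (i + k) * p = monom 1 i * q"
    then have "monom 1 i * (monom 1 k * p) = monom 1 i * q"
      by (simp add: mult_monom flip: mult.assoc)
    then show ?thesis by simp
  qed
  have "degree L = d"
  proof (rule linorder_cases)
    assume "degree L < d"
    then obtain k where k: "d = degree L + k" "k > 0" by (metis less_imp_add_positive)
    have "monom 1 k * reflect_poly L = M" using cancel[of "degree L" k "reflect_poly L" M] eq k(1) by simp
    then have "poly M 0 = poly (monom 1 k * reflect_poly L) 0" by simp
    also have "\<dots> = 0" using k(2) by (simp add: poly_monom zero_power)
    finally show ?thesis using M0 by simp
  next
    assume "d < degree L"
    then obtain k where k: "degree L = d + k" "k > 0" by (metis less_imp_add_positive)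
    have "monom 1 k * M = reflect_poly L" using cancel[of d k M "reflect_poly L"] eq k(1) by simp
    then have "coeff (reflect_poly L) 0 = poly (monom 1 k * M) 0" by (simp add: poly_0_coeff_0)
    also have "\<dots> = 0" using k(2) by (simp add: poly_monom zero_power)
    finally have "L = 0" by simp
    with k show ?thesis by simp
  qed
  then show ?thesis by (simp add: L_def)
qed

lemma form_zero_on_line:
  fixes f :: "('n::finite, 'a::{alg_closed_field, field_char_0}) mpoly"
  assumes f: "mp_homogeneous d f" "d > 0"
  shows "\<exists>s t. (s \<noteq> 0 \<or> t \<noteq> 0) \<and> mp_eval f (s *s a + t *s b) = 0"
proof (cases "mp_eval f a = 0")
  case True
  then show ?thesis by (intro exI[of _ 1] exI[of _ 0]) simp
next
  case False
  then have "degree (mp_line f b a) > 0" using form_line_degree[OF f(1), of a b] f(2) by simp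
  then obtain s where "poly (mp_line f b a) s = 0" using alg_closed_imp_poly_has_root by blast
  then show ?thesis by (intro exI[of _ s] exI[of _ 1]) (simp add: poly_mp_line add.commute)
qed

section \<open>Vertex, join and polar image of a nonzero form\<close>

context
  fixes f :: "(4, 'k::{alg_closed_field, field_char_0}) mpoly" and d :: nat
  assumes hom: "mp_homogeneous d f" and d_pos: "d > 0" and nz: "f \<noteq> 0"
begin

lemma vertex_space_zero: "q \<in> vertex_space f \<Longrightarrow> mp_eval f q = 0"
  using vertex_space_translate(2)[of q f 0] mp_eval_homogeneous_0[OF hom d_pos] by simp

text \<open>A line in the hyperplane meets X. The point found serves to reach the vertex itself:
  \<open>proj_join\<close> uses lines through the other points only.\<close>

lemma hyperplane_has_zero:
  fixes c :: "'k ^ 4"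
  shows "\<exists>w. w \<noteq> 0 \<and> dotp c w = 0 \<and> mp_eval f w = 0"
proof -
  let ?W = "{w. dotp c w = 0}"
  have "vec.dim ?W \<ge> 2"
  proof (cases "c = 0")
    case True
    then show ?thesis using vec.dim_UNIV by (simp add: card_cart_basis)
  qed (simp add: dim_hyperplane_kernel)
  then obtain B where B: "B \<subseteq> ?W" "vec.independent B" "card B \<ge> 2"
    using vec.basis_exists[of ?W] by (metis (no_types, lifting))
  then obtain a b where ab: "a \<in> B" "b \<in> B" "a \<noteq> b"
    by (metis card_le_Suc0_iff_eq card.infinite not_less_eq_eq numeral_2_eq_2 zero_le)
  then have ind: "vec.independent {a, b}" using vec.independent_mono[OF B(2), of "{a, b}"] by simp
  obtain s t where st: "s \<noteq> 0 \<or> t \<noteq> 0" "mp_eval f (s *s a + t *s b) = 0"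
    using form_zero_on_line[OF hom d_pos] by blast
  have "s *s a + t *s b \<noteq> 0"
  proof
    assume 0: "s *s a + t *s b = 0"
    have b: "b \<notin> vec.span {a}" "a \<notin> vec.span {b}"
      using ind ab(3) vec.independent_insert[of a "{b}"] vec.independent_insert[of b "{a}"]
      by (auto simp: insert_commute)
    show False
    proof (cases "t = 0")
      case False
      have "b = (- s / t) *s a"
      proof -
        have "b $ i = - s / t * a $ i" for i
          using False arg_cong[OF 0, of "\<lambda>x. x $ i"] by (simp add: field_simps eq_neg_iff_add_eq_0)
        then show ?thesis by (simp add: vec_eq_iff)
      qed
      then have "b \<in> vec.span {a}" unfolding vec.span_singleton by blast
      with b show False by simp
    next
      case True
      with st(1) 0 have "a = 0" by (simp add: vec_eq_iff)
      with b(2) show False by (simp add: vec.span_zero)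
    qed
  qed
  moreover have "s *s a + t *s b \<in> ?W"
    using ab B(1) by (intro vec.subspace_add[OF subspace_kernel] vec.subspace_scale[OF subspace_kernel]) auto
  ultimately show ?thesis using st(2) by blast
qed

lemma dual_vector:
  fixes q :: "'k ^ 4"
  assumes "q \<noteq> 0"
  obtains c where "dotp c q = 1"
proof -
  from assms obtain k where k: "q $ k \<noteq> 0" by (auto simp: vec_eq_iff)
  then have "(\<Sum>i\<in>UNIV. axis k (inverse (q $ k)) $ i * q $ i) = 1"
    by (simp add: axis_def if_distrib[where f = "\<lambda>x. x * _"] cong: if_cong)
  then show ?thesis by (rule that)
qed

text \<open>The union of the lines already equals X, so taking the closure changes nothing. It
  serves for C = X, which gives the vertex, and for a plane section C.\<close>

lemma proj_join_eq_hypersurface: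
  assumes q: "q \<noteq> 0" "q \<in> vertex_space f" and C: "C \<subseteq> proj_hypersurface f"
    and cover: "\<And>v. v \<noteq> 0 \<Longrightarrow> mp_eval f v = 0 \<Longrightarrow>
      \<exists>s t w. v = s *s q + t *s w \<and> proj_point w \<in> C - {proj_point q}"
  shows "proj_join (proj_point q) C = proj_hypersurface f"
proof -
  let ?X = "proj_hypersurface f"
  define J where "J = (\<Union>r\<in>C - {proj_point q}. proj_line_through (proj_point q) r)"
  have "J = ?X"
  proof (intro equalityI subsetI)
    fix y assume "y \<in> J"
    then obtain r where r: "r \<in> ?X" "y \<in> proj_line_through (proj_point q) r"
      using C by (auto simp: J_def)
    obtain v where v: "v \<noteq> 0" "r = proj_point v" using r(1) by (rule proj_hypersurfaceE)
    obtain z where z: "z \<noteq> 0" "y = proj_point z"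
      using r(2) unfolding proj_line_through_def by (rule proj_linearE)
    obtain s t where st: "z = s *s q + t *s v"
      using r(2) proj_point_in_line_through[OF z(1)] by (auto simp: v z)
    have "mp_eval f z = mp_eval f (t *s v)"
      using vertex_space_translate(1)[OF q(2), of "t *s v" s] by (simp add: st add.commute)
    also have "\<dots> = 0" using r(1) proj_point_in_hypersurface[OF v(1) hom] by (simp add: v(2) mp_eval_scale[OF hom])
    finally show "y \<in> ?X" using proj_point_in_hypersurface[OF z(1) hom] by (simp add: z(2))
  next
    fix y assume y: "y \<in> ?X"
    then obtain v where v: "v \<noteq> 0" "y = proj_point v" by (rule proj_hypersurfaceE)
    with y have "mp_eval f v = 0" using proj_point_in_hypersurface[OF v(1) hom] by simp
    from cover[OF v(1) this] obtain s t w
      where w: "v = s *s q + t *s w" "proj_point w \<in> C - {proj_point q}" by blast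
    have "y \<in> proj_line_through (proj_point q) (proj_point w)"
      unfolding v(2) proj_point_in_line_through[OF v(1)] using w(1) by (intro exI)
    with w(2) show "y \<in> J" unfolding J_def by blast
  qed
  then show ?thesis
    using hull_same[of zariski_closed, OF zariski_closed_hypersurface[OF hom]]
    by (simp add: proj_join_def zariski_closure_def J_def)
qed

lemma proj_vertex_iff:
  assumes q: "q \<noteq> 0"
  shows "proj_point q \<in> proj_vertex (proj_hypersurface f) \<longleftrightarrow> q \<in> vertex_space f"
proof
  let ?X = "proj_hypersurface f"
  assume vert: "proj_point q \<in> proj_vertex ?X"
  then have join: "proj_join (proj_point q) ?X = ?X" and qX: "proj_point q \<in> ?X"
    by (auto simp: proj_vertex_def)
  from qX have fq: "mp_eval f q = 0" using proj_point_in_hypersurface[OF q hom] by simp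
  show "q \<in> vertex_space f"
  proof (rule vertex_spaceI)
    fix v t assume fv: "mp_eval f v = 0"
    show "mp_eval f (v + t *s q) = 0"
    proof (cases "v \<in> proj_point q")
      case True
      \<comment> \<open>The point \<open>q\<close> itself spans no line of the join, but here
        homogeneity suffices.\<close>
      then obtain c where "v = c *s q" by (auto simp: proj_point_iff)
      then have eq: "v + t *s q = (c + t) *s q" by (simp add: vec_eq_iff algebra_simps)
      show ?thesis unfolding eq mp_eval_scale[OF hom] using fq by simp
    next
      case False
      have v0: "v \<noteq> 0" using False by (auto simp: proj_point_iff intro: exI[of _ 0])
      have ne: "v + t *s q \<noteq> 0"
      proof
        assume "v + t *s q = 0"
        then have "v = (- t) *s q" by (simp add: vec_eq_iff eq_neg_iff_add_eq_0)
        with False show False unfolding proj_point_iff by blast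
      qed
      have "proj_point v \<in> ?X - {proj_point q}"
        using fv v0 False self_in_proj_point[of v] by (auto simp: proj_point_in_hypersurface[OF v0 hom])
      moreover have "proj_point (v + t *s q) \<in> proj_line_through (proj_point q) (proj_point v)"
        unfolding proj_point_in_line_through[OF ne] by (intro exI[of _ t] exI[of _ 1]) (simp add: add.commute)
      ultimately have "proj_point (v + t *s q) \<in> proj_join (proj_point q) ?X"
        unfolding proj_join_def zariski_closure_def by (intro hull_inc) blast
      then show ?thesis unfolding join using proj_point_in_hypersurface[OF ne hom] by simp
    qed
  qed
next
  let ?X = "proj_hypersurface f"
  assume qV: "q \<in> vertex_space f"
  have qX: "proj_point q \<in> ?X" using vertex_space_zero[OF qV] proj_point_in_hypersurface[OF q hom] by simp
  have "proj_join (proj_point q) ?X = ?X"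
  proof (rule proj_join_eq_hypersurface[OF q qV subset_refl])
    fix v assume v: "v \<noteq> 0" "mp_eval f v = 0"
    show "\<exists>s t w. v = s *s q + t *s w \<and> proj_point w \<in> ?X - {proj_point q}"
    proof (cases "proj_point v = proj_point q")
      case False
      then have "proj_point v \<in> ?X - {proj_point q}" using v proj_point_in_hypersurface[OF v(1) hom] by simp
      then show ?thesis by (intro exI[of _ 0] exI[of _ 1] exI[of _ v]) simp
    next
      case True
      then have "v \<in> proj_point q" using self_in_proj_point[of v] by simp
      then obtain k where k: "v = k *s q" unfolding proj_point_iff by blast
      \<comment> \<open>The vertex lies on the line that joins it to any other point of X; one is
        taken in a hyperplane that avoids \<open>q\<close>.\<close>
      obtain c where c: "dotp c q = 1" using dual_vector[OF q] by blast
      obtain w where w: "w \<noteq> 0" "dotp c w = 0" "mp_eval f w = 0"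
        using hyperplane_has_zero by blast
      have "proj_point w \<noteq> proj_point q"
      proof
        assume "proj_point w = proj_point q"
        then have "q \<in> proj_point w" using self_in_proj_point[of q] by simp
        then obtain k where k: "q = k *s w" unfolding proj_point_iff by blast
        have "dotp c q = k * dotp c w"
          by (simp add: k sum_distrib_left mult_ac)
        with c w(2) show False by simp
      qed
      moreover have "proj_point w \<in> ?X" using w proj_point_in_hypersurface[OF w(1) hom] by simp
      ultimately show ?thesis using k by (intro exI[of _ k] exI[of _ 0] exI[of _ w]) simp
    qed
  qed
  with qX show "proj_point q \<in> proj_vertex ?X" by (simp add: proj_vertex_def)
qed

abbreviation (input) polar_space :: "('k ^ 4) set" where
  "polar_space \<equiv> {w. \<forall>q\<in>vertex_space f. dotp q w = 0}"

lemma subspace_polar: "vec.subspace polar_space"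
  by (rule vec.subspaceI)
    (auto simp: distrib_left sum.distrib mult.left_commute[of _ "_ :: 'k"] simp flip: sum_distrib_left)

text \<open>Gradients are orthogonal to the vertex space. Conversely, a form vanishing on all
  gradients is a relation between the partial derivatives, so it vanishes on the whole
  complement.\<close>

lemma polar_image_eq:
  assumes d2: "d \<ge> 2"
  shows "polar_image f = proj_linear polar_space"
    (is "_ = proj_linear ?U")
proof -
  let ?I = "{proj_point (gradient f v) | v. v \<noteq> 0 \<and> gradient f v \<noteq> 0}"
  have grad_U: "gradient f v \<in> ?U" for v
  proof -
    have "(\<Sum>i\<in>UNIV. q $ i * gradient f v $ i) = mp_eval (mp_dconst q f) v" for q
      by (simp add: gradient_def mp_eval_dconst)
    then show ?thesis by (auto simp: vertex_space_def)
  qed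
  have "zariski_closed hull ?I = proj_linear ?U"
  proof (rule hull_unique)
    show "?I \<subseteq> proj_linear ?U" using grad_U proj_point_in_linear[OF _ subspace_polar] by auto
    show "zariski_closed (proj_linear ?U)" by (rule zariski_closed_orthogonal)
    fix T assume T: "?I \<subseteq> T" "zariski_closed T"
    then obtain G where G: "\<And>g. g \<in> G \<Longrightarrow> \<exists>e. mp_homogeneous e g" "T = proj_zeros G"
      unfolding zariski_closed_def by blast
    have vanish: "mp_eval g w = 0" if g: "g \<in> G" and w: "w \<in> ?U" for g w
    proof -
      obtain e where e: "mp_homogeneous e g" using G(1)[OF g] by blast
      let ?F = "\<lambda>i. mp_pderiv i f"
      have F0: "mp_eval (?F i) 0 = 0" for i
        using mp_eval_homogeneous_0[OF mp_homogeneous_pderiv[OF hom]] d2 by simp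
      have "\<exists>i. ?F i \<noteq> 0"
      proof (rule ccontr)
        assume "\<not> ?thesis"
        then obtain c where c: "f = mp_const c" using mp_pderiv_all_zero_imp_const[of f] by blast
        then have "c = 0" using mp_eval_homogeneous_0[OF hom d_pos] by simp
        with nz c show False by simp
      qed
      then obtain i where i: "?F i \<noteq> 0" ..
      \<comment> \<open>Zeros of the gradient contribute no point to the polar image; multiplying by
        a nonzero partial derivative covers them as well.\<close>
      have "mp_eval (mp_comp ?F g * ?F i) v = 0" for v
      proof (cases "mp_eval (?F i) v = 0")
        case False
        then have v: "v \<noteq> 0" using F0 by auto
        have ne: "gradient f v \<noteq> 0" using False by (auto simp: gradient_def vec_eq_iff)
        with v T(1) have "proj_point (gradient f v) \<in> proj_zeros G" unfolding G(2) by blast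
        then have "mp_eval g (gradient f v) = 0" using proj_point_in_zeros[OF ne G(1)] g by blast
        then show ?thesis by (simp add: mp_eval_comp gradient_def)
      qed simp
      then have "mp_comp ?F g * ?F i = 0" by (rule mp_eval_all_zero_imp_zero)
      with i have "mp_comp ?F g = 0" by simp
      from polar_relation_vanishes[OF hom d2 e this] w show ?thesis by (auto simp: vertex_space_def)
    qed
    show "proj_linear ?U \<subseteq> T"
    proof
      fix y assume y: "y \<in> proj_linear ?U"
      then obtain w where w: "w \<noteq> 0" "y = proj_point w" by (rule proj_linearE)
      with y have "w \<in> ?U" using proj_point_in_linear[OF w(1) subspace_polar] by simp
      with vanish show "y \<in> T" unfolding G(2) w(2) using proj_point_in_zeros[OF w(1) G(1)] by blast
    qed
  qed
  then show ?thesis by (simp add: polar_image_def zariski_closure_def)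
qed

lemma polar_image_plane: "d \<ge> 2 \<Longrightarrow> vec.dim (vertex_space f) = 1 \<Longrightarrow> is_proj_plane (polar_image f)"
  unfolding is_proj_plane_def using polar_image_eq subspace_polar
    dim_orthogonal_complement[OF subspace_vertex_space, of f]
  by (intro exI[of _ polar_space]) simp

lemma polar_image_line: "d \<ge> 2 \<Longrightarrow> vec.dim (vertex_space f) = 2 \<Longrightarrow> is_proj_line (polar_image f)"
  unfolding is_proj_line_def using polar_image_eq subspace_polar
    dim_orthogonal_complement[OF subspace_vertex_space, of f]
  by (intro exI[of _ polar_space]) simp

end

text \<open>The linear forms \<open>\<Lambda> i\<close> are the coordinates with respect to the columns of an invertible matrix.\<close>

lemma adapted_coordinates:
  fixes B :: "('a::field ^ 'n) set"
  assumes "vec.independent B"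
  shows "\<exists>(A :: 'a ^ 'n ^ 'n) \<phi> \<Lambda>. inj_on \<phi> B \<and> (\<forall>v\<in>B. column (\<phi> v) A = v) \<and>
    (\<forall>v. v = (\<Sum>j\<in>UNIV. dotp (\<Lambda> j) v *s column j A)) \<and>
    (\<forall>j k. dotp (\<Lambda> j) (column k A) = (if j = k then 1 else 0))"
proof -
  obtain A :: "'a ^ 'n ^ 'n" and \<phi> where A: "invertible A" "inj_on \<phi> B" "\<forall>v\<in>B. column (\<phi> v) A = v"
    using independent_columns_of_invertible[OF assms] by (elim exE conjE)
  from A(1) obtain C where C: "A ** C = mat 1" "C ** A = mat 1" by (auto simp: invertible_def)
  have coord: "(\<Sum>i\<in>UNIV. C $ j $ i * v $ i) = (C *v v) $ j" for j v
    by (simp add: matrix_vector_mult_def)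
  have "v = (\<Sum>j\<in>UNIV. (\<Sum>i\<in>UNIV. C $ j $ i * v $ i) *s column j A)" for v
    unfolding coord matrix_mult_sum[symmetric] by (simp only: matrix_vector_mul_assoc C matrix_vector_mul_lid)
  moreover have "(\<Sum>i\<in>UNIV. C $ j $ i * column k A $ i) = (if j = k then 1 else 0)" for j k
    using arg_cong[OF C(2), of "\<lambda>M. M $ j $ k"] by (simp add: matrix_matrix_mult_def column_def Finite_Cartesian_Product.mat_def)
  ultimately show ?thesis using A(2,3) by (intro exI[of _ A] exI[of _ \<phi>] exI[of _ "\<lambda>j. C $ j"]) simp
qed

section \<open>Square-free forms: the possible dimensions of the vertex space\<close>

context
  fixes f :: "(4, 'k::{alg_closed_field, field_char_0}) mpoly" and d :: nat
  assumes hom: "mp_homogeneous d f" and d2: "d \<ge> 2" and sqf: "squarefree f"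
begin

lemma nonzero: "f \<noteq> 0"
  using sqf by (auto simp: squarefree_def dest: spec[of _ 0])

lemma d_pos: "d > 0" using d2 by simp

lemma square_linform_not_dvd: "\<not> mp_linform c ^ 2 dvd f"
  using sqf mp_linform_not_unit[of c] by (auto simp: squarefree_def)

text \<open>\<open>f\<close> vanishes on its vertex space, so a point \<open>a\<close> with f(a)
  nonzero is independent of a basis \<open>B\<close> of that space. In such coordinates
  \<open>f\<close> is free of those belonging to \<open>B\<close>.\<close>

lemma coordinates_at_vertex:
  "\<exists>a B (A :: 'k ^ 4 ^ 4) \<phi> \<Lambda>. mp_eval f a \<noteq> 0 \<and> a \<notin> B \<and> finite B \<and> B \<subseteq> vertex_space f \<and>
    card B = vec.dim (vertex_space f) \<and> vertex_space f \<subseteq> vec.span B \<and>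
    inj_on \<phi> (insert a B) \<and> (\<forall>v\<in>insert a B. column (\<phi> v) A = v) \<and>
    (\<forall>v. v = (\<Sum>j\<in>UNIV. dotp (\<Lambda> j) v *s column j A)) \<and>
    (\<forall>j k. dotp (\<Lambda> j) (column k A) = (if j = k then 1 else 0))"
proof -
  obtain a where a: "mp_eval f a \<noteq> 0" using mp_nonzero_point[OF nonzero] by blast
  have aV: "a \<notin> vertex_space f" using a vertex_space_zero[OF hom d_pos nonzero] by blast
  obtain B where B: "B \<subseteq> vertex_space f" "vec.independent B" "vertex_space f \<subseteq> vec.span B"
      "card B = vec.dim (vertex_space f)"
    using vec.basis_exists[of "vertex_space f"] by blast
  have span_B: "vec.span B = vertex_space f"
    using B(1,3) vec.span_minimal[OF _ subspace_vertex_space] by blast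
  have ind: "vec.independent (insert a B)"
    using B(2) aV vec.independent_insert[of a B] unfolding span_B by (simp split: if_splits)
  have "a \<notin> B" using aV B(1) by blast
  then show ?thesis
    using adapted_coordinates[OF ind] a B(1,3,4) vec.finiteI_independent[OF B(2)]
    by (elim exE conjE) (intro exI conjI; assumption)
qed

text \<open>In dimension 3 or more, \<open>f\<close> would depend only on the coordinate along
  \<open>a\<close>. It would be a multiple of the d-th power of a linear form, which is not
  square-free for d at least 2.\<close>

lemma dim_vertex_space_le: "vec.dim (vertex_space f) \<le> 2"
proof (rule ccontr)
  assume dim: "\<not> ?thesis"
  obtain a B and A :: "'k ^ 4 ^ 4" and \<phi> \<Lambda> where a: "mp_eval f a \<noteq> 0" "a \<notin> B"
    and B: "finite B" "B \<subseteq> vertex_space f" "card B = vec.dim (vertex_space f)"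
    and A: "inj_on \<phi> (insert a B)" "\<forall>v\<in>insert a B. column (\<phi> v) A = v"
      "\<forall>v. v = (\<Sum>j\<in>UNIV. dotp (\<Lambda> j) v *s column j A)"
    using coordinates_at_vertex by (elim exE conjE) (rule that)
  have "card (\<phi> ` insert a B) \<ge> 4"
    unfolding card_image[OF A(1)] using dim B(1,3) a(2) by simp
  then have UNIV: "\<phi> ` insert a B = UNIV"
    by (intro card_seteq) simp_all
  have eval: "mp_eval f v = dotp (\<Lambda> (\<phi> a)) v ^ d * mp_eval f a" for v
  proof -
    let ?l = "\<lambda>j. dotp (\<Lambda> j) v"
    have "v = (\<Sum>j\<in>UNIV. ?l j *s column j A)" using A(3) ..
    also have "\<dots> = (\<Sum>x\<in>insert a B. ?l (\<phi> x) *s column (\<phi> x) A)"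
      unfolding UNIV[symmetric] using A(1) by (subst sum.reindex) (auto simp: o_def)
    also have "\<dots> = ?l (\<phi> a) *s a + (\<Sum>x\<in>B. ?l (\<phi> x) *s x)"
      using B(1) a(2) A(2) by simp
    finally have v: "v = ?l (\<phi> a) *s a + (\<Sum>x\<in>B. ?l (\<phi> x) *s x)" .
    have s: "(\<Sum>x\<in>B. ?l (\<phi> x) *s x) \<in> vertex_space f"
      using B(2) by (intro vec.subspace_sum vec.subspace_scale subspace_vertex_space) auto
    have "mp_eval f v = mp_eval f (?l (\<phi> a) *s a)"
      using vertex_space_translate(2)[OF s, of "?l (\<phi> a) *s a"] v by simp
    then show ?thesis by (simp add: mp_eval_scale[OF hom])
  qed
  have "f = mp_const (mp_eval f a) * mp_linform (\<Lambda> (\<phi> a)) ^ d"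
  proof (rule mp_eqI)
    fix v
    show "mp_eval f v = mp_eval (mp_const (mp_eval f a) * mp_linform (\<Lambda> (\<phi> a)) ^ d) v"
      unfolding eval[of v] by (simp add: mp_eval_linform mult.commute)
  qed
  also have "\<dots> = mp_linform (\<Lambda> (\<phi> a)) ^ 2 * (mp_const (mp_eval f a) * mp_linform (\<Lambda> (\<phi> a)) ^ (d - 2))"
  proof -
    have "mp_linform (\<Lambda> (\<phi> a)) ^ d = mp_linform (\<Lambda> (\<phi> a)) ^ 2 * mp_linform (\<Lambda> (\<phi> a)) ^ (d - 2)"
      using d2 by (simp only: power_add[symmetric] le_add_diff_inverse)
    then show ?thesis by (simp only: mult_ac)
  qed
  finally have "mp_linform (\<Lambda> (\<phi> a)) ^ 2 dvd f" by (rule dvdI)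
  with square_linform_not_dvd show False by blast
qed

lemma vertex_point_imp_dim_1:
  assumes p: "p \<in> proj_space" and vert: "proj_vertex (proj_hypersurface f) = {p}"
  shows "vec.dim (vertex_space f) = 1"
proof -
  from p obtain q where q: "q \<noteq> 0" "p = proj_point q" by (elim proj_spaceE)
  have "vertex_space f = vec.span {q}"
  proof (intro equalityI subsetI)
    fix r assume r: "r \<in> vertex_space f"
    show "r \<in> vec.span {q}"
    proof (cases "r = 0")
      case False
      then have "proj_point r = proj_point q"
        using proj_vertex_iff[OF hom d_pos nonzero False] r vert q(2) by simp
      then show ?thesis using self_in_proj_point[of r] by (simp add: proj_point_def)
    qed (simp add: vec.span_zero)
  next
    fix r assume "r \<in> vec.span {q}"
    moreover have "q \<in> vertex_space f"
      using proj_vertex_iff[OF hom d_pos nonzero q(1)] vert q(2) by simp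
    ultimately show "r \<in> vertex_space f"
      using vec.span_minimal[OF _ subspace_vertex_space, of "{q}" f] by auto
  qed
  then show ?thesis using q(1) by (simp add: vec.dim_eq_card_independent)
qed

lemma cone_over_curve_iff_dim_1:
  "is_cone_over_curve_with_point_vertex (proj_hypersurface f) \<longleftrightarrow> vec.dim (vertex_space f) = 1"
proof
  assume "is_cone_over_curve_with_point_vertex (proj_hypersurface f)"
  then show "vec.dim (vertex_space f) = 1"
    unfolding is_cone_over_curve_with_point_vertex_def using vertex_point_imp_dim_1 by blast
next
  let ?X = "proj_hypersurface f"
  assume dim: "vec.dim (vertex_space f) = 1"
  obtain B where B: "B \<subseteq> vertex_space f" "vec.independent B" "vertex_space f \<subseteq> vec.span B" "card B = 1"
    using vec.basis_exists[of "vertex_space f"] dim by auto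
  then obtain q where Bq: "B = {q}" by (auto simp: card_1_singleton_iff)
  have q: "q \<noteq> 0" "q \<in> vertex_space f" using B(1,2) by (auto simp: Bq)
  have V: "r \<in> vertex_space f \<longleftrightarrow> (\<exists>k. r = k *s q)" for r
    using B(3) vec.subspace_scale[OF subspace_vertex_space q(2)] by (auto simp: Bq vec.span_singleton)
  \<comment> \<open>The plane c . w = 0 misses the vertex. Splitting vectors along \<open>q\<close>
    projects onto it, and \<open>f\<close> is determined by its restriction to it.\<close>
  obtain c where c: "dotp c q = 1" using dual_vector[OF hom d_pos nonzero q(1)] by blast
  let ?W = "{w. dotp c w = 0}"
  define p where "p = proj_point q"
  define H where "H = proj_linear ?W"
  define C where "C = H \<inter> ?X"
  have "c \<noteq> 0" using c by auto
  then have plane: "is_proj_plane H"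
    unfolding is_proj_plane_def H_def
    by (intro exI[of _ ?W] conjI subspace_kernel refl) (simp add: dim_hyperplane_kernel)
  have p: "p \<in> proj_space" "p \<notin> H"
    using q(1) c proj_point_in_space[OF q(1)] proj_point_in_linear[OF q(1) subspace_kernel[of c]]
    by (auto simp: p_def H_def)
  have split: "\<exists>t w. v = t *s q + w \<and> w \<in> ?W" for v
  proof -
    define t where "t = dotp c v"
    have "dotp c (v - t *s q) = dotp c v - t * dotp c q"
      by (simp add: right_diff_distrib sum_subtractf sum_distrib_left mult_ac)
    then have "dotp c (v - t *s q) = 0" using c by (simp add: t_def)
    then show ?thesis by (intro exI[of _ t] exI[of _ "v - t *s q"]) simp
  qed
  have eval: "mp_eval f (t *s q + w) = mp_eval f w" for t w
    using vertex_space_translate(1)[OF q(2), of w t] by (simp add: add.commute)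
  have "C \<noteq> H"
  proof
    assume "C = H"
    have "mp_eval f v = 0" for v
    proof -
      obtain t w where v: "v = t *s q + w" "w \<in> ?W" using split by blast
      show ?thesis
      proof (cases "w = 0")
        case True
        then show ?thesis unfolding v eval using mp_eval_homogeneous_0[OF hom d_pos] by simp
      next
        case False
        then have "proj_point w \<in> H" unfolding H_def using proj_point_in_linear[OF False subspace_kernel] v(2) by simp
        with \<open>C = H\<close> have "proj_point w \<in> ?X" by (auto simp: C_def)
        then show ?thesis unfolding v eval using proj_point_in_hypersurface[OF False hom] by simp
      qed
    qed
    then have "f = 0" by (rule mp_eval_all_zero_imp_zero)
    with nonzero show False ..
  qed
  then have curve: "is_plane_curve H C"
    unfolding is_plane_curve_def using plane hom d_pos C_def by blast
  have CI: "proj_point w \<in> C - {p}" if "w \<noteq> 0" "w \<in> ?W" "mp_eval f w = 0" for w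
    using that p(2) proj_point_in_linear[OF that(1) subspace_kernel[of c]] proj_point_in_hypersurface[OF that(1) hom]
    by (auto simp: C_def H_def)
  have join: "proj_join p C = ?X"
    unfolding p_def
  proof (rule proj_join_eq_hypersurface[OF hom d_pos nonzero q])
    show "C \<subseteq> ?X" by (simp add: C_def)
    fix v assume "mp_eval f v = 0"
    obtain t w where vw: "v = t *s q + w" "w \<in> ?W" using split by blast
    show "\<exists>s t w. v = s *s q + t *s w \<and> proj_point w \<in> C - {proj_point q}"
    proof (cases "w = 0")
      case False
      have "mp_eval f w = 0" using \<open>mp_eval f v = 0\<close> unfolding vw(1) eval .
      then have "proj_point w \<in> C - {p}" using CI False vw(2) by blast
      then show ?thesis by (intro exI[of _ t] exI[of _ 1] exI[of _ w]) (simp add: vw(1) p_def)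
    next
      case True
      \<comment> \<open>Here \<open>v\<close> is a multiple of \<open>q\<close>, which lies on the
        line to any point of C.\<close>
      obtain w' where w': "w' \<noteq> 0" "dotp c w' = 0" "mp_eval f w' = 0"
        using hyperplane_has_zero[OF hom d_pos nonzero] by blast
      then have "proj_point w' \<in> C - {p}" using CI by blast
      then show ?thesis by (intro exI[of _ t] exI[of _ 0] exI[of _ w']) (simp add: vw(1) True p_def)
    qed
  qed
  have "proj_vertex ?X = {p}"
  proof (intro equalityI subsetI)
    fix y assume y: "y \<in> proj_vertex ?X"
    then have "y \<in> ?X" by (simp add: proj_vertex_def)
    then obtain v where v: "v \<noteq> 0" "y = proj_point v" by (rule proj_hypersurfaceE)
    with y have "v \<in> vertex_space f" using proj_vertex_iff[OF hom d_pos nonzero v(1)] by simp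
    then obtain k where k: "v = k *s q" using V by blast
    with v(1) have "k \<noteq> 0" by auto
    have "proj_point v = proj_point q"
    proof (intro equalityI subsetI)
      fix x assume "x \<in> proj_point q"
      then obtain s where "x = s *s q" by (auto simp: proj_point_iff)
      then have "x = (s / k) *s v" using \<open>k \<noteq> 0\<close> by (simp add: k)
      then show "x \<in> proj_point v" unfolding proj_point_iff by blast
    qed (auto simp: proj_point_iff k)
    then show "y \<in> {p}" by (simp add: p_def v(2))
  next
    fix y assume "y \<in> {p}"
    then show "y \<in> proj_vertex ?X" using proj_vertex_iff[OF hom d_pos nonzero q(1)] q(2) by (simp add: p_def)
  qed
  with curve p join[symmetric] show "is_cone_over_curve_with_point_vertex ?X"
    unfolding is_cone_over_curve_with_point_vertex_def by blast
qed

text \<open>Translation along the common line preserves each plane, so the underlying space of the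
  line lies in the vertex space, whose dimension is at most 2.\<close>

lemma planes_imp_dim_2:
  assumes "consists_of_planes_through_line d (proj_hypersurface f)"
  shows "vec.dim (vertex_space f) = 2"
proof -
  let ?X = "proj_hypersurface f"
  from assms[unfolded consists_of_planes_through_line_def]
  obtain L P where L: "is_proj_line L" and P: "finite P" "card P = d"
    "\<forall>H\<in>P. is_proj_plane H \<and> L \<subseteq> H" "?X = \<Union>P"
    by (elim exE conjE) (rule that)
  from L[unfolded is_proj_line_def] obtain W where W: "vec.subspace W" "vec.dim W = 2" "L = proj_linear W"
    by (elim exE conjE) (rule that)
  have P_linear: "\<exists>U. H = proj_linear U \<and> vec.subspace U" if "H \<in> P" for H
  proof -
    have "is_proj_plane H" using P(3) that by blast
    then show ?thesis unfolding is_proj_plane_def by (elim exE conjE) (intro exI conjI)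
  qed
  have "q \<in> vertex_space f" if qW: "q \<in> W" for q
  proof (cases "q = 0")
    case True
    then show ?thesis using vec.subspace_0[OF subspace_vertex_space] by simp
  next
    case False
    show ?thesis
    proof (rule vertex_spaceI)
      fix v t assume v: "mp_eval f v = 0"
      show "mp_eval f (v + t *s q) = 0"
      proof (cases "v + t *s q = 0")
        case True
        then show ?thesis using mp_eval_homogeneous_0[OF hom d_pos] by simp
      next
        case ne: False
        have "\<exists>H\<in>P. \<exists>U. H = proj_linear U \<and> vec.subspace U \<and> v \<in> U"
        proof (cases "v = 0")
          case True
          \<comment> \<open>The zero vector defines no projective point, but it lies in each of the
            linear subspaces, and there is a plane as d > 0.\<close>
          have "P \<noteq> {}" using P(2) d_pos by auto
          then obtain H where "H \<in> P" by blast
          then obtain U where "H = proj_linear U" "vec.subspace U" using P_linear by blast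
          with \<open>H \<in> P\<close> True show ?thesis using vec.subspace_0 by blast
        next
          case False
          then have "proj_point v \<in> ?X" using v proj_point_in_hypersurface[OF False hom] by simp
          then obtain H where H: "H \<in> P" "proj_point v \<in> H" unfolding P(4) by blast
          then obtain U where U: "H = proj_linear U" "vec.subspace U" using P_linear by blast
          with H(2) have "v \<in> U" using proj_point_in_linear[OF False] by blast
          with U H(1) show ?thesis by blast
        qed
        then obtain H U where H: "H \<in> P" "H = proj_linear U" "vec.subspace U" "v \<in> U" by blast
        have "proj_point q \<in> L" unfolding W(3) using proj_point_in_linear[OF False W(1)] qW by simp
        with P(3) H(1) have "proj_point q \<in> proj_linear U" unfolding H(2)[symmetric] by blast
        then have "q \<in> U" using proj_point_in_linear[OF False H(3)] by simp
        then have "v + t *s q \<in> U" using H(3,4) by (intro vec.subspace_add vec.subspace_scale)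
        then have "proj_point (v + t *s q) \<in> H" unfolding H(2) using proj_point_in_linear[OF ne H(3)] by simp
        then have "proj_point (v + t *s q) \<in> ?X" unfolding P(4) using H(1) by blast
        then show ?thesis using proj_point_in_hypersurface[OF ne hom] by simp
      qed
    qed
  qed
  then have "vec.dim W \<le> vec.dim (vertex_space f)" by (intro vec.dim_subset) auto
  with W(2) dim_vertex_space_le show ?thesis by simp
qed

lemma mp_eval_prod_mset: "mp_eval (\<Prod>x\<in>#M. g x) v = (\<Prod>x\<in>#M. mp_eval (g x) v)"
  by (induction M) simp_all

text \<open>\<open>f\<close> is a binary form in the two coordinates \<xi> and \<mu> transverse to
  the vertex space. It splits into linear forms over an algebraically closed field, and these are
  distinct because \<open>f\<close> is square-free.\<close>

lemma dim_2_imp_planes: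
  assumes dim: "vec.dim (vertex_space f) = 2"
  shows "consists_of_planes_through_line d (proj_hypersurface f)"
proof -
  let ?X = "proj_hypersurface f"
  obtain a B and A :: "'k ^ 4 ^ 4" and \<phi> \<Lambda> where a: "mp_eval f a \<noteq> 0" and "a \<notin> B" "finite B"
    and B: "B \<subseteq> vertex_space f" "card B = vec.dim (vertex_space f)" "vertex_space f \<subseteq> vec.span B"
    and A: "inj_on \<phi> (insert a B)" "\<forall>v\<in>insert a B. column (\<phi> v) A = v"
      "\<forall>v. v = (\<Sum>j\<in>UNIV. dotp (\<Lambda> j) v *s column j A)"
      "\<forall>j k. dotp (\<Lambda> j) (column k A) = (if j = k then 1 else 0)"
    using coordinates_at_vertex by (elim exE conjE) (rule that)
  have "card (- \<phi> ` insert a B) = 1"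
    using card_image[OF A(1)] B(2) dim \<open>finite B\<close> \<open>a \<notin> B\<close> by (simp add: Compl_eq_Diff_UNIV card_Diff_subset)
  then obtain m where m: "- \<phi> ` insert a B = {m}" by (auto simp: card_1_singleton_iff)
  have UNIV: "UNIV = insert m (\<phi> ` insert a B)" and m_notin: "m \<notin> \<phi> ` insert a B" using m by auto
  define b where "b = column m A"
  define \<xi> where "\<xi> v = dotp (\<Lambda> (\<phi> a)) v" for v
  define \<mu> where "\<mu> v = dotp (\<Lambda> m) v" for v
  have ab: "\<xi> a = 1" "\<mu> a = 0" "\<xi> b = 0" "\<mu> b = 1"
    using A(4)[rule_format, of "\<phi> a" "\<phi> a"] A(4)[rule_format, of m "\<phi> a"]
      A(4)[rule_format, of "\<phi> a" m] A(4)[rule_format, of m m] A(2) m_notin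
    by (auto simp: \<xi>_def \<mu>_def b_def)
  have lin: "\<xi> (x + y) = \<xi> x + \<xi> y" "\<mu> (x + y) = \<mu> x + \<mu> y" "\<xi> (t *s x) = t * \<xi> x" "\<mu> (t *s x) = t * \<mu> x" for x y t
    by (simp_all add: \<xi>_def \<mu>_def distrib_left sum.distrib sum_distrib_left mult_ac)
  have lin0: "\<xi> 0 = 0" "\<mu> 0 = 0" by (simp_all add: \<xi>_def \<mu>_def)
  have V0: "\<xi> q = 0 \<and> \<mu> q = 0" if "q \<in> vertex_space f" for q
  proof -
    have "vec.subspace {q. \<xi> q = 0 \<and> \<mu> q = 0}"
      by (rule vec.subspaceI) (auto simp: lin lin0)
    moreover have "B \<subseteq> {q. \<xi> q = 0 \<and> \<mu> q = 0}"
    proof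
      fix x assume x: "x \<in> B"
      then have "\<phi> x \<noteq> \<phi> a" "\<phi> x \<noteq> m" using A(1) \<open>a \<notin> B\<close> m_notin by (auto simp: inj_on_def)
      with x show "x \<in> {q. \<xi> q = 0 \<and> \<mu> q = 0}"
        using A(4)[rule_format, of "\<phi> a" "\<phi> x"] A(4)[rule_format, of m "\<phi> x"] A(2)
        by (auto simp: \<xi>_def \<mu>_def)
    qed
    ultimately have "vec.span B \<subseteq> {q. \<xi> q = 0 \<and> \<mu> q = 0}" by (rule vec.span_minimal[rotated])
    with B(3) that show ?thesis by blast
  qed
  have eval: "mp_eval f v = mp_eval f (\<xi> v *s a + \<mu> v *s b)" for v
  proof -
    define c where "c j = dotp (\<Lambda> j) v" for j
    have "v = (\<Sum>j\<in>UNIV. c j *s column j A)" unfolding c_def using A(3) ..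
    also have "\<dots> = (\<Sum>j\<in>insert m (\<phi> ` insert a B). c j *s column j A)"
      by (simp only: UNIV[symmetric])
    also have "\<dots> = \<mu> v *s b + (\<Sum>j\<in>\<phi> ` insert a B. c j *s column j A)"
      using m_notin \<open>finite B\<close> by (subst sum.insert) (simp_all add: c_def \<mu>_def b_def)
    also have "(\<Sum>j\<in>\<phi> ` insert a B. c j *s column j A) = (\<Sum>x\<in>insert a B. c (\<phi> x) *s column (\<phi> x) A)"
      using A(1) by (subst sum.reindex) (simp_all add: o_def)
    also have "\<mu> v *s b + \<dots> = \<xi> v *s a + \<mu> v *s b + (\<Sum>x\<in>B. c (\<phi> x) *s x)"
      using \<open>finite B\<close> \<open>a \<notin> B\<close> A(2) by (simp add: \<xi>_def c_def)
    finally have v: "v = \<xi> v *s a + \<mu> v *s b + (\<Sum>x\<in>B. c (\<phi> x) *s x)" .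
    have s: "(\<Sum>x\<in>B. c (\<phi> x) *s x) \<in> vertex_space f"
      using B(1) by (intro vec.subspace_sum vec.subspace_scale subspace_vertex_space) auto
    show ?thesis using vertex_space_translate(2)[OF s, of "\<xi> v *s a + \<mu> v *s b"] v by simp
  qed
  define form where "form \<alpha> = mp_linform (\<Lambda> (\<phi> a) - \<alpha> *s \<Lambda> m)" for \<alpha>
  have form: "mp_eval (form \<alpha>) v = \<xi> v - \<alpha> * \<mu> v" for \<alpha> v
    by (simp add: form_def mp_eval_linform \<xi>_def \<mu>_def left_diff_distrib sum_subtractf sum_distrib_left mult.assoc)
  \<comment> \<open>The dehomogenization \<mu> = 1. As f(a) is nonzero, there is no root at
    infinity, and all d factors are visible.\<close>
  define l where "l = mp_line f b a"
  have deg: "degree l = d" unfolding l_def by (rule form_line_degree[OF hom a])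
  then have "l \<noteq> 0" using d_pos by auto
  then obtain M where M: "size M = d" "l = smult (lead_coeff l) (\<Prod>x\<in>#M. [:-x, 1:])"
    using alg_closed_imp_factorization[of l] deg by blast
  have poly_l: "poly l s = lead_coeff l * (\<Prod>x\<in>#M. s - x)" for s
  proof -
    have "poly (\<Prod>x\<in>#N. [:-x, 1:]) s = (\<Prod>x\<in>#N. s - x)" for N
      by (induction N) (simp_all add: algebra_simps)
    then show ?thesis by (subst M(2)) simp
  qed
  \<comment> \<open>The identity follows from homogeneity where \<mu> is nonzero; the extra factor
    takes care of the hyperplane \<mu> = 0.\<close>
  have "(f - mp_const (lead_coeff l) * (\<Prod>\<alpha>\<in>#M. form \<alpha>)) * mp_linform (\<Lambda> m) = 0"
  proof (rule mp_eval_all_zero_imp_zero)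
    fix v
    have "mp_eval f v = lead_coeff l * (\<Prod>\<alpha>\<in>#M. \<xi> v - \<alpha> * \<mu> v)" if nz: "\<mu> v \<noteq> 0"
    proof -
      have eq: "\<xi> v *s a + \<mu> v *s b = \<mu> v *s (b + (\<xi> v / \<mu> v) *s a)"
        using nz by (simp add: vec_eq_iff distrib_left add.commute)
      have prod: "(\<Prod>\<alpha>\<in>#N. \<xi> v - \<alpha> * \<mu> v) = \<mu> v ^ size N * (\<Prod>\<alpha>\<in>#N. \<xi> v / \<mu> v - \<alpha>)" for N
        using nz by (induction N) (simp_all add: field_simps)
      show ?thesis
        unfolding eval[of v] eq mp_eval_scale[OF hom] poly_mp_line[symmetric] l_def[symmetric] poly_l prod M(1)
        by (simp add: mult_ac)
    qed
    then show "mp_eval ((f - mp_const (lead_coeff l) * (\<Prod>\<alpha>\<in>#M. form \<alpha>)) * mp_linform (\<Lambda> m)) v = 0"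
      by (cases "\<mu> v = 0") (simp_all add: mp_eval_linform mp_eval_prod_mset form flip: \<mu>_def)
  qed
  moreover have "mp_linform (\<Lambda> m) \<noteq> 0" using ab(4) mp_eval_linform[of "\<Lambda> m" b] by (auto simp: \<mu>_def)
  ultimately have f_prod: "f = mp_const (lead_coeff l) * (\<Prod>\<alpha>\<in>#M. form \<alpha>)" by simp
  have "count M \<alpha> \<le> 1" for \<alpha>
  proof (rule ccontr)
    assume "\<not> ?thesis"
    then obtain N where N: "M = add_mset \<alpha> (add_mset \<alpha> N)"
      by (metis One_nat_def count_add_mset count_greater_zero_iff diff_Suc_1 mset_add not_less_eq_eq less_Suc_eq_le not_le zero_less_Suc le0 order_le_less)
    have "f = form \<alpha> ^ 2 * (mp_const (lead_coeff l) * (\<Prod>\<alpha>\<in>#N. form \<alpha>))"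
      by (subst f_prod) (simp add: N power2_eq_square mult_ac)
    then have "form \<alpha> ^ 2 dvd f" by (rule dvdI)
    with square_linform_not_dvd show False by (simp add: form_def)
  qed
  then have M_set: "mset_set (set_mset M) = M"
    by (intro multiset_eqI) (metis count_eq_zero_iff count_mset_set(1,3) finite_set_mset le_antisym Suc_leI One_nat_def neq0_conv)
  then have card: "card (set_mset M) = d" using M(1) by (metis size_mset_set)
  have zero_iff: "mp_eval f v = 0 \<longleftrightarrow> (\<exists>\<alpha>\<in>#M. \<xi> v - \<alpha> * \<mu> v = 0)" for v
    by (subst f_prod) (use \<open>l \<noteq> 0\<close> in \<open>auto simp: mp_eval_prod_mset form prod_mset_zero_iff\<close>)
  define U where "U \<alpha> = {v. dotp (\<Lambda> (\<phi> a) - \<alpha> *s \<Lambda> m) v = 0}" for \<alpha>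
  have U: "v \<in> U \<alpha> \<longleftrightarrow> \<xi> v - \<alpha> * \<mu> v = 0" for v \<alpha>
    using form[of \<alpha> v] by (simp add: U_def form_def mp_eval_linform)
  have sub_U: "vec.subspace (U \<alpha>)" for \<alpha> unfolding U_def by (rule subspace_kernel)
  have "is_proj_plane (proj_linear (U \<alpha>))" for \<alpha>
  proof -
    have "\<Lambda> (\<phi> a) - \<alpha> *s \<Lambda> m \<noteq> 0"
    proof
      assume 0: "\<Lambda> (\<phi> a) - \<alpha> *s \<Lambda> m = 0"
      show False using form[of \<alpha> a] ab unfolding form_def mp_eval_linform 0 by simp
    qed
    from dim_hyperplane_kernel[OF this] have "vec.dim (U \<alpha>) = 3" unfolding U_def by simp
    then show ?thesis unfolding is_proj_plane_def using sub_U by blast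
  qed
  moreover have "proj_linear (vertex_space f) \<subseteq> proj_linear (U \<alpha>)" for \<alpha>
    using V0 by (auto simp: proj_linear_def U)
  moreover have "is_proj_line (proj_linear (vertex_space f))"
    unfolding is_proj_line_def using subspace_vertex_space dim by blast
  moreover have "inj_on (\<lambda>\<alpha>. proj_linear (U \<alpha>)) (set_mset M)"
  proof (rule inj_onI)
    fix \<alpha> \<beta> assume eq: "proj_linear (U \<alpha>) = proj_linear (U \<beta>)"
    \<comment> \<open>This point lies on the plane \<xi> = \<alpha> \<mu>, and on the plane for
      \<beta> only if \<alpha> = \<beta>.\<close>
    define z where "z = \<alpha> *s a + b"
    have z: "\<xi> z = \<alpha>" "\<mu> z = 1" by (simp_all add: z_def lin ab)
    then have "z \<noteq> 0" using lin0 by auto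
    then have "z \<in> U \<beta>"
      using proj_point_in_linear[OF \<open>z \<noteq> 0\<close> sub_U, of \<alpha>] proj_point_in_linear[OF \<open>z \<noteq> 0\<close> sub_U, of \<beta>] eq z
      by (simp add: U)
    then show "\<alpha> = \<beta>" by (simp add: U z)
  qed
  then have "card ((\<lambda>\<alpha>. proj_linear (U \<alpha>)) ` set_mset M) = d" by (simp add: card_image card)
  moreover have "?X = \<Union>((\<lambda>\<alpha>. proj_linear (U \<alpha>)) ` set_mset M)"
  proof (intro equalityI subsetI)
    fix y assume y: "y \<in> ?X"
    then obtain v where v: "v \<noteq> 0" "y = proj_point v" by (rule proj_hypersurfaceE)
    with y have "mp_eval f v = 0" using proj_point_in_hypersurface[OF v(1) hom] by simp
    then obtain \<alpha> where "\<alpha> \<in># M" "v \<in> U \<alpha>" unfolding zero_iff U by blast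
    then show "y \<in> \<Union>((\<lambda>\<alpha>. proj_linear (U \<alpha>)) ` set_mset M)"
      using proj_point_in_linear[OF v(1) sub_U] v(2) by blast
  next
    fix y assume "y \<in> \<Union>((\<lambda>\<alpha>. proj_linear (U \<alpha>)) ` set_mset M)"
    then obtain \<alpha> where \<alpha>: "\<alpha> \<in># M" "y \<in> proj_linear (U \<alpha>)" by blast
    from \<alpha>(2) obtain v where v: "v \<noteq> 0" "y = proj_point v" by (rule proj_linearE)
    with \<alpha> have "mp_eval f v = 0"
      unfolding zero_iff using proj_point_in_linear[OF v(1) sub_U] U by blast
    then show "y \<in> ?X" using proj_point_in_hypersurface[OF v(1) hom] v(2) by simp
  qed
  ultimately show ?thesis
    unfolding consists_of_planes_through_line_def
    by (intro exI[of _ "proj_linear (vertex_space f)"] exI[of _ "(\<lambda>\<alpha>. proj_linear (U \<alpha>)) ` set_mset M"]) auto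
qed

end

theorem proposition3p5:
  fixes f :: "(4, 'k::{alg_closed_field, field_char_0}) mpoly" and d :: nat
  assumes "mp_homogeneous d f" and "d \<ge> 3" and "squarefree f"
  shows
    "(hessian f = 0 \<longleftrightarrow> is_cone f) \<and>
     (hessian f = 0 \<longleftrightarrow>
        is_cone_over_curve_with_point_vertex (proj_hypersurface f) \<or>
        consists_of_planes_through_line d (proj_hypersurface f)) \<and>
     (is_cone_over_curve_with_point_vertex (proj_hypersurface f) \<longrightarrow>
        is_proj_plane (polar_image f)) \<and>
     (consists_of_planes_through_line d (proj_hypersurface f) \<longrightarrow>
        is_proj_line (polar_image f))"
proof -
  have d2: "d \<ge> 2" and d0: "d > 0" using assms(2) by simp_all
  have nz: "f \<noteq> 0" by (rule nonzero[OF assms(1) d2 assms(3)])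
  have hess: "hessian f = 0 \<longleftrightarrow> (\<exists>q. q \<noteq> 0 \<and> q \<in> vertex_space f)"
    using hessian_zero_imp_vertex[OF assms(1) d2] hessian_zero_if_vertex
    by (auto simp: vertex_space_def)
  have planes: "consists_of_planes_through_line d (proj_hypersurface f) \<longleftrightarrow> vec.dim (vertex_space f) = 2"
    using planes_imp_dim_2[OF assms(1) d2 assms(3)] dim_2_imp_planes[OF assms(1) d2 assms(3)] by blast
  have curve: "is_cone_over_curve_with_point_vertex (proj_hypersurface f) \<longleftrightarrow> vec.dim (vertex_space f) = 1"
    by (rule cone_over_curve_iff_dim_1[OF assms(1) d2 assms(3)])
  \<comment> \<open>The dimension of the vertex space decides everything: 0 for no cone, 1 for a
    point vertex, 2 for planes through a line.\<close>
  have "(\<exists>q. q \<noteq> 0 \<and> q \<in> vertex_space f) \<longleftrightarrow> vec.dim (vertex_space f) \<noteq> 0"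
    by (auto simp: vec.dim_eq_0)
  also have "\<dots> \<longleftrightarrow> vec.dim (vertex_space f) = 1 \<or> vec.dim (vertex_space f) = 2"
    using dim_vertex_space_le[OF assms(1) d2 assms(3)] by arith
  finally show ?thesis
    unfolding is_cone_iff hess planes curve
    using polar_image_plane[OF assms(1) d0 nz d2] polar_image_line[OF assms(1) d0 nz d2] by blast
qed

end
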